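(* Let $A(t)$ be a self-adjoint holomorphic family of type (B) on a complex Hilbert space $\mathcal{H}$, and let $\Sigma(t)=\min\sigma_e(A(t))$. Suppose that $\lambda(t)<\Sigma(t)$ is an eigenvalue of $A(t)$ that depends continuously on $t$ when $t_0<t<\epsilon$, that $\lim_{t\to t_0^+}\lambda(t)=\Sigma(t_0)$, and that $\liminf_{t\to t_0^+}(\lambda(t)-\Sigma(t))/(t-t_0)<0$. Then $\Sigma(t_0)$ is an eigenvalue of $A(t_0)$. Furthermore, $\lim_{t\to t_0^+}(\lambda(t)-\Sigma(t_0))/(t-t_0)$ exists and is equal to an eigenvalue of the bounded self-adjoint operator $B_0$ on $\mathcal{H}$ defined by $\langle B_0x,y\rangle=\mathfrak{a}_1[Px,Py]$ for all $x,y\in\mathcal{H}$, where $P$ is the orthogonal projection onto the kernel of $A(t_0)-\Sigma(t_0)$ and $\mathfrak{a}_1$ is the coefficient of $(t-t_0)$ in the power series expansion around $t_0$ of the family of sesquilinear forms $\mathfrak{a}(t)$ corresponding to $A(t)$.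
   Context: For a sesquilinear form $\mathfrak{t}$ on $\mathcal{H}$ with domain $\mathcal{D}(\mathfrak{t})$, write $\mathfrak{t}[x]=\mathfrak{t}[x,x]$, and $W(\mathfrak{t})=\{\mathfrak{t}[x] : x\in\mathcal{D}(\mathfrak{t}),\ \|x\|=1\}$. The form is symmetric if $\mathfrak{t}[x,y]=\overline{\mathfrak{t}[y,x]}$. It is sectorial if there are $v\in\mathbb{C}$ and $\theta<\pi/2$ with $|\arg(z-v)|\le\theta$ for all $z\in W(\mathfrak{t})$. A sectorial form is closed if whenever $x_n\in\mathcal{D}(\mathfrak{t})$, $x_n\to x$ in $\mathcal{H}$ and $\mathfrak{t}[x_n-x_m]\to 0$ as $n,m\to\infty$, then $x\in\mathcal{D}(\mathfrak{t})$ (and $\mathfrak{t}[x_n-x]\to0$). A subspace $V\subseteq\mathcal{D}(\mathfrak{t})$ is a core of a closed form $\mathfrak{t}$ if the closure (smallest closed extension) of $\mathfrak{t}|_V$ is $\mathfrak{t}$. A family $\mathfrak{a}(t)$ of sesquilinear forms, defined for complex $t$ in an open set (here, a neighborhood in $\mathbb{C}$ of the real interval of parameters considered, in particular of the real point $t_0$), is holomorphic of type (a) if each $\mathfrak{a}(t)$ is closed and sectorial, the domain $\mathcal{D}(\mathfrak{a}(t))=:\mathcal{D}(\mathfrak{a})$ is independent of $t$ and dense in $\mathcal{H}$, and $t\mapsto\mathfrak{a}(t)[x,y]$ is holomorphic for all $x,y\in\mathcal{D}(\mathfrak{a})$. If in addition $\mathfrak{a}(t)$ is symmetric for real $t$,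 then for each such real $t$ there is a unique self-adjoint operator $A(t)$, with $\mathcal{D}(A(t))$ a core of $\mathfrak{a}(t)$ and $\langle A(t)x,y\rangle=\mathfrak{a}(t)[x,y]$ for $x,y\in\mathcal{D}(A(t))$; each $A(t)$ is bounded below. Such a family $A(t)$ is called a self-adjoint holomorphic family of type (B), and $\mathfrak{a}(t)$ is the corresponding family of forms. Near $t_0$ there are symmetric sesquilinear forms $\mathfrak{a}_k$, defined on $\mathcal{D}(\mathfrak{a})$, with $\mathfrak{a}(t)[x,y]=\sum_{k\ge0}(t-t_0)^k\mathfrak{a}_k[x,y]$ for all $x,y\in\mathcal{D}(\mathfrak{a})$. The form $(x,y)\mapsto\mathfrak{a}_1[Px,Py]$ is bounded and symmetric on $\mathcal{H}$, so $B_0$ is well defined. The essential spectrum of an operator $T$ is $\sigma_e(T)=\{\lambda\in\mathbb{C} : \exists\, x_n\in\mathcal{D}(T),\ \|x_n\|=1,\ x_n\to0 \text{ weakly},\ \|(T-\lambda)x_n\|\to0\}$. *)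

theory Defs
  imports "HOL-Complex_Analysis.Complex_Analysis"
begin

section \<open>Complex Hilbert spaces\<close>

text \<open>
  The libraries only provide real inner product spaces. A complex Hilbert space is a complete space
  with a complex scalar multiplication and a complex inner product, linear in the first and
  conjugate-linear in the second argument. Building on \<^class>\<open>real_inner\<close>, whose inner product is
  required to be the real part of the complex one, gives access to the library's lemmas on norms and
  real inner products; in particular the norm of \<open>x\<close> is the square root of \<open>cinner x x\<close>.
\<close>

class complex_hilbert = real_inner + complete_space +
  fixes scaleC :: "complex \<Rightarrow> 'a \<Rightarrow> 'a"  (infixr "*\<^sub>C" 75)
    and cinner :: "'a \<Rightarrow> 'a \<Rightarrow> complex"
  assumes scaleC_add_right: "c *\<^sub>C (x + y) = c *\<^sub>C x + c *\<^sub>C y"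
    and scaleC_add_left: "(c + d) *\<^sub>C x = c *\<^sub>C x + d *\<^sub>C x"
    and scaleC_scaleC: "c *\<^sub>C d *\<^sub>C x = (c * d) *\<^sub>C x"
    and scaleC_of_real: "complex_of_real r *\<^sub>C x = r *\<^sub>R x"
    and cinner_commute: "cinner x y = cnj (cinner y x)"
    and cinner_add_left: "cinner (x + y) z = cinner x z + cinner y z"
    and cinner_scaleC_left: "cinner (c *\<^sub>C x) y = c * cinner x y"
    and inner_eq_Re_cinner: "inner x y = Re (cinner x y)"

lemma power2_norm_eq_cinner:
  fixes x :: "'a :: complex_hilbert"
  shows "complex_of_real ((norm x)\<^sup>2) = cinner x x"
proof -
  have "Im (cinner x x) = 0"
    using arg_cong[OF cinner_commute[of x x], of Im] by simp
  then show ?thesis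
    by (simp add: complex_eq_iff power2_norm_eq_inner inner_eq_Re_cinner)
qed

definition csubspace :: "'a :: complex_hilbert set \<Rightarrow> bool" where
  "csubspace S \<longleftrightarrow>
     0 \<in> S \<and> (\<forall>x\<in>S. \<forall>y\<in>S. x + y \<in> S) \<and> (\<forall>c. \<forall>x\<in>S. c *\<^sub>C x \<in> S)"

definition clinear_on :: "'a set \<Rightarrow> ('a :: complex_hilbert \<Rightarrow> 'a) \<Rightarrow> bool" where
  "clinear_on S T \<longleftrightarrow>
     (\<forall>x\<in>S. \<forall>y\<in>S. T (x + y) = T x + T y) \<and> (\<forall>c. \<forall>x\<in>S. T (c *\<^sub>C x) = c *\<^sub>C T x)"

definition weakly_tendsto :: "(nat \<Rightarrow> 'a :: complex_hilbert) \<Rightarrow> 'a \<Rightarrow> bool" where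
  "weakly_tendsto X x \<longleftrightarrow> (\<forall>y. (\<lambda>n. cinner (X n) y) \<longlonglongrightarrow> cinner x y)"

text \<open>The point \<open>p\<close> exists and is unique when \<open>M\<close> is a closed subspace.\<close>

definition orth_proj :: "'a set \<Rightarrow> 'a \<Rightarrow> 'a :: complex_hilbert" where
  "orth_proj M x = (THE p. p \<in> M \<and> (\<forall>m\<in>M. cinner (x - p) m = 0))"


section \<open>Unbounded operators\<close>

text \<open>
  An operator is given by its domain \<open>D\<close> and a function \<open>T\<close> whose values outside \<open>D\<close> are irrelevant.
\<close>

definition op_graph :: "'a set \<Rightarrow> ('a :: complex_hilbert \<Rightarrow> 'a) \<Rightarrow> ('a \<times> 'a) set" where
  "op_graph D T = {(x, T x) | x. x \<in> D}"

definition adjoint_graph :: "'a set \<Rightarrow> ('a :: complex_hilbert \<Rightarrow> 'a) \<Rightarrow> ('a \<times> 'a) set" where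
  "adjoint_graph D T = {(y, z). \<forall>x\<in>D. cinner (T x) y = cinner x z}"

definition selfadjoint_op :: "'a set \<Rightarrow> ('a :: complex_hilbert \<Rightarrow> 'a) \<Rightarrow> bool" where
  "selfadjoint_op D T \<longleftrightarrow>
     csubspace D \<and> closure D = UNIV \<and> clinear_on D T \<and> adjoint_graph D T = op_graph D T"

definition op_kernel :: "'a set \<Rightarrow> ('a :: complex_hilbert \<Rightarrow> 'a) \<Rightarrow> 'a set" where
  "op_kernel D T = {x \<in> D. T x = 0}"

definition eigenvalue :: "'a set \<Rightarrow> ('a :: complex_hilbert \<Rightarrow> 'a) \<Rightarrow> complex \<Rightarrow> bool" where
  "eigenvalue D T l \<longleftrightarrow> (\<exists>x\<in>D. x \<noteq> 0 \<and> T x = l *\<^sub>C x)"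

definition ess_spectrum :: "'a set \<Rightarrow> ('a :: complex_hilbert \<Rightarrow> 'a) \<Rightarrow> complex set" where
  "ess_spectrum D T =
     {l. \<exists>X. (\<forall>n. X n \<in> D \<and> norm (X n) = 1) \<and> weakly_tendsto X 0 \<and>
             (\<lambda>n. norm (T (X n) - l *\<^sub>C X n)) \<longlonglongrightarrow> 0}"

text \<open>
  The minimum of a set of complex numbers all of which are real, as is the case for the essential
  spectrum of a self-adjoint operator.
\<close>

definition is_min_of :: "real \<Rightarrow> complex set \<Rightarrow> bool" where
  "is_min_of s S \<longleftrightarrow> complex_of_real s \<in> S \<and> (\<forall>r. complex_of_real r \<in> S \<longrightarrow> s \<le> r)"


section \<open>Sesquilinear forms\<close>

text \<open>
  A form is given by its domain \<open>D\<close> and a function \<open>s\<close> of two arguments whose values outside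
  \<open>D \<times> D\<close> are irrelevant.
\<close>

definition sesquilinear_form :: "'a set \<Rightarrow> ('a :: complex_hilbert \<Rightarrow> 'a \<Rightarrow> complex) \<Rightarrow> bool" where
  "sesquilinear_form D s \<longleftrightarrow> csubspace D \<and>
     (\<forall>x\<in>D. \<forall>y\<in>D. \<forall>z\<in>D. s (x + y) z = s x z + s y z) \<and>
     (\<forall>x\<in>D. \<forall>y\<in>D. \<forall>z\<in>D. s x (y + z) = s x y + s x z) \<and>
     (\<forall>c. \<forall>x\<in>D. \<forall>y\<in>D. s (c *\<^sub>C x) y = c * s x y) \<and>
     (\<forall>c. \<forall>x\<in>D. \<forall>y\<in>D. s x (c *\<^sub>C y) = cnj c * s x y)"

definition symmetric_form :: "'a set \<Rightarrow> ('a :: complex_hilbert \<Rightarrow> 'a \<Rightarrow> complex) \<Rightarrow> bool" where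
  "symmetric_form D s \<longleftrightarrow> (\<forall>x\<in>D. \<forall>y\<in>D. s x y = cnj (s y x))"

definition form_numrange :: "'a set \<Rightarrow> ('a :: complex_hilbert \<Rightarrow> 'a \<Rightarrow> complex) \<Rightarrow> complex set" where
  "form_numrange D s = {s x x | x. x \<in> D \<and> norm x = 1}"

text \<open>The vertex \<open>v\<close> itself belongs to the sector, since \<^term>\<open>Arg 0 = 0\<close>.\<close>

definition sectorial_form :: "'a set \<Rightarrow> ('a :: complex_hilbert \<Rightarrow> 'a \<Rightarrow> complex) \<Rightarrow> bool" where
  "sectorial_form D s \<longleftrightarrow>
     (\<exists>v \<theta>. \<theta> < pi / 2 \<and> (\<forall>z \<in> form_numrange D s. \<bar>Arg (z - v)\<bar> \<le> \<theta>))"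

text \<open>The convergence \<open>s[X n - X m] \<rightarrow> 0\<close> is joint in \<open>n\<close> and \<open>m\<close>.\<close>

definition closed_sectorial_form :: "'a set \<Rightarrow> ('a :: complex_hilbert \<Rightarrow> 'a \<Rightarrow> complex) \<Rightarrow> bool" where
  "closed_sectorial_form D s \<longleftrightarrow> sesquilinear_form D s \<and> sectorial_form D s \<and>
     (\<forall>X x. (\<forall>n. X n \<in> D) \<and> X \<longlonglongrightarrow> x \<and>
            ((\<lambda>(n, m). s (X n - X m) (X n - X m)) \<longlongrightarrow> 0) (sequentially \<times>\<^sub>F sequentially)
        \<longrightarrow> x \<in> D \<and> (\<lambda>n. s (X n - x) (X n - x)) \<longlonglongrightarrow> 0)"

definition form_extends ::
  "'a set \<Rightarrow> ('a :: complex_hilbert \<Rightarrow> 'a \<Rightarrow> complex) \<Rightarrow> 'a set \<Rightarrow> ('a \<Rightarrow> 'a \<Rightarrow> complex) \<Rightarrow> bool" where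
  "form_extends E r V s \<longleftrightarrow> V \<subseteq> E \<and> (\<forall>x\<in>V. \<forall>y\<in>V. r x y = s x y)"

text \<open>\<open>(D, s)\<close> is the smallest closed extension of \<open>(V, r)\<close>.\<close>

definition is_form_closure ::
  "'a set \<Rightarrow> ('a :: complex_hilbert \<Rightarrow> 'a \<Rightarrow> complex) \<Rightarrow> 'a set \<Rightarrow> ('a \<Rightarrow> 'a \<Rightarrow> complex) \<Rightarrow> bool" where
  "is_form_closure D s V r \<longleftrightarrow>
     closed_sectorial_form D s \<and> form_extends D s V r \<and>
     (\<forall>E q. closed_sectorial_form E q \<and> form_extends E q V r \<longrightarrow> form_extends E q D s)"

definition form_core ::
  "'a set \<Rightarrow> 'a set \<Rightarrow> ('a :: complex_hilbert \<Rightarrow> 'a \<Rightarrow> complex) \<Rightarrow> bool" where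
  "form_core V D s \<longleftrightarrow> csubspace V \<and> V \<subseteq> D \<and> is_form_closure D s V s"

text \<open>\<open>(DT, T)\<close> is the self-adjoint operator associated with the closed symmetric form \<open>(D, s)\<close>.\<close>

definition form_operator ::
  "'a set \<Rightarrow> ('a :: complex_hilbert \<Rightarrow> 'a \<Rightarrow> complex) \<Rightarrow> 'a set \<Rightarrow> ('a \<Rightarrow> 'a) \<Rightarrow> bool" where
  "form_operator D s DT T \<longleftrightarrow>
     selfadjoint_op DT T \<and> form_core DT D s \<and> (\<forall>x\<in>DT. \<forall>y\<in>DT. cinner (T x) y = s x y)"


section \<open>Holomorphic families\<close>

definition holomorphic_family_a ::
  "complex set \<Rightarrow> 'a set \<Rightarrow> (complex \<Rightarrow> 'a :: complex_hilbert \<Rightarrow> 'a \<Rightarrow> complex) \<Rightarrow> bool" where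
  "holomorphic_family_a U D a \<longleftrightarrow>
     open U \<and> closure D = UNIV \<and> (\<forall>z\<in>U. closed_sectorial_form D (a z)) \<and>
     (\<forall>x\<in>D. \<forall>y\<in>D. (\<lambda>z. a z x y) holomorphic_on U)"

definition selfadjoint_family_B ::
  "complex set \<Rightarrow> 'a set \<Rightarrow> (complex \<Rightarrow> 'a :: complex_hilbert \<Rightarrow> 'a \<Rightarrow> complex) \<Rightarrow>
   (real \<Rightarrow> 'a set) \<Rightarrow> (real \<Rightarrow> 'a \<Rightarrow> 'a) \<Rightarrow> bool" where
  "selfadjoint_family_B U D a DA A \<longleftrightarrow>
     holomorphic_family_a U D a \<and>
     (\<forall>t. complex_of_real t \<in> U \<longrightarrow>
        symmetric_form D (a (complex_of_real t)) \<and>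
        form_operator D (a (complex_of_real t)) (DA t) (A t))"

definition form_coeff ::
  "(complex \<Rightarrow> 'a \<Rightarrow> 'a \<Rightarrow> complex) \<Rightarrow> complex \<Rightarrow> nat \<Rightarrow> 'a :: complex_hilbert \<Rightarrow> 'a \<Rightarrow> complex" where
  "form_coeff a z0 k x y = fps_nth (fps_expansion (\<lambda>z. a z x y) z0) k"

lemma form_coeff_sums:
  assumes "holomorphic_family_a U D a" "ball z0 r \<subseteq> U" "z \<in> ball z0 r" "x \<in> D" "y \<in> D"
  shows "(\<lambda>k. (z - z0) ^ k * form_coeff a z0 k x y) sums a z x y"
proof -
  have "(\<lambda>z. a z x y) holomorphic_on ball z0 r"
    using assms unfolding holomorphic_family_a_def by (meson holomorphic_on_subset)
  from holomorphic_power_series[OF this assms(3)] show ?thesis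
    by (simp add: form_coeff_def fps_expansion_def mult.commute)
qed

end

theory Submission
  imports Defs
begin

text \<open>
  Take \<open>t0 = 0\<close>, write \<open>g t = (lam t - \<Sigma> 0) / t\<close>, and let \<open>E\<close> be the set of \<open>\<mu>\<close> with
  \<open>a1 x y = \<mu> \<langle>x, y\<rangle>\<close> for some nonzero \<open>x\<close> in the kernel of \<open>A 0 - \<Sigma> 0\<close> and all \<open>y\<close> in it. Unit
  eigenvectors at \<open>t \<rightarrow> 0\<close> with \<open>g t \<rightarrow> \<mu>\<close> have weak limits in the form domain, which are eigenvectors for \<open>\<mu>\<close>
  in this sense unless they vanish. Right difference quotients of \<open>lam\<close> at \<open>t\<close> accumulate, up to \<open>O(t)\<close>,
  at values of \<open>a1\<close> at unit eigenvectors. If a normalized weakly null sequence has \<open>a 0\<close>-values tending to \<open>\<Sigma> 0\<close> and \<open>a1\<close>-values tending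
  to \<open>\<beta>\<close>, then it shows \<open>\<Sigma> t \<le> \<Sigma> 0 + \<beta> t + O(t\<^sup>2)\<close>. By the assumption on the lower limit, \<open>g\<close> has a
  cluster point \<open>m\<close> and there is \<open>\<sigma> > m\<close> with \<open>\<beta> \<ge> \<sigma>\<close> for all such sequences. So where \<open>g\<close>
  takes a value \<open>q < \<sigma>\<close> outside \<open>E\<close>, these quotients are almost at least \<open>\<sigma>\<close>, and \<open>g\<close> is increasing:
  \<open>g\<close> cannot cross the level \<open>q\<close> infinitely often. As \<open>E\<close> is discrete below \<open>\<sigma>\<close>, this gives \<open>g \<rightarrow> m\<close>.
  Finally \<open>m \<in> E\<close>, since otherwise the quotients would be almost at least \<open>\<sigma>\<close> everywhere near \<open>0\<close>,
  and \<open>g\<close> could not tend to \<open>m < \<sigma>\<close>.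
\<close>

section \<open>Complex Hilbert spaces\<close>

text \<open>Two of the data do not compare parameters: holomorphy is given for each pair of vectors
  separately, and singular sequences lie in operator domains that may change with \<open>t\<close>.
  Uniform boundedness turns the first into estimates in one energy norm, that of the form at
  \<open>t0\<close>. For the second, the bottom of the essential spectrum is reached through form
  values along weakly null sequences in the form domain, which serve all parameters at once. One
  sequence yields only upper bounds on \<open>\<Sigma> t\<close>, but these suffice, as the lower
  limit supplies a strict gap.

  Eigenvectors cannot be followed along \<open>t\<close>, since \<open>lam t\<close> may be a
  multiple eigenvalue. So \<open>lam\<close> is never differentiated: its growth comes from weak
  limits of eigenvectors from the right, and a crossing argument looks only at the points where a
  level is met. On such a level the slope is constant, so its convergence is known there before it
  is known in general; this is why excluding the single value \<open>q\<close> from \<open>E\<close>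
  is enough.\<close>

lemma scaleC_zero_right [simp]: "c *\<^sub>C (0 :: 'a :: complex_hilbert) = 0"
  using scaleC_add_right[of c "0 :: 'a" 0] by simp

lemma scaleC_minus_one [simp]: "(-1) *\<^sub>C x = - (x :: 'a :: complex_hilbert)"
  using scaleC_of_real[of "-1" x] by simp

lemma csubspace_0: "csubspace S \<Longrightarrow> 0 \<in> S"
  and csubspace_add: "csubspace S \<Longrightarrow> x \<in> S \<Longrightarrow> y \<in> S \<Longrightarrow> x + y \<in> S"
  and csubspace_scaleC: "csubspace S \<Longrightarrow> x \<in> S \<Longrightarrow> c *\<^sub>C x \<in> S"
  by (auto simp: csubspace_def)

lemma csubspace_scaleR: "csubspace S \<Longrightarrow> x \<in> S \<Longrightarrow> r *\<^sub>R x \<in> S"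
  by (metis csubspace_scaleC scaleC_of_real)

lemma csubspace_minus: "csubspace S \<Longrightarrow> x \<in> S \<Longrightarrow> - x \<in> S"
  by (metis csubspace_scaleC scaleC_minus_one)

lemma csubspace_diff: "csubspace S \<Longrightarrow> x \<in> S \<Longrightarrow> y \<in> S \<Longrightarrow> x - y \<in> S"
  by (metis csubspace_add csubspace_minus add_uminus_conv_diff)

lemma csubspace_UNIV: "csubspace UNIV"
  by (simp add: csubspace_def)

lemma cinner_add_right: "cinner x (y + z) = cinner x y + cinner x z"
  by (metis cinner_commute cinner_add_left complex_cnj_add)

lemma cinner_scaleC_right: "cinner x (c *\<^sub>C y) = cnj c * cinner x y"
  by (metis cinner_commute cinner_scaleC_left complex_cnj_mult)

section \<open>Hilbert spaces given by a form on a subspace\<close>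

lemma sesquilinear_formD:
  assumes "sesquilinear_form D f" "x \<in> D" "y \<in> D"
  shows "z \<in> D \<Longrightarrow> f (x + y) z = f x z + f y z" "z \<in> D \<Longrightarrow> f x (y + z) = f x y + f x z"
    "f (d *\<^sub>C x) y = d * f x y" "f x (d *\<^sub>C y) = cnj d * f x y"
  using assms unfolding sesquilinear_form_def by blast+

lemma sesquilinear_form_scaleR:
  assumes "sesquilinear_form D f" "x \<in> D" "y \<in> D"
  shows "f (r *\<^sub>R x) y = of_real r * f x y" "f x (r *\<^sub>R y) = of_real r * f x y"
  using sesquilinear_formD(3,4)[OF assms, of "of_real r"] by (simp_all add: scaleC_of_real)

text \<open>
  The form domain with its energy norm is a Hilbert space that is not a type, so the basic Hilbert
  space theory is developed for a subspace carrying a form; the ambient space is the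
  special case of \<^term>\<open>cinner\<close> on \<^term>\<open>UNIV\<close>.
\<close>

locale form_space =
  fixes D :: "'a :: complex_hilbert set" and s :: "'a \<Rightarrow> 'a \<Rightarrow> complex"
  assumes sesquilinear: "sesquilinear_form D s"
    and symmetric: "symmetric_form D s"
    and dominates: "\<And>x. x \<in> D \<Longrightarrow> (norm x)\<^sup>2 \<le> Re (s x x)"
    and complete: "\<And>X. (\<And>n. X n \<in> D) \<Longrightarrow>
      (\<And>e. e > 0 \<Longrightarrow> \<exists>N. \<forall>m\<ge>N. \<forall>n\<ge>N. Re (s (X m - X n) (X m - X n)) < e) \<Longrightarrow>
      \<exists>x\<in>D. (\<lambda>n. Re (s (X n - x) (X n - x))) \<longlonglongrightarrow> 0"
begin

definition fnorm :: "'a \<Rightarrow> real" where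
  "fnorm x = sqrt (Re (s x x))"

lemma sub: "csubspace D"
  using sesquilinear by (simp add: sesquilinear_form_def)

lemmas D_0 [simp] = csubspace_0[OF sub]
lemmas D_add [simp] = csubspace_add[OF sub]
lemmas D_diff [simp] = csubspace_diff[OF sub]
lemmas D_minus [simp] = csubspace_minus[OF sub]
lemmas D_scaleC [simp] = csubspace_scaleC[OF sub]
lemmas D_scaleR [simp] = csubspace_scaleR[OF sub]

lemma add_left: "x \<in> D \<Longrightarrow> y \<in> D \<Longrightarrow> z \<in> D \<Longrightarrow> s (x + y) z = s x z + s y z"
  and add_right: "x \<in> D \<Longrightarrow> y \<in> D \<Longrightarrow> z \<in> D \<Longrightarrow> s x (y + z) = s x y + s x z"
  and scaleC_left: "x \<in> D \<Longrightarrow> y \<in> D \<Longrightarrow> s (c *\<^sub>C x) y = c * s x y"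
  and scaleC_right: "x \<in> D \<Longrightarrow> y \<in> D \<Longrightarrow> s x (c *\<^sub>C y) = cnj c * s x y"
  using sesquilinear by (auto simp: sesquilinear_form_def)

lemma scaleR_left: "x \<in> D \<Longrightarrow> y \<in> D \<Longrightarrow> s (r *\<^sub>R x) y = of_real r * s x y"
  and scaleR_right: "x \<in> D \<Longrightarrow> y \<in> D \<Longrightarrow> s x (r *\<^sub>R y) = of_real r * s x y"
  using scaleC_left[of x y "of_real r"] scaleC_right[of x y "of_real r"] by (simp_all add: scaleC_of_real)

lemma minus_left: "x \<in> D \<Longrightarrow> y \<in> D \<Longrightarrow> s (- x) y = - s x y"
  and minus_right: "x \<in> D \<Longrightarrow> y \<in> D \<Longrightarrow> s x (- y) = - s x y"
  using scaleR_left[of x y "-1"] scaleR_right[of x y "-1"] by auto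

lemma diff_left: "x \<in> D \<Longrightarrow> y \<in> D \<Longrightarrow> z \<in> D \<Longrightarrow> s (x - y) z = s x z - s y z"
  and diff_right: "x \<in> D \<Longrightarrow> y \<in> D \<Longrightarrow> z \<in> D \<Longrightarrow> s x (y - z) = s x y - s x z"
  using add_left[of x "-y" z] add_right[of x y "-z"] by (simp_all add: minus_left minus_right)

lemma commute: "x \<in> D \<Longrightarrow> y \<in> D \<Longrightarrow> s x y = cnj (s y x)"
  using symmetric unfolding symmetric_form_def by blast

lemma Re_nonneg: "x \<in> D \<Longrightarrow> Re (s x x) \<ge> 0"
  using dominates[of x] zero_le_power2[of "norm x"] by linarith

lemma fnorm_nonneg: "x \<in> D \<Longrightarrow> fnorm x \<ge> 0"
  by (simp add: fnorm_def Re_nonneg)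

lemma fnorm_sq: "x \<in> D \<Longrightarrow> (fnorm x)\<^sup>2 = Re (s x x)"
  by (simp add: fnorm_def Re_nonneg)

lemma self_eq: "x \<in> D \<Longrightarrow> s x x = of_real ((fnorm x)\<^sup>2)"
  using arg_cong[OF commute[of x x], of Im] by (simp add: fnorm_sq complex_eq_iff)

lemma norm_le_fnorm: "x \<in> D \<Longrightarrow> norm x \<le> fnorm x"
  by (simp add: fnorm_def dominates real_le_rsqrt)

lemma fnorm_0 [simp]: "fnorm 0 = 0"
  using scaleR_left[of 0 0 0] by (simp add: fnorm_def)

lemma fnorm_minus: "x \<in> D \<Longrightarrow> fnorm (- x) = fnorm x"
  by (simp add: fnorm_def minus_left minus_right)

lemma fnorm_scaleC: "x \<in> D \<Longrightarrow> fnorm (c *\<^sub>C x) = cmod c * fnorm x"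
proof -
  assume x: "x \<in> D"
  have "s (c *\<^sub>C x) (c *\<^sub>C x) = of_real ((cmod c * fnorm x)\<^sup>2)"
    using x complex_norm_square[of c] by (simp add: scaleC_left scaleC_right self_eq[OF x] power_mult_distrib)
  thus ?thesis
    using x by (simp add: fnorm_def[of "c *\<^sub>C x"] fnorm_nonneg)
qed

lemma fnorm_scaleR: "x \<in> D \<Longrightarrow> fnorm (r *\<^sub>R x) = \<bar>r\<bar> * fnorm x"
  using fnorm_scaleC[of x "of_real r"] by (simp add: scaleC_of_real)

lemma Re_commute: "x \<in> D \<Longrightarrow> y \<in> D \<Longrightarrow> Re (s x y) = Re (s y x)"
  using commute[of x y] by simp

lemma fnorm_add_sq:
  "x \<in> D \<Longrightarrow> y \<in> D \<Longrightarrow> (fnorm (x + y))\<^sup>2 = (fnorm x)\<^sup>2 + (fnorm y)\<^sup>2 + 2 * Re (s x y)"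
  using Re_commute[of x y] by (simp add: fnorm_sq add_left add_right)

lemma fnorm_diff_sq:
  "x \<in> D \<Longrightarrow> y \<in> D \<Longrightarrow> (fnorm (x - y))\<^sup>2 = (fnorm x)\<^sup>2 + (fnorm y)\<^sup>2 - 2 * Re (s x y)"
  using Re_commute[of x y] by (simp add: fnorm_sq diff_left diff_right)

text \<open>For nonzero vectors, expand the squared energy norm of
  \<open>fnorm y *\<^sub>R x - fnorm x *\<^sub>R y\<close>. A vector of energy norm 0 is 0 because
  the energy norm dominates the ambient one.\<close>

lemma Re_le_fnorm:
  assumes "x \<in> D" "y \<in> D"
  shows "Re (s x y) \<le> fnorm x * fnorm y"
proof (cases "fnorm x = 0 \<or> fnorm y = 0")
  case True
  hence "x = 0 \<or> y = 0"
    using norm_le_fnorm assms by fastforce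
  thus ?thesis
    using scaleR_left[of 0 y 0] scaleR_right[of x 0 0] assms by auto
next
  case False
  hence pos: "fnorm x > 0" "fnorm y > 0"
    using fnorm_nonneg assms by (auto simp: less_le)
  have "0 \<le> (fnorm (fnorm y *\<^sub>R x - fnorm x *\<^sub>R y))\<^sup>2"
    by simp
  also have "\<dots> = 2 * (fnorm x * fnorm y) * (fnorm x * fnorm y - Re (s x y))"
    using assms by (subst fnorm_diff_sq)
      (auto simp: fnorm_scaleR scaleR_left scaleR_right algebra_simps power2_eq_square fnorm_nonneg)
  finally have "0 \<le> fnorm x * fnorm y - Re (s x y)"
    using mult_pos_pos[OF pos] mult_pos_neg[of "2 * (fnorm x * fnorm y)" "fnorm x * fnorm y - Re (s x y)"]
    by linarith
  thus ?thesis
    by simp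
qed

lemma cauchy_schwarz:
  assumes "x \<in> D" "y \<in> D"
  shows "cmod (s x y) \<le> fnorm x * fnorm y"
proof (cases "s x y = 0")
  case False
  \<comment> \<open>This phase makes \<open>s (c *\<^sub>C x) y\<close> equal to its modulus, so
    that the bound on real parts applies.\<close>
  define c where "c = cnj (s x y) / cmod (s x y)"
  have "cmod c = 1"
    using False by (simp add: c_def norm_divide)
  moreover have "s (c *\<^sub>C x) y = cmod (s x y)"
  proof -
    have "s (c *\<^sub>C x) y = s x y * cnj (s x y) / cmod (s x y)"
      using assms by (simp add: scaleC_left c_def)
    also have "\<dots> = (cmod (s x y) * cmod (s x y)) / cmod (s x y)"
      by (simp flip: complex_norm_square add: power2_eq_square)
    finally show ?thesis
      using False by simp
  qed
  ultimately show ?thesis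
    using Re_le_fnorm[OF D_scaleC[OF assms(1)] assms(2), of c] assms by (simp add: fnorm_scaleC)
qed (simp add: fnorm_nonneg assms)

lemma fnorm_triangle: "x \<in> D \<Longrightarrow> y \<in> D \<Longrightarrow> fnorm (x + y) \<le> fnorm x + fnorm y"
  by (rule power2_le_imp_le)
    (simp_all add: fnorm_add_sq Re_le_fnorm power2_sum fnorm_nonneg)

lemma fnorm_commute: "x \<in> D \<Longrightarrow> y \<in> D \<Longrightarrow> fnorm (x - y) = fnorm (y - x)"
  using fnorm_minus[of "x - y"] by simp

lemma fnorm_complete:
  assumes "\<And>n. X n \<in> D" "\<And>e. e > 0 \<Longrightarrow> \<exists>N. \<forall>m\<ge>N. \<forall>n\<ge>N. fnorm (X m - X n) < e"
  obtains x where "x \<in> D" "(\<lambda>n. fnorm (X n - x)) \<longlonglongrightarrow> 0"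
proof -
  have "\<exists>x\<in>D. (\<lambda>n. Re (s (X n - x) (X n - x))) \<longlonglongrightarrow> 0"
  proof (rule complete)
    fix e :: real assume "e > 0"
    then obtain N where N: "\<And>m n. m \<ge> N \<Longrightarrow> n \<ge> N \<Longrightarrow> fnorm (X m - X n) < sqrt e"
      using assms(2)[of "sqrt e"] by auto
    show "\<exists>N. \<forall>m\<ge>N. \<forall>n\<ge>N. Re (s (X m - X n) (X m - X n)) < e"
      using N by (intro exI[of _ N]) (auto simp: fnorm_def)
  qed (use assms in auto)
  then obtain x where x: "x \<in> D" "(\<lambda>n. Re (s (X n - x) (X n - x))) \<longlonglongrightarrow> 0"
    by auto
  have "(\<lambda>n. fnorm (X n - x)) \<longlonglongrightarrow> 0"
    using tendsto_real_sqrt[OF x(2)] by (simp add: fnorm_def)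
  with x show ?thesis
    using that by blast
qed

lemma tendsto_form_left:
  assumes "\<And>n. X n \<in> D" "x \<in> D" "y \<in> D" "(\<lambda>n. fnorm (X n - x)) \<longlonglongrightarrow> 0"
  shows "(\<lambda>n. s (X n) y) \<longlonglongrightarrow> s x y"
proof (rule LIM_zero_cancel, rule Lim_null_comparison)
  show "\<forall>\<^sub>F n in sequentially. norm (s (X n) y - s x y) \<le> fnorm (X n - x) * fnorm y"
    using assms by (auto simp: cauchy_schwarz simp flip: diff_left)
  show "(\<lambda>n. fnorm (X n - x) * fnorm y) \<longlonglongrightarrow> 0"
    using tendsto_mult_right[OF assms(4), of "fnorm y"] by simp
qed

lemma tendsto_fnorm:
  assumes "\<And>n. X n \<in> D" "x \<in> D" "(\<lambda>n. fnorm (X n - x)) \<longlonglongrightarrow> 0"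
  shows "(\<lambda>n. fnorm (X n)) \<longlonglongrightarrow> fnorm x"
proof (rule LIM_zero_cancel, rule Lim_null_comparison)
  have "\<bar>fnorm (X n) - fnorm x\<bar> \<le> fnorm (X n - x)" for n
    using fnorm_triangle[of "X n - x" x] fnorm_triangle[of "x - X n" "X n"] assms
      fnorm_commute[of x "X n"] by simp
  thus "\<forall>\<^sub>F n in sequentially. norm (fnorm (X n) - fnorm x) \<le> fnorm (X n - x)"
    by simp
qed (fact assms)

section \<open>Bounded functionals, Riesz representation and projections\<close>

definition functional :: "('a \<Rightarrow> complex) \<Rightarrow> bool" where
  "functional l \<longleftrightarrow> (\<forall>x\<in>D. \<forall>y\<in>D. l (x + y) = l x + l y) \<and> (\<forall>c. \<forall>x\<in>D. l (c *\<^sub>C x) = c * l x) \<and>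
     (\<exists>M. \<forall>x\<in>D. cmod (l x) \<le> M * fnorm x)"

lemma functionalD:
  assumes "functional l" "x \<in> D"
  shows "y \<in> D \<Longrightarrow> l (x + y) = l x + l y" "l (c *\<^sub>C x) = c * l x" "l (r *\<^sub>R x) = of_real r * l x"
    "y \<in> D \<Longrightarrow> l (x - y) = l x - l y" "l 0 = 0"
proof -
  have add: "l (x + y) = l x + l y" if "y \<in> D" for y
    using assms that unfolding functional_def by blast
  have sc: "l (c *\<^sub>C x) = c * l x" if "x \<in> D" for c x
    using assms that unfolding functional_def by blast
  show "y \<in> D \<Longrightarrow> l (x + y) = l x + l y" "l (c *\<^sub>C x) = c * l x"
    using add sc assms by blast+
  show "l (r *\<^sub>R x) = of_real r * l x"
    using sc[OF assms(2), of "of_real r"] by (simp add: scaleC_of_real)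
  show "l 0 = 0"
    using sc[OF D_0, of 0] by simp
  assume y: "y \<in> D"
  have "l (- y) = - l y"
    using sc[OF y, of "-1"] by simp
  thus "l (x - y) = l x - l y"
    using add[of "-y"] y by simp
qed

lemma functional_form: "y \<in> D \<Longrightarrow> functional (\<lambda>x. s x y)"
  using cauchy_schwarz unfolding functional_def
  by (auto simp: add_left scaleC_left mult.commute intro!: exI[of _ "fnorm y"])

text \<open>Up to a constant, \<open>J x\<close> is the squared distance from \<open>x\<close> to
  the representing vector, which is therefore found as a minimizer of \<open>J\<close>. By the
  parallelogram law minimizing sequences are Cauchy, and the first variation at the minimizer gives
  the representation.\<close>

theorem riesz:
  assumes l: "functional l"
  obtains z where "z \<in> D" "\<And>x. x \<in> D \<Longrightarrow> l x = s x z"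
proof -
  define J where "J x = (fnorm x)\<^sup>2 - 2 * Re (l x)" for x
  obtain M where M: "\<And>x. x \<in> D \<Longrightarrow> cmod (l x) \<le> M * fnorm x"
    using l unfolding functional_def by metis
  have J_lower: "J x \<ge> - M\<^sup>2" if "x \<in> D" for x
  proof -
    have "Re (l x) \<le> M * fnorm x"
      using M[OF that] complex_Re_le_cmod[of "l x"] by linarith
    moreover have "(fnorm x)\<^sup>2 - 2 * (M * fnorm x) + M\<^sup>2 \<ge> 0"
      using zero_le_power2[of "fnorm x - M"] by (simp add: power2_diff mult.commute)
    ultimately show ?thesis
      by (simp add: J_def)
  qed
  define m where "m = Inf (J ` D)"
  have bdd: "bdd_below (J ` D)"
    using J_lower by (intro bdd_belowI2[of _ "- M\<^sup>2"]) auto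
  have m_le: "m \<le> J x" if "x \<in> D" for x
    unfolding m_def using bdd that by (simp add: cInf_lower)
  have "\<exists>x\<in>D. J x < m + inverse (real (Suc n))" for n
  proof -
    have "\<exists>y\<in>J ` D. y < m + inverse (real (Suc n))"
      unfolding m_def using bdd by (subst cInf_less_iff[symmetric]) (use D_0 in \<open>auto simp del: of_nat_Suc D_0\<close>)
    thus ?thesis by auto
  qed
  then obtain X where X: "\<And>n. X n \<in> D" "\<And>n. J (X n) < m + inverse (real (Suc n))"
    by metis
  have par: "(fnorm (x - y))\<^sup>2 = 2 * (J x + J y - 2 * J ((1/2) *\<^sub>R (x + y)))"
    if "x \<in> D" "y \<in> D" for x y
  proof -
    have "J ((1/2) *\<^sub>R (x + y)) = (fnorm (x + y))\<^sup>2 / 4 - Re (l x) - Re (l y)"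
      unfolding J_def fnorm_scaleR[OF D_add[OF that]] functionalD(3)[OF l D_add[OF that]]
        functionalD(1)[OF l that] by (simp add: power_divide field_simps)
    thus ?thesis
      by (simp add: J_def fnorm_add_sq[OF that] fnorm_diff_sq[OF that] field_simps)
  qed
  have close: "(fnorm (X i - X j))\<^sup>2 \<le> 2 * (inverse (real (Suc i)) + inverse (real (Suc j)))" for i j
    using par[of "X i" "X j"] m_le[of "(1/2) *\<^sub>R (X i + X j)"] X(2)[of i] X(2)[of j] X(1)
    by (auto simp del: of_nat_Suc scaleR_add_right)
  obtain z where z: "z \<in> D" "(\<lambda>n. fnorm (X n - z)) \<longlonglongrightarrow> 0"
  proof (rule fnorm_complete[of X])
    fix e :: real assume e: "e > 0"
    obtain N where N: "inverse (real (Suc N)) < e\<^sup>2 / 4"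
      using reals_Archimedean[of "e\<^sup>2 / 4"] e by auto
    have "fnorm (X i - X j) < e" if "i \<ge> N" "j \<ge> N" for i j
    proof -
      have "inverse (real (Suc i)) \<le> inverse (real (Suc N))" "inverse (real (Suc j)) \<le> inverse (real (Suc N))"
        using that by (auto intro!: le_imp_inverse_le)
      moreover have "v < w" if "a \<le> c" "b \<le> c" "v \<le> 2 * (a + b)" "c < w / 4" for a b c v w :: real
        using that by argo
      ultimately have "(fnorm (X i - X j))\<^sup>2 < e\<^sup>2"
        using close[of i j] N by blast
      thus ?thesis
        using e by (meson power2_less_imp_less less_imp_le)
    qed
    thus "\<exists>N. \<forall>m\<ge>N. \<forall>n\<ge>N. fnorm (X m - X n) < e" by blast
  qed (use X in auto)
  have Jz: "J z \<le> m"
  proof -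
    have "(\<lambda>n. l (X n - z)) \<longlonglongrightarrow> 0"
    proof (rule Lim_null_comparison)
      show "\<forall>\<^sub>F n in sequentially. norm (l (X n - z)) \<le> M * fnorm (X n - z)"
        using M X(1) z(1) by auto
      show "(\<lambda>n. M * fnorm (X n - z)) \<longlonglongrightarrow> 0"
        using tendsto_mult_left[OF z(2), of M] by simp
    qed
    hence "(\<lambda>n. l (X n) - l z) \<longlonglongrightarrow> 0"
      using functionalD(4)[OF l X(1) z(1)] by simp
    hence "(\<lambda>n. l (X n)) \<longlonglongrightarrow> l z"
      by (rule LIM_zero_cancel)
    hence "(\<lambda>n. J (X n)) \<longlonglongrightarrow> J z"
      unfolding J_def by (intro tendsto_intros tendsto_fnorm X z)
    moreover have "(\<lambda>n. m + inverse (real (Suc n))) \<longlonglongrightarrow> m + 0"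
      by (intro tendsto_intros LIMSEQ_inverse_real_of_nat)
    ultimately show ?thesis
      using LIMSEQ_le[of "\<lambda>n. J (X n)" "J z" "\<lambda>n. m + inverse (real (Suc n))" "m + 0"] X(2)
      by (force intro: less_imp_le)
  qed
  have Re0: "Re (l h) = Re (s h z)" if h: "h \<in> D" for h
  proof (rule ccontr)
    assume ne: "Re (l h) \<noteq> Re (s h z)"
    define d where "d = Re (l h) - Re (s h z)"
    \<comment> \<open>The quadratic in \<open>r\<close> would be minimal at
      \<open>d / (fnorm h)\<^sup>2\<close>; the added 1 avoids division by zero and still makes
      \<open>J\<close> strictly smaller.\<close>
    define r where "r = d / ((fnorm h)\<^sup>2 + 1)"
    have "J (z + r *\<^sub>R h) = J z + r\<^sup>2 * (fnorm h)\<^sup>2 - 2 * r * d"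
      using h z(1) by (simp add: J_def fnorm_add_sq fnorm_scaleR functionalD[OF l] scaleR_right
          power_mult_distrib d_def Re_commute[of z h] algebra_simps)
    moreover have "J z \<le> J (z + r *\<^sub>R h)"
      using Jz m_le[of "z + r *\<^sub>R h"] h z(1) by auto
    moreover have "r\<^sup>2 * (fnorm h)\<^sup>2 - 2 * r * d = - (d\<^sup>2 * ((fnorm h)\<^sup>2 + 2)) / ((fnorm h)\<^sup>2 + 1)\<^sup>2"
    proof -
      have pos: "(fnorm h)\<^sup>2 + 1 > 0"
        using zero_le_power2[of "fnorm h"] by linarith
      thus ?thesis
        unfolding r_def by (simp add: divide_simps) (simp add: power2_eq_square algebra_simps)
    qed
    moreover have "d\<^sup>2 * ((fnorm h)\<^sup>2 + 2) > 0"
      using ne by (intro mult_pos_pos add_nonneg_pos) (auto simp: d_def)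
    moreover have "((fnorm h)\<^sup>2 + 1)\<^sup>2 > 0"
      by (smt (verit) zero_le_power2 zero_less_power2)
    ultimately show False
      by (smt (verit) divide_pos_pos minus_divide_left)
  qed
  have "l x = s x z" if x: "x \<in> D" for x
  proof -
    \<comment> \<open>Multiplication by \<open>- \<i>\<close> turns imaginary parts into real
      parts.\<close>
    have "Re (l (- \<i> *\<^sub>C x)) = Re (s (- \<i> *\<^sub>C x) z)"
      using x by (intro Re0) auto
    hence "Im (l x) = Im (s x z)"
      using x z(1) by (simp add: functionalD(2)[OF l] scaleC_left)
    with Re0[OF x] show ?thesis
      by (simp add: complex_eq_iff)
  qed
  with z(1) show ?thesis
    using that by blast
qed

text \<open>Stability under energy limits is enough for completeness, which makes Riesz
  representation available inside \<open>M\<close>.\<close>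

lemma closed_subspace:
  assumes "csubspace M" "M \<subseteq> D"
    and "\<And>X x. (\<And>n. X n \<in> M) \<Longrightarrow> x \<in> D \<Longrightarrow> (\<lambda>n. fnorm (X n - x)) \<longlonglongrightarrow> 0 \<Longrightarrow> x \<in> M"
  shows "form_space M s"
proof
  show "sesquilinear_form M s"
    using assms(1,2) sesquilinear unfolding sesquilinear_form_def by (meson subsetD)
  show "symmetric_form M s"
    using assms(2) symmetric unfolding symmetric_form_def by (meson subsetD)
  show "x \<in> M \<Longrightarrow> (norm x)\<^sup>2 \<le> Re (s x x)" for x
    using assms(2) dominates by blast
next
  fix X :: "nat \<Rightarrow> 'a"
  assume X: "\<And>n. X n \<in> M"
    "\<And>e. e > 0 \<Longrightarrow> \<exists>N. \<forall>m\<ge>N. \<forall>n\<ge>N. Re (s (X m - X n) (X m - X n)) < e"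
  have "\<exists>x\<in>D. (\<lambda>n. Re (s (X n - x) (X n - x))) \<longlonglongrightarrow> 0"
    using X assms(2) by (intro complete) auto
  then obtain x where x: "x \<in> D" "(\<lambda>n. Re (s (X n - x) (X n - x))) \<longlonglongrightarrow> 0"
    by auto
  have "(\<lambda>n. fnorm (X n - x)) \<longlonglongrightarrow> 0"
    using tendsto_real_sqrt[OF x(2)] by (simp add: fnorm_def)
  hence "x \<in> M"
    using assms(3)[of X x] X x by blast
  with x show "\<exists>x\<in>M. (\<lambda>n. Re (s (X n - x) (X n - x))) \<longlonglongrightarrow> 0"
    by blast
qed

text \<open>Inside \<open>M\<close>, the Riesz representative of the functional
  \<open>m \<mapsto> s m x\<close> is already the projection of \<open>x\<close>.\<close>

lemma projection:
  assumes M: "csubspace M" "M \<subseteq> D"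
    "\<And>X x. (\<And>n. X n \<in> M) \<Longrightarrow> x \<in> D \<Longrightarrow> (\<lambda>n. fnorm (X n - x)) \<longlonglongrightarrow> 0 \<Longrightarrow> x \<in> M"
    and x: "x \<in> D"
  obtains p where "p \<in> M" "\<And>m. m \<in> M \<Longrightarrow> s m (x - p) = 0"
proof -
  interpret M: form_space M s
    using M by (rule closed_subspace)
  have "M.functional (\<lambda>m. s m x)"
    using functional_form[OF x] M(2) unfolding functional_def M.functional_def M.fnorm_def fnorm_def
    by (meson subsetD)
  then obtain p where "p \<in> M" "\<And>m. m \<in> M \<Longrightarrow> s m x = s m p"
    using M.riesz by blast
  with that x M(2) show ?thesis
    by (metis diff_right eq_iff_diff_eq_0 subsetD)
qed

section \<open>The principle of uniform boundedness\<close>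

text \<open>\<open>M\<close> is the supremum over the unit ball, and \<open>2 / 3\<close> is the
  quality of near-maximizer required later: it has to exceed the share \<open>1 / 2\<close> that the
  tail of a series of steps with ratio \<open>1 / 3\<close> can cancel.\<close>

lemma functional_bound:
  assumes l: "functional l"
  obtains M where "M \<ge> 0" "\<And>x. x \<in> D \<Longrightarrow> cmod (l x) \<le> M * fnorm x"
    "M > 0 \<Longrightarrow> \<exists>u\<in>D. fnorm u \<le> 1 \<and> 2 / 3 * M \<le> cmod (l u)"
proof -
  obtain B where B: "\<And>x. x \<in> D \<Longrightarrow> cmod (l x) \<le> B * fnorm x"
    using l unfolding functional_def by metis
  define S where "S = (\<lambda>u. cmod (l u)) ` {u \<in> D. fnorm u \<le> 1}"
  have bdd: "bdd_above S"
    unfolding S_def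
  proof (rule bdd_aboveI2)
    fix u assume u: "u \<in> {u \<in> D. fnorm u \<le> 1}"
    have "cmod (l u) \<le> B * fnorm u"
      using B u by simp
    also have "\<dots> \<le> \<bar>B\<bar> * 1"
      using u fnorm_nonneg[of u] by (intro mult_mono) auto
    finally show "cmod (l u) \<le> \<bar>B\<bar>" by simp
  qed
  have 0: "0 \<in> S"
    using functionalD(5)[OF l D_0] by (auto simp: S_def intro!: image_eqI[of _ _ 0])
  have le: "cmod (l u) \<le> Sup S" if "u \<in> D" "fnorm u \<le> 1" for u
    by (rule cSup_upper[OF _ bdd]) (use that in \<open>auto simp: S_def\<close>)
  show ?thesis
  proof (rule that[of "Sup S"])
    show "Sup S \<ge> 0"
      using cSup_upper[OF 0 bdd] .
    fix x assume x: "x \<in> D"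
    show "cmod (l x) \<le> Sup S * fnorm x"
    proof (cases "fnorm x = 0")
      case True
      thus ?thesis using B[OF x] by simp
    next
      case False
      hence pos: "fnorm x > 0"
        using fnorm_nonneg[OF x] by simp
      have "cmod (l ((1 / fnorm x) *\<^sub>R x)) \<le> Sup S"
        using x pos by (intro le) (auto simp: fnorm_scaleR)
      thus ?thesis
        using x pos by (simp add: functionalD[OF l] norm_mult norm_divide field_simps)
    qed
  next
    assume "Sup S > 0"
    hence "2 / 3 * Sup S < Sup S" by simp
    then obtain r where "r \<in> S" "2 / 3 * Sup S < r"
      using less_cSup_iff[of S] 0 bdd by blast
    thus "\<exists>u\<in>D. fnorm u \<le> 1 \<and> 2 / 3 * Sup S \<le> cmod (l u)"
      by (auto simp: S_def intro: less_imp_le)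
  qed
qed

text \<open>
  Sokal's argument: steps of length \<open>3 ^ (-n)\<close>, whose signs are chosen such that the \<open>n\<close>-th
  functional does not decrease, lead to a point where the family is unbounded.
\<close>

theorem uniform_boundedness:
  assumes l: "\<And>i. i \<in> I \<Longrightarrow> functional (l i)"
    and bounded: "\<And>x. x \<in> D \<Longrightarrow> \<exists>C. \<forall>i\<in>I. cmod (l i x) \<le> C"
  obtains K where "\<And>i x. i \<in> I \<Longrightarrow> x \<in> D \<Longrightarrow> cmod (l i x) \<le> K * fnorm x"
proof (rule ccontr)
  assume "\<not> thesis"
  hence unb: "\<exists>i\<in>I. \<exists>x\<in>D. K * fnorm x < cmod (l i x)" for K
    using that by (meson not_le)
  \<comment> \<open>Growth like \<open>4 ^ n\<close> will beat the step lengths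
    \<open>3 ^ (-n)\<close>.\<close>
  have "\<exists>i M u. i \<in> I \<and> 4 ^ n \<le> M \<and> (\<forall>x\<in>D. cmod (l i x) \<le> M * fnorm x) \<and>
    u \<in> D \<and> fnorm u \<le> 1 \<and> 2 / 3 * M \<le> cmod (l i u)" for n
  proof -
    obtain i x where i: "i \<in> I" "x \<in> D" "4 ^ n * fnorm x < cmod (l i x)"
      using unb by blast
    obtain M where M: "\<And>x. x \<in> D \<Longrightarrow> cmod (l i x) \<le> M * fnorm x"
      "M > 0 \<Longrightarrow> \<exists>u\<in>D. fnorm u \<le> 1 \<and> 2 / 3 * M \<le> cmod (l i u)"
      using functional_bound[OF l[OF i(1)]] by blast
    have "4 ^ n * fnorm x < M * fnorm x"
      using M(1)[OF i(2)] i(3) by linarith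
    hence "4 ^ n < M"
      using fnorm_nonneg[OF i(2)] by (simp add: mult_less_cancel_right)
    moreover from this have "M > 0"
      by (smt (verit) zero_less_power)
    ultimately show ?thesis
      using i M by (meson less_imp_le)
  qed
  then obtain i M u where i: "\<And>n. i n \<in> I" and M: "\<And>n. 4 ^ n \<le> M n"
    and lM: "\<And>n x. x \<in> D \<Longrightarrow> cmod (l (i n) x) \<le> M n * fnorm x"
    and u: "\<And>n. u n \<in> D" "\<And>n. fnorm (u n) \<le> 1"
    and lu: "\<And>n::nat. 2 / 3 * M n \<le> cmod (l (i n) (u n))"
    by metis
  define p :: "nat \<Rightarrow> real" where "p n = (1 / 3) ^ n" for n
  have p_pos: "p n > 0" for n
    by (simp add: p_def)
  define x where "x = rec_nat 0 (\<lambda>n y. if p n * cmod (l (i n) (u n)) \<le> cmod (l (i n) (y + p n *\<^sub>R u n))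
      then y + p n *\<^sub>R u n else y - p n *\<^sub>R u n)"
  have x_Suc: "x (Suc n) = (if p n * cmod (l (i n) (u n)) \<le> cmod (l (i n) (x n + p n *\<^sub>R u n))
      then x n + p n *\<^sub>R u n else x n - p n *\<^sub>R u n)" for n
    by (simp add: x_def)
  have xD: "x n \<in> D" for n
    by (induction n) (simp_all add: x_Suc u, simp add: x_def)
  have grow: "p n * cmod (l (i n) (u n)) \<le> cmod (l (i n) (x (Suc n)))" for n
  proof (cases "p n * cmod (l (i n) (u n)) \<le> cmod (l (i n) (x n + p n *\<^sub>R u n))")
    case False
    note L = functionalD[OF l[OF i[of n]]]
    \<comment> \<open>The two candidates differ by twice the step, so one of them attains at least
      half of the difference of the values.\<close>
    have "2 * (p n * cmod (l (i n) (u n))) = cmod (l (i n) (x n + p n *\<^sub>R u n) - l (i n) (x n - p n *\<^sub>R u n))"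
      using p_pos[of n] by (simp add: L xD u norm_mult)
    also have "\<dots> \<le> cmod (l (i n) (x n + p n *\<^sub>R u n)) + cmod (l (i n) (x n - p n *\<^sub>R u n))"
      by (rule norm_triangle_ineq4)
    finally show ?thesis
      using False by (simp add: x_Suc)
  qed (simp add: x_Suc)
  have step: "fnorm (x (Suc n) - x n) \<le> p n" for n
    using p_pos[of n] u[of n] by (simp add: x_Suc fnorm_scaleR fnorm_minus)
  have dist: "fnorm (x (n + k) - x n) \<le> 3 / 2 * (p n - p (n + k))" for n k
  proof (induction k)
    case (Suc k)
    have "fnorm (x (n + Suc k) - x n) \<le> fnorm (x (Suc (n + k)) - x (n + k)) + fnorm (x (n + k) - x n)"
      using fnorm_triangle[of "x (Suc (n + k)) - x (n + k)" "x (n + k) - x n"] xD by simp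
    also have "\<dots> \<le> p (n + k) + 3 / 2 * (p n - p (n + k))"
      using step Suc by (intro add_mono)
    also have "\<dots> = 3 / 2 * (p n - p (n + Suc k))"
    proof -
      have "p (n + Suc k) = p (n + k) / 3" by (simp add: p_def)
      thus ?thesis by (simp only:) (simp add: field_simps)
    qed
    finally show ?case .
  qed simp
  have dist': "fnorm (x m - x n) \<le> 3 / 2 * p n" if "n \<le> m" for m n
    using dist[of n "m - n"] that p_pos[of m] by simp
  have p0: "p \<longlonglongrightarrow> 0"
    unfolding p_def by (rule LIMSEQ_power_zero) simp
  obtain z where z: "z \<in> D" "(\<lambda>n. fnorm (x n - z)) \<longlonglongrightarrow> 0"
  proof (rule fnorm_complete[of x])
    fix e :: real assume e: "e > 0"
    have "\<forall>\<^sub>F n in sequentially. p n < e / 4"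
      using e by (intro order_tendstoD[OF p0]) simp
    then obtain N where N: "p N < e / 4"
      using eventually_sequentially by auto
    have N': "p n < e / 4" if "n \<ge> N" for n
      using order_le_less_trans[OF power_decreasing[of N n "1 / 3 :: real"] N[unfolded p_def]] that
      by (simp add: p_def)
    have "fnorm (x m - x n) < e" if "m \<ge> N" "n \<ge> N" for m n
      using dist'[of n m] dist'[of m n] N'[OF that(1)] N'[OF that(2)] p_pos[of m] p_pos[of n] that
        fnorm_commute[OF xD xD, of m n] by (cases "n \<le> m") auto
    thus "\<exists>N. \<forall>m\<ge>N. \<forall>n\<ge>N. fnorm (x m - x n) < e" by blast
  qed (rule xD)
  have dist_z: "fnorm (x n - z) \<le> 3 / 2 * p n" for n
  proof (rule LIMSEQ_le_const)
    show "(\<lambda>m. fnorm (x m - z) + 3 / 2 * p n) \<longlonglongrightarrow> 3 / 2 * p n"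
      using tendsto_add[OF z(2) tendsto_const[of "3 / 2 * p n"]] by simp
    show "\<exists>N. \<forall>m\<ge>N. fnorm (x n - z) \<le> fnorm (x m - z) + 3 / 2 * p n"
    proof (intro exI[of _ n] allI impI)
      fix m assume "n \<le> m"
      thus "fnorm (x n - z) \<le> fnorm (x m - z) + 3 / 2 * p n"
        using fnorm_triangle[of "x n - x m" "x m - z"] dist'[of n m] xD z(1)
          fnorm_commute[OF xD xD, of m n] by simp
    qed
  qed
  obtain C where C: "\<And>n. cmod (l (i n) z) \<le> C"
    using bounded[OF z(1)] i by blast
  have "(4 / 3) ^ n \<le> 6 * C" for n
  proof -
    note L = functionalD[OF l[OF i[of n]]]
    have "p n * (2 / 3 * M n) \<le> p n * cmod (l (i n) (u n))"
      using lu[of n] p_pos[of n] by simp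
    also note grow[of n]
    also have "cmod (l (i n) (x (Suc n))) \<le> cmod (l (i n) z) + cmod (l (i n) (x (Suc n) - z))"
      using norm_triangle_sub[of "l (i n) (x (Suc n))" "l (i n) z"] by (simp add: L xD z)
    also have "cmod (l (i n) (x (Suc n) - z)) \<le> M n * (3 / 2 * p (Suc n))"
      using lM[of "x (Suc n) - z" n] dist_z[of "Suc n"] xD z M[of n]
      by (smt (verit) D_diff mult_left_mono zero_le_power)
    \<comment> \<open>The chosen step guarantees \<open>2 / 3 * p n * M n\<close>, and all later
      steps together can cancel at most half of \<open>p n * M n\<close>; a sixth remains.\<close>
    finally have "p n * M n \<le> 6 * cmod (l (i n) z)"
      by (simp add: p_def field_simps)
    moreover have "(4 / 3) ^ n \<le> p n * M n"
      using mult_left_mono[OF M[of n], of "p n"] p_pos[of n] by (simp add: p_def power_divide)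
    ultimately show ?thesis
      using C[of n] by linarith
  qed
  moreover obtain n where "6 * C < (4 / 3) ^ n"
    using real_arch_pow[of "4 / 3"] by auto
  ultimately show False
    by (meson not_le)
qed

text \<open>Uniform boundedness is used once in each argument: for fixed \<open>y\<close> over the
  index \<open>i\<close>, then over all pairs of an index and an \<open>x\<close> in the unit ball.
  In the second use the forms are conjugated, as they are conjugate-linear in
  \<open>y\<close>.\<close>

theorem uniform_boundedness_forms:
  assumes b: "\<And>i. i \<in> I \<Longrightarrow> sesquilinear_form D (b i)"
    and bd: "\<And>i. i \<in> I \<Longrightarrow> \<exists>M. \<forall>x\<in>D. \<forall>y\<in>D. cmod (b i x y) \<le> M * fnorm x * fnorm y"
    and pw: "\<And>x y. x \<in> D \<Longrightarrow> y \<in> D \<Longrightarrow> \<exists>C. \<forall>i\<in>I. cmod (b i x y) \<le> C"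
  obtains K where "K \<ge> 0" "\<And>i x y. i \<in> I \<Longrightarrow> x \<in> D \<Longrightarrow> y \<in> D \<Longrightarrow> cmod (b i x y) \<le> K * fnorm x * fnorm y"
proof -
  obtain M where M: "\<And>i x y. i \<in> I \<Longrightarrow> x \<in> D \<Longrightarrow> y \<in> D \<Longrightarrow> cmod (b i x y) \<le> M i * fnorm x * fnorm y"
    using bd by metis
  have bD: "i \<in> I \<Longrightarrow> x \<in> D \<Longrightarrow> y \<in> D \<Longrightarrow> z \<in> D \<Longrightarrow> b i (x + y) z = b i x z + b i y z"
    "i \<in> I \<Longrightarrow> x \<in> D \<Longrightarrow> y \<in> D \<Longrightarrow> z \<in> D \<Longrightarrow> b i x (y + z) = b i x y + b i x z"
    "i \<in> I \<Longrightarrow> x \<in> D \<Longrightarrow> y \<in> D \<Longrightarrow> b i (d *\<^sub>C x) y = d * b i x y"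
    "i \<in> I \<Longrightarrow> x \<in> D \<Longrightarrow> y \<in> D \<Longrightarrow> b i x (d *\<^sub>C y) = cnj d * b i x y" for i x y z d
    using b[of i] unfolding sesquilinear_form_def by blast+
  have "\<exists>C. \<forall>i\<in>I. \<forall>x\<in>D. cmod (b i x y) \<le> C * fnorm x" if y: "y \<in> D" for y
  proof -
    have "functional (\<lambda>x. b i x y)" if "i \<in> I" for i
      unfolding functional_def using that y M[OF that _ y]
      by (intro conjI ballI allI exI[of _ "M i * fnorm y"]) (simp_all add: bD mult.assoc mult.left_commute mult.commute)
    then obtain C where "\<And>i x. i \<in> I \<Longrightarrow> x \<in> D \<Longrightarrow> cmod (b i x y) \<le> C * fnorm x"
      using uniform_boundedness[of I "\<lambda>i x. b i x y"] pw[OF _ y] by blast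
    thus ?thesis by blast
  qed
  then obtain C where C: "\<And>y i x. y \<in> D \<Longrightarrow> i \<in> I \<Longrightarrow> x \<in> D \<Longrightarrow> cmod (b i x y) \<le> C y * fnorm x"
    by metis
  obtain K where K: "\<And>j y. j \<in> I \<times> {x \<in> D. fnorm x \<le> 1} \<Longrightarrow> y \<in> D \<Longrightarrow>
      cmod (cnj (b (fst j) (snd j) y)) \<le> K * fnorm y"
  proof (rule uniform_boundedness[of "I \<times> {x \<in> D. fnorm x \<le> 1}" "\<lambda>j y. cnj (b (fst j) (snd j) y)"])
    fix j assume j: "j \<in> I \<times> {x \<in> D. fnorm x \<le> 1}"
    show "functional (\<lambda>y. cnj (b (fst j) (snd j) y))"
      unfolding functional_def using j M[of "fst j" "snd j"]
      by (intro conjI ballI allI exI[of _ "M (fst j) * fnorm (snd j)"]) (auto simp: bD)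
  next
    fix y assume y: "y \<in> D"
    have "cmod (cnj (b (fst j) (snd j) y)) \<le> \<bar>C y\<bar>" if j: "j \<in> I \<times> {x \<in> D. fnorm x \<le> 1}" for j
    proof -
      have "cmod (b (fst j) (snd j) y) \<le> C y * fnorm (snd j)"
        using C[OF y, of "fst j" "snd j"] j by auto
      also have "\<dots> \<le> \<bar>C y\<bar> * 1"
        using j fnorm_nonneg by (intro mult_mono) auto
      finally show ?thesis by simp
    qed
    thus "\<exists>B. \<forall>j\<in>I \<times> {x \<in> D. fnorm x \<le> 1}. cmod (cnj (b (fst j) (snd j) y)) \<le> B" by blast
  qed blast
  have "cmod (b i x y) \<le> \<bar>K\<bar> * fnorm x * fnorm y" if i: "i \<in> I" and x: "x \<in> D" and y: "y \<in> D" for i x y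
  proof (cases "fnorm x = 0")
    case True
    thus ?thesis using M[OF that] by simp
  next
    case False
    hence pos: "fnorm x > 0"
      using fnorm_nonneg[OF x] by simp
    have "cmod (b i ((1 / fnorm x) *\<^sub>R x) y) \<le> K * fnorm y"
      using K[of "(i, (1 / fnorm x) *\<^sub>R x)" y] that pos by (auto simp: fnorm_scaleR)
    also have "b i ((1 / fnorm x) *\<^sub>R x) y = of_real (1 / fnorm x) * b i x y"
      using bD(3)[OF i x y, of "of_real (1 / fnorm x)"] by (simp only: scaleC_of_real)
    finally have "cmod (b i x y) \<le> K * fnorm x * fnorm y"
      using pos by (simp add: norm_mult norm_divide field_simps)
    also have "\<dots> \<le> \<bar>K\<bar> * fnorm x * fnorm y"
      using pos fnorm_nonneg[OF y] by (intro mult_right_mono) auto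
    finally show ?thesis .
  qed
  thus ?thesis
    using that[of "\<bar>K\<bar>"] by simp
qed

section \<open>Weak sequential compactness of bounded sets\<close>

text \<open>A diagonal subsequence converges against each of the countably many vectors
  \<open>X n\<close>. The vectors against which it converges form a closed subspace \<open>M\<close>
  containing all \<open>X n\<close>, while vectors orthogonal to \<open>M\<close> give only zeros;
  so it converges against all of \<open>D\<close>, and Riesz representation provides the
  limit.\<close>

theorem weakly_compact:
  assumes X: "\<And>n :: nat. X n \<in> D" "\<And>n. fnorm (X n) \<le> B"
  obtains k x where "strict_mono k" "x \<in> D" "\<And>y. y \<in> D \<Longrightarrow> (\<lambda>n. s (X (k n)) y) \<longlonglongrightarrow> s x y"
proof -
  have B: "B \<ge> 0"
    using X fnorm_nonneg order_trans by blast
  have bound: "cmod (s (X n) y) \<le> B * fnorm y" if "y \<in> D" for n y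
    using cauchy_schwarz[OF X(1) that, of n] X(2)[of n] fnorm_nonneg[OF that]
    by (meson mult_right_mono order_trans)
  have "cmod (s (X n) y) \<le> B * B" if "y \<in> range X" for n :: nat and y
    using that X B by (auto intro!: order_trans[OF bound] mult_left_mono)
  then obtain k where k: "strict_mono k"
    and conv: "\<And>y. y \<in> range X \<Longrightarrow> \<exists>l. (\<lambda>n. s (X (k n)) y) \<longlonglongrightarrow> l"
    using function_convergent_subsequence[of "range X" "\<lambda>n. s (X n)" "B * B"] by (metis countableI_type countable_image)
  define M where "M = {y \<in> D. convergent (\<lambda>n. s (X (k n)) y)}"
  have M_sub: "csubspace M"
    unfolding csubspace_def M_def
    using scaleR_right[OF X(1) D_0, of _ 0] X(1)
    by (auto simp: add_right scaleC_right convergent_const intro!: convergent_add convergent_mult)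
  have XM: "X n \<in> M" for n
    using X(1) conv by (auto simp: M_def convergent_def)
  have M_closed: "y \<in> M" if Y: "\<And>n. Y n \<in> M" "y \<in> D" "(\<lambda>n. fnorm (Y n - y)) \<longlonglongrightarrow> 0" for Y y
  proof -
    have "Cauchy (\<lambda>n. s (X (k n)) y)"
    proof (rule metric_CauchyI)
      fix e :: real assume e: "e > 0"
      have "\<forall>\<^sub>F n in sequentially. fnorm (Y n - y) < e / (3 * (B + 1))"
        using e B by (intro order_tendstoD[OF Y(3)]) simp
      then obtain m where m: "fnorm (Y m - y) < e / (3 * (B + 1))"
        using eventually_sequentially by auto
      have YD: "Y m \<in> D" and "Cauchy (\<lambda>n. s (X (k n)) (Y m))"
        using Y(1)[of m] by (auto simp: M_def convergent_Cauchy)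
      then obtain N where N: "\<And>i j. i \<ge> N \<Longrightarrow> j \<ge> N \<Longrightarrow> dist (s (X (k i)) (Y m)) (s (X (k j)) (Y m)) < e / 3"
        using metric_CauchyD[of _ "e / 3"] e by (metis divide_pos_pos zero_less_numeral)
      have near: "dist (s (X n) (Y m)) (s (X n) y) < e / 3" for n
      proof -
        have "dist (s (X n) (Y m)) (s (X n) y) \<le> B * fnorm (Y m - y)"
          using bound[of "Y m - y" n] YD Y(2) X(1) by (simp add: dist_norm diff_right)
        also have "\<dots> \<le> (B + 1) * fnorm (Y m - y)"
          using fnorm_nonneg[of "Y m - y"] YD Y(2) by (simp add: mult_right_mono)
        also have "\<dots> < e / 3"
          using m B by (simp add: field_simps)
        finally show ?thesis .
      qed
      show "\<exists>N. \<forall>i\<ge>N. \<forall>j\<ge>N. dist (s (X (k i)) y) (s (X (k j)) y) < e"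
      proof (intro exI[of _ N] allI impI)
        fix i j assume "N \<le> i" "N \<le> j"
        from N[OF this] near[of "k i"] near[of "k j"]
        show "dist (s (X (k i)) y) (s (X (k j)) y) < e"
          using dist_triangle[of "s (X (k i)) y" "s (X (k j)) y" "s (X (k i)) (Y m)"]
            dist_triangle[of "s (X (k i)) (Y m)" "s (X (k j)) y" "s (X (k j)) (Y m)"]
            dist_commute[of "s (X (k i)) y" "s (X (k i)) (Y m)"]
          by linarith
      qed
    qed
    thus ?thesis
      using Y(2) by (simp add: M_def Cauchy_convergent_iff)
  qed
  have conv_D: "convergent (\<lambda>n. s (X (k n)) y)" if y: "y \<in> D" for y
  proof -
    \<comment> \<open>Since \<open>y - p\<close> is orthogonal to every \<open>X n\<close>, testing
      with \<open>y\<close> amounts to testing with \<open>p\<close>, for which convergence is the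
      definition of \<open>M\<close>.\<close>
    obtain p where p: "p \<in> M" "\<And>m. m \<in> M \<Longrightarrow> s m (y - p) = 0"
    proof (rule projection[OF M_sub _ _ y])
      show "M \<subseteq> D" by (auto simp: M_def)
    qed (use M_closed in blast)+
    have "p \<in> D" "convergent (\<lambda>n. s (X (k n)) p)"
      using p(1) by (auto simp: M_def)
    moreover have "s (X (k n)) y = s (X (k n)) p" for n
      using p(2)[OF XM[of "k n"]] \<open>p \<in> D\<close> y X(1) by (simp add: diff_right)
    ultimately show ?thesis by simp
  qed
  define l where "l y = lim (\<lambda>n. s (X (k n)) y)" for y
  have l: "(\<lambda>n. s (X (k n)) y) \<longlonglongrightarrow> l y" if "y \<in> D" for y
    using conv_D[OF that] by (simp add: l_def convergent_LIMSEQ_iff)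
  \<comment> \<open>The limit is conjugate-linear in \<open>y\<close>, so its conjugate is the
    functional.\<close>
  have "functional (\<lambda>y. cnj (l y))"
    unfolding functional_def
  proof (intro conjI ballI allI exI)
    fix x y assume xy: "x \<in> D" "y \<in> D"
    have "(\<lambda>n. s (X (k n)) (x + y)) \<longlonglongrightarrow> l x + l y"
      using tendsto_add[OF l[OF xy(1)] l[OF xy(2)]] X(1) xy by (simp add: add_right)
    from LIMSEQ_unique[OF l[OF D_add[OF xy]] this]
    show "cnj (l (x + y)) = cnj (l x) + cnj (l y)" by simp
  next
    fix d x assume x: "x \<in> D"
    have "(\<lambda>n. s (X (k n)) (d *\<^sub>C x)) \<longlonglongrightarrow> cnj d * l x"
      using tendsto_mult_left[OF l[OF x], of "cnj d"] X(1) x by (simp add: scaleC_right)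
    from LIMSEQ_unique[OF l[OF D_scaleC[OF x]] this]
    show "cnj (l (d *\<^sub>C x)) = d * cnj (l x)" by simp
  next
    fix x assume x: "x \<in> D"
    show "cmod (cnj (l x)) \<le> B * fnorm x"
      using LIMSEQ_le_const2[OF tendsto_norm[OF l[OF x]]] bound[OF x] by simp
  qed
  then obtain x where x: "x \<in> D" "\<And>y. y \<in> D \<Longrightarrow> cnj (l y) = s y x"
    by (rule riesz) blast
  have "l y = s x y" if "y \<in> D" for y
    using x(2)[OF that] commute[OF x(1) that] by (metis complex_cnj_cnj)
  with k x l that show ?thesis
    by metis
qed

end

section \<open>The ambient space as a form space\<close>

lemma sesquilinear_cinner: "sesquilinear_form UNIV cinner"
  by (simp add: sesquilinear_form_def csubspace_UNIV cinner_add_left cinner_add_right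
      cinner_scaleC_left cinner_scaleC_right)

lemma Re_cinner_self: "Re (cinner x x) = (norm x)\<^sup>2"
  by (simp add: power2_norm_eq_inner inner_eq_Re_cinner)

interpretation hilbert: form_space UNIV cinner
  rewrites "form_space.fnorm cinner = norm"
proof -
  show "form_space UNIV (cinner :: 'a \<Rightarrow> 'a \<Rightarrow> complex)"
  proof
    show "symmetric_form UNIV (cinner :: 'a \<Rightarrow> 'a \<Rightarrow> complex)"
      unfolding symmetric_form_def using cinner_commute by blast
  next
    fix X :: "nat \<Rightarrow> 'a"
    assume X: "\<And>e. e > 0 \<Longrightarrow> \<exists>N. \<forall>m\<ge>N. \<forall>n\<ge>N. Re (cinner (X m - X n) (X m - X n)) < e"
    have "Cauchy X"
    proof (rule metric_CauchyI)
      fix e :: real assume e: "e > 0"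
      then obtain N where "\<forall>m\<ge>N. \<forall>n\<ge>N. (norm (X m - X n))\<^sup>2 < e\<^sup>2"
        using X[of "e\<^sup>2"] by (auto simp: Re_cinner_self)
      thus "\<exists>N. \<forall>m\<ge>N. \<forall>n\<ge>N. dist (X m) (X n) < e"
        using e by (intro exI[of _ N]) (auto simp: dist_norm intro: power2_less_imp_less)
    qed
    then obtain x where "X \<longlonglongrightarrow> x"
      by (auto simp: Cauchy_convergent_iff convergent_def)
    hence "(\<lambda>n. (norm (X n - x))\<^sup>2) \<longlonglongrightarrow> 0\<^sup>2"
      by (intro tendsto_power tendsto_norm_zero LIM_zero)
    thus "\<exists>x\<in>UNIV. (\<lambda>n. Re (cinner (X n - x) (X n - x))) \<longlonglongrightarrow> 0"
      by (auto simp: Re_cinner_self)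
  qed (simp_all add: sesquilinear_cinner Re_cinner_self)
  then interpret form_space UNIV "cinner :: 'a \<Rightarrow> 'a \<Rightarrow> complex" .
  show "fnorm = norm"
    by (auto simp: fun_eq_iff fnorm_def Re_cinner_self)
qed

section \<open>The operator of a closed symmetric form\<close>

lemma bounded_real_subseq:
  fixes f :: "nat \<Rightarrow> real"
  assumes "\<And>n. \<bar>f n\<bar> \<le> B"
  obtains r l where "strict_mono r" "(\<lambda>n. f (r n)) \<longlonglongrightarrow> l"
proof -
  have "bounded (range f)"
    using assms by (auto simp: bounded_iff)
  from bounded_imp_convergent_subsequence[OF this] that show ?thesis
    by (auto simp: o_def)
qed

lemma tendsto_subseq: "X \<longlonglongrightarrow> L \<Longrightarrow> strict_mono r \<Longrightarrow> (\<lambda>n. X (r n)) \<longlonglongrightarrow> L"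
  using LIMSEQ_subseq_LIMSEQ[of X L r] by (simp add: o_def)

lemma weakly_tendsto_subseq:
  "weakly_tendsto X x \<Longrightarrow> strict_mono r \<Longrightarrow> weakly_tendsto (\<lambda>n. X (r n)) x"
  using tendsto_subseq[of "\<lambda>n. cinner (X n) y" for y] by (auto simp: weakly_tendsto_def)

lemma cinner_0_left [simp]: "cinner 0 y = 0" and cinner_0_right [simp]: "cinner y 0 = 0"
  using hilbert.scaleR_left[of 0 y 0] hilbert.scaleR_right[of y 0 0] by simp_all

lemma weakly_null_scaleR:
  assumes "weakly_tendsto X 0" "r \<longlonglongrightarrow> \<rho>"
  shows "weakly_tendsto (\<lambda>n. r n *\<^sub>R X n) 0"
  unfolding weakly_tendsto_def
proof
  fix y
  have "(\<lambda>n. of_real (r n) * cinner (X n) y) \<longlonglongrightarrow> of_real \<rho> * 0"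
    using assms by (intro tendsto_intros) (auto simp: weakly_tendsto_def)
  thus "(\<lambda>n. cinner (r n *\<^sub>R X n) y) \<longlonglongrightarrow> cinner 0 y"
    by (simp add: hilbert.scaleR_left)
qed

text \<open>A weak limit of a subsequence is orthogonal to every \<open>v i\<close>, hence to
  itself, being a weak limit of such vectors.\<close>

lemma almost_orthogonal_weakly_null:
  assumes "\<And>n. norm (v n) \<le> B" "\<And>i. (\<lambda>n. cinner (v n) (v i)) \<longlonglongrightarrow> 0"
  obtains r where "strict_mono r" "weakly_tendsto (\<lambda>n. v (r n)) 0"
proof -
  obtain r x where r: "strict_mono (r :: nat \<Rightarrow> nat)" "\<And>y. (\<lambda>n. cinner (v (r n)) y) \<longlonglongrightarrow> cinner x y"
    using hilbert.weakly_compact[of v B] assms(1) by auto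
  have "cinner x (v i) = 0" for i
    using LIMSEQ_unique[OF r(2) tendsto_subseq[OF assms(2) r(1)]] .
  hence "cinner (v i) x = 0" for i
    using cinner_commute[of "v i" x] by simp
  hence "cinner x x = 0"
    using r(2)[of x] by (simp add: LIMSEQ_const_iff)
  hence "x = 0"
    using Re_cinner_self[of x] by simp
  with r that show ?thesis
    by (auto simp: weakly_tendsto_def)
qed

text \<open>The core property enters as density of \<open>DT\<close> for the energy norm, the shape
  in which it is used. The shift \<open>c\<close> makes the energy norm dominate the ambient
  norm.\<close>

locale form_operator_pair =
  fixes D :: "'a :: complex_hilbert set" and s :: "'a \<Rightarrow> 'a \<Rightarrow> complex"
    and DT :: "'a set" and T :: "'a \<Rightarrow> 'a" and c :: real
  assumes energy: "form_space D (\<lambda>x y. s x y + of_real c * cinner x y)"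
    and form: "sesquilinear_form D s"
    and selfadjoint: "selfadjoint_op DT T"
    and dom_sub: "DT \<subseteq> D"
    and dense: "\<And>x. x \<in> D \<Longrightarrow> \<exists>X. (\<forall>n. X n \<in> DT) \<and>
      (\<lambda>n. form_space.fnorm (\<lambda>x y. s x y + of_real c * cinner x y) (X n - x)) \<longlonglongrightarrow> 0"
    and op_form: "\<And>x y. x \<in> DT \<Longrightarrow> y \<in> DT \<Longrightarrow> cinner (T x) y = s x y"
begin

sublocale E: form_space D "\<lambda>x y. s x y + of_real c * cinner x y"
  by (rule energy)

abbreviation e :: "'a \<Rightarrow> 'a \<Rightarrow> complex" where
  "e x y \<equiv> s x y + of_real c * cinner x y"

lemma s_commute: "x \<in> D \<Longrightarrow> y \<in> D \<Longrightarrow> s x y = cnj (s y x)"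
  using E.commute[of x y] cinner_commute[of x y] by simp

lemma fnorm_sq: "x \<in> D \<Longrightarrow> (E.fnorm x)\<^sup>2 = Re (s x x) + c * (norm x)\<^sup>2"
  by (simp add: E.fnorm_sq Re_cinner_self)

lemma lower_bound: "x \<in> D \<Longrightarrow> (1 - c) * (norm x)\<^sup>2 \<le> Re (s x x)"
  using E.dominates[of x] by (simp add: Re_cinner_self algebra_simps)

lemma scaleR_scaleR: "x \<in> D \<Longrightarrow> s (r *\<^sub>R x) (r *\<^sub>R x) = of_real (r\<^sup>2) * s x x"
  by (simp add: sesquilinear_form_scaleR[OF form] power2_eq_square)

text \<open>Both sides are continuous in \<open>y\<close> for the energy norm, for which
  \<open>DT\<close> is dense.\<close>

lemma op_form': "x \<in> DT \<Longrightarrow> y \<in> D \<Longrightarrow> cinner (T x) y = s x y"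
proof -
  assume x: "x \<in> DT" and y: "y \<in> D"
  have xD: "x \<in> D"
    using x dom_sub by blast
  obtain Y where Y: "\<And>n. Y n \<in> DT" "(\<lambda>n. E.fnorm (Y n - y)) \<longlonglongrightarrow> 0"
    using dense[OF y] by blast
  have YD: "Y n \<in> D" for n
    using Y dom_sub by blast
  have "(\<lambda>n. norm (Y n - y)) \<longlonglongrightarrow> 0"
    using Y(2) by (rule Lim_null_comparison[rotated]) (simp add: E.norm_le_fnorm YD y)
  hence "(\<lambda>n. cinner (Y n) (T x)) \<longlonglongrightarrow> cinner y (T x)" "(\<lambda>n. cinner (Y n) x) \<longlonglongrightarrow> cinner y x"
    by (auto intro: hilbert.tendsto_form_left)
  hence "(\<lambda>n. cinner (Y n) (T x) + of_real c * cinner (Y n) x) \<longlonglongrightarrow> cinner y (T x) + of_real c * cinner y x"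
    by (intro tendsto_intros)
  moreover have "cinner (Y n) (T x) = s (Y n) x" for n
    using op_form[OF x Y(1)[of n]] s_commute[OF YD xD] cinner_commute[of "Y n" "T x"] by simp
  moreover have "(\<lambda>n. e (Y n) x) \<longlonglongrightarrow> e y x"
    using YD y xD Y(2) by (rule E.tendsto_form_left)
  ultimately have "cinner y (T x) + of_real c * cinner y x = e y x"
    using LIMSEQ_unique[of "\<lambda>n. e (Y n) x" "cinner y (T x) + of_real c * cinner y x" "e y x"] by simp
  thus ?thesis
    using s_commute[OF xD y] cinner_commute[of "T x" y] by simp
qed

text \<open>The pair \<open>(u, f)\<close> lies in the adjoint graph, which self-adjointness
  identifies with the graph of \<open>T\<close>. This is the way from the form domain into the
  operator domain.\<close>

lemma representation:
  assumes "u \<in> D" "\<And>y. y \<in> D \<Longrightarrow> s u y = cinner f y"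
  shows "u \<in> DT" "T u = f"
proof -
  have "cinner (T x) u = cinner x f" if x: "x \<in> DT" for x
  proof -
    have "x \<in> D"
      using x dom_sub by blast
    thus ?thesis
      using op_form'[OF x assms(1)] s_commute[of x u] assms cinner_commute[of x f] by simp
  qed
  hence "(u, f) \<in> adjoint_graph DT T"
    by (simp add: adjoint_graph_def)
  thus "u \<in> DT" "T u = f"
    using selfadjoint by (auto simp: selfadjoint_op_def op_graph_def)
qed

text \<open>The vector \<open>u\<close> is the image of \<open>v\<close> under the resolvent at
  \<open>- c\<close>. It is the Riesz representative, in the energy space, of the inner product with
  \<open>v\<close>, which is bounded there because the energy norm dominates.\<close>

lemma resolvent:
  obtains u where "u \<in> DT" "u \<in> D" "T u + c *\<^sub>R u = v" "\<And>z. z \<in> D \<Longrightarrow> e z u = cinner z v"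
proof -
  have "cmod (cinner z v) \<le> norm v * E.fnorm z" if "z \<in> D" for z
    using hilbert.cauchy_schwarz[of z v] E.norm_le_fnorm[OF that]
    by (smt (verit) UNIV_I mult.commute mult_left_mono norm_ge_zero)
  hence "E.functional (\<lambda>z. cinner z v)"
    unfolding E.functional_def by (auto simp: cinner_add_left cinner_scaleC_left)
  then obtain u where u: "u \<in> D" "\<And>z. z \<in> D \<Longrightarrow> cinner z v = e z u"
    using E.riesz by blast
  have "s u y = cinner (v - c *\<^sub>R u) y" if y: "y \<in> D" for y
  proof -
    have "s u y = cnj (cinner y v) - of_real c * cnj (cinner y u)"
      using u(2)[OF y] s_commute[OF u(1) y] by simp
    also have "\<dots> = cinner v y - of_real c * cinner u y"
      by (simp flip: cinner_commute)
    finally show ?thesis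
      by (simp add: hilbert.diff_left hilbert.scaleR_left)
  qed
  from representation[OF u(1) this] have "u \<in> DT" "T u = v - c *\<^sub>R u"
    by auto
  with u that show ?thesis
    by (metis diff_add_cancel)
qed

text \<open>By \<open>resolvent\<close>, every inner product functional of the ambient space is
  given by the energy form, so weak convergence in the energy space is the stronger notion.\<close>

lemma weakly_tendstoI:
  assumes "\<And>n. X n \<in> D" "x \<in> D" "\<And>y. y \<in> D \<Longrightarrow> (\<lambda>n. e (X n) y) \<longlonglongrightarrow> e x y"
  shows "weakly_tendsto X x"
  unfolding weakly_tendsto_def
proof
  fix y
  obtain u where "u \<in> D" "\<And>z. z \<in> D \<Longrightarrow> e z u = cinner z y"
    using resolvent[of y] by metis
  thus "(\<lambda>n. cinner (X n) y) \<longlonglongrightarrow> cinner x y"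
    using assms(3)[of u] assms(1,2) by simp
qed

text \<open>Removes the operator domain, which may vary with the parameter, from all arguments about
  eigenvectors.\<close>

lemma eigenvector_iff:
  "x \<in> DT \<and> T x = l *\<^sub>C x \<longleftrightarrow> x \<in> D \<and> (\<forall>y\<in>D. s x y = l * cinner x y)"
proof
  assume "x \<in> DT \<and> T x = l *\<^sub>C x"
  thus "x \<in> D \<and> (\<forall>y\<in>D. s x y = l * cinner x y)"
    using op_form' dom_sub by (metis cinner_scaleC_left subsetD)
next
  assume "x \<in> D \<and> (\<forall>y\<in>D. s x y = l * cinner x y)"
  thus "x \<in> DT \<and> T x = l *\<^sub>C x"
    using representation[of x "l *\<^sub>C x"] by (simp add: cinner_scaleC_left)
qed

section \<open>The bottom of the essential spectrum in terms of the form\<close>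

text \<open>The form counterpart of the essential spectrum: vectors range over the form domain, and
  only form values have to converge. The infimum turns out to lie in the essential spectrum, which
  is all that is needed to bound the latter's minimum from above.\<close>

definition weak_values :: "real set" where
  "weak_values = {\<beta>. \<exists>X. (\<forall>n. X n \<in> D \<and> norm (X n) = 1) \<and> weakly_tendsto X 0 \<and>
     (\<lambda>n. Re (s (X n) (X n))) \<longlonglongrightarrow> \<beta>}"

lemma weak_values_lower: "\<beta> \<in> weak_values \<Longrightarrow> 1 - c \<le> \<beta>"
proof -
  assume "\<beta> \<in> weak_values"
  then obtain X where X: "\<And>n. X n \<in> D \<and> norm (X n) = 1" "(\<lambda>n. Re (s (X n) (X n))) \<longlonglongrightarrow> \<beta>"
    by (auto simp: weak_values_def)
  have "1 - c \<le> Re (s (X n) (X n))" for n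
    using lower_bound[of "X n"] X(1)[of n] by simp
  thus ?thesis
    using LIMSEQ_le_const[OF X(2)] by blast
qed

lemma bdd_below_weak_values: "bdd_below weak_values"
  using weak_values_lower by (intro bdd_belowI)

text \<open>Differences from a weak limit are weakly null but not normalized, so the bound is needed
  in homogeneous form. If the norms tend to \<open>0\<close>, it follows from semiboundedness;
  otherwise a tail of the sequence can be normalized.\<close>

lemma weak_value_scaled:
  assumes m: "\<And>\<beta>. \<beta> \<in> weak_values \<Longrightarrow> m \<le> \<beta>"
    and Z: "\<And>n. Z n \<in> D" "weakly_tendsto Z 0" "(\<lambda>n. norm (Z n)) \<longlonglongrightarrow> \<nu>" "(\<lambda>n. Re (s (Z n) (Z n))) \<longlonglongrightarrow> \<beta>"
  shows "m * \<nu>\<^sup>2 \<le> \<beta>"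
proof (cases "\<nu> = 0")
  case True
  have "(\<lambda>n. (1 - c) * (norm (Z n))\<^sup>2) \<longlonglongrightarrow> (1 - c) * 0\<^sup>2"
    using Z(3) True by (intro tendsto_intros) auto
  hence "(1 - c) * 0\<^sup>2 \<le> \<beta>"
    by (rule LIMSEQ_le[OF _ Z(4)]) (use lower_bound[OF Z(1)] in auto)
  thus ?thesis
    using True by simp
next
  case False
  have "\<nu> \<ge> 0"
    using LIMSEQ_le_const[OF Z(3), of 0] by simp
  hence pos: "\<nu> > 0"
    using False by simp
  obtain N where N: "\<And>n. n \<ge> N \<Longrightarrow> norm (Z n) > 0"
    using order_tendstoD(1)[OF Z(3) pos] by (auto simp: eventually_sequentially)
  define r where "r n = 1 / norm (Z (n + N))" for n
  define X where "X n = r n *\<^sub>R Z (n + N)" for n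
  have r: "r \<longlonglongrightarrow> 1 / \<nu>"
    unfolding r_def using False by (intro tendsto_intros LIMSEQ_ignore_initial_segment[OF Z(3)])
  have "X n \<in> D \<and> norm (X n) = 1" for n
    using N[of "n + N"] Z(1) by (simp add: X_def r_def)
  moreover have "weakly_tendsto (\<lambda>n. Z (n + N)) 0"
    using Z(2) LIMSEQ_ignore_initial_segment[of "\<lambda>n. cinner (Z n) y" for y]
    by (auto simp: weakly_tendsto_def)
  hence "weakly_tendsto X 0"
    unfolding X_def by (rule weakly_null_scaleR[OF _ r])
  moreover have "(\<lambda>n. (r n)\<^sup>2 * Re (s (Z (n + N)) (Z (n + N)))) \<longlonglongrightarrow> (1 / \<nu>)\<^sup>2 * \<beta>"
    by (intro tendsto_intros r LIMSEQ_ignore_initial_segment[OF Z(4)])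
  hence "(\<lambda>n. Re (s (X n) (X n))) \<longlonglongrightarrow> (1 / \<nu>)\<^sup>2 * \<beta>"
    using Z(1) by (simp add: X_def scaleR_scaleR del: of_real_power)
  ultimately have "(1 / \<nu>)\<^sup>2 * \<beta> \<in> weak_values"
    unfolding weak_values_def by blast
  from m[OF this] show ?thesis
    using pos by (simp add: field_simps)
qed

text \<open>The terms are picked from different weakly null sequences, with values approaching the
  infimum and each almost orthogonal to all earlier terms. This imposes finitely many conditions at
  each stage and still yields a weakly null subsequence.\<close>

lemma Inf_weak_values:
  assumes "weak_values \<noteq> {}"
  shows "Inf weak_values \<in> weak_values"
proof -
  define m where "m = Inf weak_values"
  define d :: "nat \<Rightarrow> real" where "d n = inverse (real (Suc n))" for n
  have d: "d n > 0" "d \<longlonglongrightarrow> 0" for n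
    using LIMSEQ_inverse_real_of_nat by (simp_all add: d_def[abs_def])
  have m_le: "m \<le> \<beta>" if "\<beta> \<in> weak_values" for \<beta>
    unfolding m_def using that bdd_below_weak_values by (rule cInf_lower)
  let ?P = "\<lambda>f n v. v \<in> D \<and> norm v = 1 \<and> Re (s v v) < m + d n \<and> (\<forall>i<n. cmod (cinner v (f i)) < d n)"
  have "\<exists>f. \<forall>n. ?P f n (f n)"
  proof (rule dependent_wellorder_choice)
    fix n :: nat and f :: "nat \<Rightarrow> 'a"
    obtain \<beta> where \<beta>: "\<beta> \<in> weak_values" "\<beta> < m + d n"
      using cInf_less_iff[OF assms bdd_below_weak_values, of "m + d n"] d(1)[of n] m_def by auto
    then obtain X where X: "\<And>k. X k \<in> D \<and> norm (X k) = 1" "weakly_tendsto X 0"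
      "(\<lambda>k. Re (s (X k) (X k))) \<longlonglongrightarrow> \<beta>"
      by (auto simp: weak_values_def)
    have "\<forall>\<^sub>F k in sequentially. cmod (cinner (X k) (f i)) < d n" for i
    proof -
      have "(\<lambda>k. cinner (X k) (f i)) \<longlonglongrightarrow> 0"
        using X(2) by (auto simp: weakly_tendsto_def dest: spec[of _ "f i"])
      from order_tendstoD(2)[OF tendsto_norm_zero[OF this] d(1)] show ?thesis .
    qed
    hence "\<forall>\<^sub>F k in sequentially. \<forall>i\<in>{..<n}. cmod (cinner (X k) (f i)) < d n"
      by (intro eventually_ball_finite) auto
    moreover have "\<forall>\<^sub>F k in sequentially. Re (s (X k) (X k)) < m + d n"
      using order_tendstoD(2)[OF X(3) \<beta>(2)] .
    ultimately have "\<forall>\<^sub>F k in sequentially. ?P f n (X k)"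
      by eventually_elim (use X(1) in auto)
    thus "\<exists>v. ?P f n v"
      using eventually_happens'[OF sequentially_bot] by blast
  qed auto
  then obtain v where v: "\<And>n. v n \<in> D" "\<And>n. norm (v n) = 1" "\<And>n. Re (s (v n) (v n)) < m + d n"
    "\<And>n i. i < n \<Longrightarrow> cmod (cinner (v n) (v i)) < d n"
    by blast
  have "(\<lambda>n. cinner (v n) (v i)) \<longlonglongrightarrow> 0" for i
    using d(2)
  proof (rule Lim_null_comparison[rotated])
    show "\<forall>\<^sub>F n in sequentially. norm (cinner (v n) (v i)) \<le> d n"
      using eventually_gt_at_top[of i] by eventually_elim (use v(4) in \<open>auto intro: less_imp_le\<close>)
  qed
  then obtain r where r: "strict_mono r" "weakly_tendsto (\<lambda>n. v (r n)) 0"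
    using almost_orthogonal_weakly_null[of v 1] v(2) by auto
  have bound: "\<bar>Re (s (v n) (v n))\<bar> \<le> \<bar>1 - c\<bar> + \<bar>m\<bar> + 1" for n
  proof -
    have "d n \<le> 1"
      by (simp add: d_def field_simps)
    thus ?thesis
      using lower_bound[OF v(1), of n] v(2)[of n] v(3)[of n] by simp
  qed
  obtain q \<beta> where q: "strict_mono q" "(\<lambda>n. Re (s (v (r (q n))) (v (r (q n))))) \<longlonglongrightarrow> \<beta>"
    using bounded_real_subseq[of "\<lambda>n. Re (s (v (r n)) (v (r n)))", OF bound] .
  have "\<beta> \<in> weak_values"
    unfolding weak_values_def using v(1,2) weakly_tendsto_subseq[OF r(2) q(1)] q(2)
    by (intro CollectI exI[of _ "\<lambda>n. v (r (q n))"] conjI allI)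
  moreover have "(\<lambda>n. m + d (r (q n))) \<longlonglongrightarrow> m + 0"
    by (intro tendsto_intros tendsto_subseq[OF tendsto_subseq[OF d(2)]] r q)
  hence "\<beta> \<le> m + 0"
    by (rule LIMSEQ_le[OF q(2)]) (use v(3) in \<open>auto intro: less_imp_le\<close>)
  ultimately show ?thesis
    using m_le[of \<beta>] by (simp flip: m_def)
qed

text \<open>
  A minimizing weakly null sequence \<open>v\<close> is turned into a singular sequence of the operator by the resolvent
  \<open>R\<close> at \<open>-c\<close>: with \<open>m\<close> the minimal value, \<open>k = m + c\<close> and \<open>h = v - k R v\<close>, the value of
  \<open>s - m\<close> at \<open>k R v = v - h\<close> is at most its value at \<open>v\<close> minus the squared energy norm of \<open>h\<close>,
  and by minimality of \<open>m\<close> it is asymptotically nonnegative, so \<open>h\<close> tends to \<open>0\<close>.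
\<close>

lemma Inf_weak_values_ess_spectrum:
  assumes "weak_values \<noteq> {}"
  shows "of_real (Inf weak_values) \<in> ess_spectrum DT T"
proof -
  define m where "m = Inf weak_values"
  define k where "k = m + c"
  have m: "m \<in> weak_values"
    unfolding m_def by (rule Inf_weak_values[OF assms])
  have m_le: "m \<le> \<beta>" if "\<beta> \<in> weak_values" for \<beta>
    unfolding m_def using that bdd_below_weak_values by (rule cInf_lower)
  have k: "k \<ge> 1"
    using weak_values_lower[OF m] by (simp add: k_def)
  obtain v where v: "\<And>n. v n \<in> D" "\<And>n. norm (v n) = 1" "weakly_tendsto v 0"
    "(\<lambda>n. Re (s (v n) (v n))) \<longlonglongrightarrow> m"
    using m by (auto simp: weak_values_def)
  have "\<exists>u. u \<in> DT \<and> u \<in> D \<and> T u + c *\<^sub>R u = w \<and> (\<forall>z\<in>D. e z u = cinner z w)" for w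
    using resolvent[of w] by metis
  then obtain R where R: "\<And>w. R w \<in> DT" "\<And>w. R w \<in> D" "\<And>w. T (R w) + c *\<^sub>R R w = w"
    "\<And>w z. z \<in> D \<Longrightarrow> e z (R w) = cinner z w"
    by metis
  \<comment> \<open>Applying \<open>T\<close> minus \<open>m\<close> to \<open>R (v n)\<close> gives
    exactly \<open>h n\<close>. So it remains to show that \<open>h\<close> tends to 0 while the
    norms of \<open>R (v n)\<close> stay away from 0.\<close>
  define h where "h n = v n - k *\<^sub>R R (v n)" for n
  have hD: "h n \<in> D" for n
    using v(1) R(2) by (simp add: h_def)
  have R_sym: "cinner (R w) y = cinner w (R y)" for w y
    using R(4)[OF R(2), of w y] R(4)[OF R(2), of y w] E.commute[OF R(2) R(2), of w y]
      cinner_commute[of w "R y"] by simp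
  have Rv_null: "weakly_tendsto (\<lambda>n. R (v n)) 0"
    using v(3) by (simp add: weakly_tendsto_def R_sym)
  have h_sq: "(E.fnorm (h n))\<^sup>2 = Re (e (v n) (h n)) - k * Re (cinner (v n) (h n))" for n
  proof -
    have "Re (e (R (v n)) (h n)) = Re (cinner (v n) (h n))"
      using R(4)[OF hD, of n "v n"] E.Re_commute[OF R(2) hD, of "v n" n]
        hilbert.Re_commute[of "v n" "h n"] by simp
    moreover have "e (h n) (h n) = e (v n) (h n) - of_real k * e (R (v n)) (h n)"
      using E.diff_left[of "v n" "k *\<^sub>R R (v n)" "h n"] E.scaleR_left[of "R (v n)" "h n" k] hD v(1) R(2)
      by (simp add: h_def[of n, symmetric])
    ultimately show ?thesis
      by (simp add: E.fnorm_sq[OF hD])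
  qed
  have key: "Re (s (k *\<^sub>R R (v n)) (k *\<^sub>R R (v n))) - m * (norm (k *\<^sub>R R (v n)))\<^sup>2
      \<le> Re (s (v n) (v n)) - m - (E.fnorm (h n))\<^sup>2" for n
  proof -
    have eq: "k *\<^sub>R R (v n) = v n - h n"
      by (simp add: h_def)
    \<comment> \<open>By \<open>h_sq\<close>, the mixed terms of both squares combine to minus twice
      the squared energy norm of \<open>h n\<close>; the negative term with the ambient norm of
      \<open>h n\<close> is then dropped.\<close>
    have "(E.fnorm (v n - h n))\<^sup>2 - k * (norm (v n - h n))\<^sup>2 =
      (E.fnorm (v n))\<^sup>2 - k * (norm (v n))\<^sup>2 + ((E.fnorm (h n))\<^sup>2 - k * (norm (h n))\<^sup>2) - 2 * (E.fnorm (h n))\<^sup>2"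
      unfolding h_sq[of n] hilbert.fnorm_diff_sq[OF UNIV_I UNIV_I] E.fnorm_diff_sq[OF v(1) hD]
      by (simp add: algebra_simps)
    also have "\<dots> \<le> (E.fnorm (v n))\<^sup>2 - k - (E.fnorm (h n))\<^sup>2"
      using k v(2) by simp
    finally show ?thesis
      unfolding eq using v(1,2) hD by (simp add: fnorm_sq k_def algebra_simps)
  qed
  have h0: "(\<lambda>n. E.fnorm (h n)) \<longlonglongrightarrow> 0"
  proof (rule ccontr)
    assume "\<not> ?thesis"
    then obtain \<delta> where \<delta>: "\<delta> > 0" "\<not> (\<forall>\<^sub>F n in sequentially. dist (E.fnorm (h n)) 0 < \<delta>)"
      unfolding tendsto_iff by blast
    hence "\<exists>\<^sub>F n in sequentially. \<delta> \<le> E.fnorm (h n)"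
      using E.fnorm_nonneg[OF hD] by (simp add: not_eventually not_less)
    then obtain r :: "nat \<Rightarrow> nat" where r: "strict_mono r" "\<And>n. \<delta> \<le> E.fnorm (h (r n))"
      using infinite_enumerate[of "{n. \<delta> \<le> E.fnorm (h n)}"]
      by (auto simp: frequently_cofinite cofinite_eq_sequentially[symmetric])
    \<comment> \<open>Where \<open>h\<close> stays away from 0, \<open>z\<close> lies below the
      minimal value by a fixed amount; further subsequences make its norms and form values converge,
      so that \<open>weak_value_scaled\<close> is contradicted.\<close>
    define z where "z n = k *\<^sub>R R (v (r n))" for n
    have zD: "z n \<in> D" for n
      using R(2) by (simp add: z_def)
    have norm_z: "norm (z n) \<le> k" for n
    proof -
      have "(norm (R w))\<^sup>2 \<le> norm w * norm (R w)" for w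
        using E.dominates[OF R(2), of w] R(4)[OF R(2), of w w] hilbert.Re_le_fnorm[of "R w" w]
        by (simp add: mult.commute)
      hence "norm (R w) \<le> norm w" for w
        by (metis mult_le_cancel_right norm_ge_zero order_le_less power2_eq_square not_less)
      thus ?thesis
        using k v(2)[of "r n"] by (metis abs_of_nonneg mult.right_neutral mult_left_mono norm_scaleR order_trans
            z_def zero_le_one)
    qed
    have upper: "Re (s (z n) (z n)) - m * (norm (z n))\<^sup>2 \<le> Re (s (v (r n)) (v (r n))) - m - \<delta>\<^sup>2" for n
      using key[of "r n"] power_mono[OF r(2)[of n] less_imp_le[OF \<delta>(1)], of 2] by (simp add: z_def)
    obtain B where B: "\<And>n. \<bar>Re (s (v n) (v n))\<bar> \<le> B"
      using Bseq_def convergent_imp_Bseq[OF convergentI[OF v(4)]] by (auto simp: Bseq_def)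
    have sq: "(norm (z n))\<^sup>2 \<le> k\<^sup>2" for n
      using norm_z[of n] by (simp add: power_mono)
    have "\<bar>Re (s (z n) (z n))\<bar> \<le> \<bar>1 - c\<bar> * k\<^sup>2 + \<bar>m\<bar> * k\<^sup>2 + B + \<bar>m\<bar>" for n
    proof -
      have "\<bar>(1 - c) * (norm (z n))\<^sup>2\<bar> \<le> \<bar>1 - c\<bar> * k\<^sup>2" "\<bar>m * (norm (z n))\<^sup>2\<bar> \<le> \<bar>m\<bar> * k\<^sup>2"
        using sq[of n] by (simp_all add: abs_mult mult_left_mono)
      moreover have "\<delta>\<^sup>2 \<ge> 0" by simp
      moreover have "\<bar>1 - c\<bar> * k\<^sup>2 \<ge> 0" by simp
      moreover have "\<bar>m\<bar> * k\<^sup>2 \<ge> 0" by simp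
      ultimately show ?thesis
        using lower_bound[OF zD, of n] upper[of n] B[of "r n"] by linarith
    qed
    then obtain q \<beta> where q: "strict_mono q" "(\<lambda>n. Re (s (z (q n)) (z (q n)))) \<longlonglongrightarrow> \<beta>"
      by (rule bounded_real_subseq)
    have "\<bar>norm (z (q n))\<bar> \<le> k" for n
      using norm_z by simp
    then obtain p \<nu> where p: "strict_mono p" "(\<lambda>n. norm (z (q (p n)))) \<longlonglongrightarrow> \<nu>"
      by (rule bounded_real_subseq)
    have lim: "(\<lambda>n. Re (s (z (q (p n))) (z (q (p n))))) \<longlonglongrightarrow> \<beta>"
      using tendsto_subseq[OF q(2) p(1)] .
    have "weakly_tendsto z 0"
      unfolding z_def
      by (rule weakly_null_scaleR[OF weakly_tendsto_subseq[OF Rv_null r(1)] tendsto_const])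
    hence "weakly_tendsto (\<lambda>n. z (q (p n))) 0"
      using weakly_tendsto_subseq[OF weakly_tendsto_subseq[OF _ q(1)] p(1)] by blast
    hence "m * \<nu>\<^sup>2 \<le> \<beta>"
      using weak_value_scaled[OF m_le zD _ p(2) lim] by blast
    moreover have "\<beta> - m * \<nu>\<^sup>2 \<le> m - m - \<delta>\<^sup>2"
    proof (rule LIMSEQ_le)
      show "(\<lambda>n. Re (s (z (q (p n))) (z (q (p n)))) - m * (norm (z (q (p n))))\<^sup>2) \<longlonglongrightarrow> \<beta> - m * \<nu>\<^sup>2"
        by (intro tendsto_intros lim p)
      show "(\<lambda>n. Re (s (v (r (q (p n)))) (v (r (q (p n))))) - m - \<delta>\<^sup>2) \<longlonglongrightarrow> m - m - \<delta>\<^sup>2"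
        using tendsto_subseq[OF tendsto_subseq[OF tendsto_subseq[OF v(4) r(1)] q(1)] p(1)]
        by (intro tendsto_intros) auto
    qed (use upper in auto)
    moreover have "\<delta>\<^sup>2 > 0"
      using \<delta>(1) by simp
    ultimately show False
      by linarith
  qed
  have h0': "(\<lambda>n. norm (h n)) \<longlonglongrightarrow> 0"
    using h0 by (rule Lim_null_comparison[rotated]) (simp add: E.norm_le_fnorm hD)
  have nR: "(\<lambda>n. norm (R (v n))) \<longlonglongrightarrow> 1 / k"
  proof -
    have "\<bar>norm (R (v n)) - 1 / k\<bar> \<le> norm (h n)" for n
    proof -
      have "k *\<^sub>R R (v n) = v n - h n"
        by (simp add: h_def)
      hence "norm (v n - h n) = k * norm (R (v n))"
        using k by (metis abs_of_nonneg norm_scaleR order_trans zero_le_one)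
      hence "\<bar>k * norm (R (v n)) - 1\<bar> \<le> norm (h n)"
        using norm_triangle_ineq3[of "v n - h n" "v n"] v(2)[of n] by simp
      moreover have "\<bar>k * norm (R (v n)) - 1\<bar> = k * \<bar>norm (R (v n)) - 1 / k\<bar>"
      proof -
        have "k * norm (R (v n)) - 1 = k * (norm (R (v n)) - 1 / k)"
          using k by (simp add: field_simps)
        thus ?thesis
          using k by (simp add: abs_mult)
      qed
      moreover have "1 * \<bar>norm (R (v n)) - 1 / k\<bar> \<le> k * \<bar>norm (R (v n)) - 1 / k\<bar>"
        using k by (intro mult_right_mono) auto
      ultimately show ?thesis by (simp only: mult_1)
    qed
    hence "\<forall>\<^sub>F n in sequentially. norm (norm (R (v n)) - 1 / k) \<le> norm (h n)"
      by simp
    from Lim_null_comparison[OF this h0'] show ?thesis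
      by (rule LIM_zero_cancel)
  qed
  have k': "1 / k > 0"
    using k by simp
  obtain N where N: "\<And>n. n \<ge> N \<Longrightarrow> norm (R (v n)) > 0"
    using order_tendstoD(1)[OF nR k'] by (auto simp: eventually_sequentially)
  define u where "u n = R (v (n + N))" for n
  define \<rho> where "\<rho> n = 1 / norm (u n)" for n
  have \<rho>: "\<rho> \<longlonglongrightarrow> 1 / (1 / k)"
    unfolding \<rho>_def u_def using k by (intro tendsto_intros LIMSEQ_ignore_initial_segment[OF nR]) auto
  define X where "X n = \<rho> n *\<^sub>R u n" for n
  have uDT: "u n \<in> DT" for n
    using R(1) by (simp add: u_def)
  have lin: "csubspace DT" "clinear_on DT T"
    using selfadjoint by (auto simp: selfadjoint_op_def)
  have "X n \<in> DT \<and> norm (X n) = 1" for n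
    using N[of "n + N"] uDT[of n] csubspace_scaleR[OF lin(1)] by (simp add: X_def \<rho>_def u_def)
  moreover have "weakly_tendsto u 0"
    using Rv_null LIMSEQ_ignore_initial_segment[of "\<lambda>n. cinner (R (v n)) y" for y]
    by (auto simp: weakly_tendsto_def u_def)
  hence "weakly_tendsto X 0"
    unfolding X_def by (rule weakly_null_scaleR[OF _ \<rho>])
  moreover have "(\<lambda>n. norm (T (X n) - of_real m *\<^sub>C X n)) \<longlonglongrightarrow> 0"
  proof -
    have "T (X n) - of_real m *\<^sub>C X n = \<rho> n *\<^sub>R h (n + N)" for n
    proof -
      have "T (X n) = \<rho> n *\<^sub>R T (u n)"
        using lin(2) uDT[of n] by (simp add: X_def clinear_on_def flip: scaleC_of_real)
      moreover have "T (u n) = v (n + N) - c *\<^sub>R u n"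
        using R(3)[of "v (n + N)"] by (simp add: u_def algebra_simps)
      hence "T (u n) - m *\<^sub>R u n = h (n + N)"
        by (simp add: h_def k_def u_def scaleR_add_left)
      ultimately show ?thesis
        by (simp add: scaleC_of_real X_def scaleR_diff_right scaleR_left_commute[of m] flip: \<open>T (u n) - m *\<^sub>R u n = h (n + N)\<close>)
    qed
    moreover have "(\<lambda>n. \<bar>\<rho> n\<bar> * norm (h (n + N))) \<longlonglongrightarrow> \<bar>1 / (1 / k)\<bar> * 0"
      by (intro tendsto_intros \<rho> LIMSEQ_ignore_initial_segment[OF h0'])
    ultimately show ?thesis by simp
  qed
  ultimately show ?thesis
    unfolding ess_spectrum_def m_def[symmetric] by blast
qed

text \<open>The bridge from form to operator: weakly null sequences in the form domain bound the
  bottom of the essential spectrum, although its definition refers to sequences in the operator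
  domain.\<close>

theorem ess_min_le:
  assumes "is_min_of \<Sigma> (ess_spectrum DT T)"
    and Z: "\<And>n. Z n \<in> D" "weakly_tendsto Z 0" "(\<lambda>n. norm (Z n)) \<longlonglongrightarrow> \<nu>" "(\<lambda>n. Re (s (Z n) (Z n))) \<longlonglongrightarrow> \<beta>"
  shows "\<Sigma> * \<nu>\<^sup>2 \<le> \<beta>"
proof (rule weak_value_scaled[OF _ Z])
  fix \<beta> assume \<beta>: "\<beta> \<in> weak_values"
  hence "\<Sigma> \<le> Inf weak_values"
    using Inf_weak_values_ess_spectrum assms(1) unfolding is_min_of_def by blast
  also have "\<dots> \<le> \<beta>"
    using \<beta> bdd_below_weak_values by (rule cInf_lower)
  finally show "\<Sigma> \<le> \<beta>" .
qed

end

section \<open>From the definition of the associated operator to energy density\<close>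

lemma closed_sectorial_form_restrict:
  assumes cl: "closed_sectorial_form D s" and E: "csubspace E" "E \<subseteq> D"
    and lim: "\<And>X x. (\<And>n. X n \<in> E) \<Longrightarrow> x \<in> D \<Longrightarrow> X \<longlonglongrightarrow> x \<Longrightarrow> (\<lambda>n. s (X n - x) (X n - x)) \<longlonglongrightarrow> 0 \<Longrightarrow> x \<in> E"
  shows "closed_sectorial_form E s"
proof -
  have "sesquilinear_form E s"
    using cl E unfolding closed_sectorial_form_def sesquilinear_form_def by (meson subsetD)
  moreover have "form_numrange E s \<subseteq> form_numrange D s"
    using E(2) by (auto simp: form_numrange_def)
  hence "sectorial_form E s"
    using cl unfolding closed_sectorial_form_def sectorial_form_def by (meson subsetD)
  moreover have "\<forall>X x. (\<forall>n. X n \<in> E) \<and> X \<longlonglongrightarrow> x \<and>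
      ((\<lambda>(n, m). s (X n - X m) (X n - X m)) \<longlongrightarrow> 0) (sequentially \<times>\<^sub>F sequentially)
      \<longrightarrow> x \<in> E \<and> (\<lambda>n. s (X n - x) (X n - x)) \<longlonglongrightarrow> 0"
  proof (intro allI impI)
    fix X :: "nat \<Rightarrow> 'a" and x
    assume X: "(\<forall>n. X n \<in> E) \<and> X \<longlonglongrightarrow> x \<and>
      ((\<lambda>(n, m). s (X n - X m) (X n - X m)) \<longlongrightarrow> 0) (sequentially \<times>\<^sub>F sequentially)"
    hence "x \<in> D \<and> (\<lambda>n. s (X n - x) (X n - x)) \<longlonglongrightarrow> 0"
      using cl E(2) unfolding closed_sectorial_form_def by blast
    thus "x \<in> E \<and> (\<lambda>n. s (X n - x) (X n - x)) \<longlonglongrightarrow> 0"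
      using lim[of X x] X by blast
  qed
  ultimately show ?thesis
    unfolding closed_sectorial_form_def by blast
qed

text \<open>With \<open>v\<close> the vertex of the sector, the numerical range lies to the right of
  \<open>Re v\<close>, so the shift by \<open>1 - Re v\<close> makes the energy dominate the squared
  norm. Energy Cauchy sequences are then Cauchy in the ambient space, and closedness applies to
  their limits.\<close>

lemma closed_symmetric_form_energy:
  assumes cl: "closed_sectorial_form D s" and sym: "symmetric_form D s"
  obtains c where "form_space D (\<lambda>x y. s x y + of_real c * cinner x y)"
proof -
  have sesq: "sesquilinear_form D s" and sec: "sectorial_form D s"
    using cl by (auto simp: closed_sectorial_form_def)
  have sub: "csubspace D"
    using sesq by (simp add: sesquilinear_form_def)
  obtain v \<theta> where v: "\<theta> < pi / 2" "\<And>z. z \<in> form_numrange D s \<Longrightarrow> \<bar>Arg (z - v)\<bar> \<le> \<theta>"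
    using sec unfolding sectorial_form_def by blast
  define c where "c = 1 - Re v"
  have s_scale: "s (r *\<^sub>R x) (r *\<^sub>R x) = of_real (r\<^sup>2) * s x x" if "x \<in> D" for r x
    using that csubspace_scaleR[OF sub that] by (simp add: sesquilinear_form_scaleR[OF sesq] power2_eq_square)
  have low: "Re v * (norm x)\<^sup>2 \<le> Re (s x x)" if x: "x \<in> D" for x
  proof (cases "x = 0")
    case True
    thus ?thesis using s_scale[OF x, of 0] by simp
  next
    case False
    define y where "y = (1 / norm x) *\<^sub>R x"
    have "y \<in> D" "norm y = 1"
      using False x csubspace_scaleR[OF sub] by (simp_all add: y_def)
    hence "s y y \<in> form_numrange D s"
      by (auto simp: form_numrange_def)
    hence "\<bar>Arg (s y y - v)\<bar> \<le> pi / 2"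
      using v by fastforce
    hence "Re v \<le> Re (s y y)"
      by (simp only: Arg_Re_nonneg) simp
    also have "s y y = of_real ((1 / norm x)\<^sup>2) * s x x"
      unfolding y_def by (rule s_scale[OF x])
    finally show ?thesis
      using False by (simp add: field_simps del: of_real_power)
  qed
  have Re_e: "Re (s x x + of_real c * cinner x x) = Re (s x x) + c * (norm x)\<^sup>2" for x
    by (simp add: Re_cinner_self)
  have "form_space D (\<lambda>x y. s x y + of_real c * cinner x y)"
  proof
    show "sesquilinear_form D (\<lambda>x y. s x y + of_real c * cinner x y)"
      using sesq unfolding sesquilinear_form_def
      by (simp add: cinner_add_left cinner_add_right cinner_scaleC_left cinner_scaleC_right algebra_simps)
    show "symmetric_form D (\<lambda>x y. s x y + of_real c * cinner x y)"
      unfolding symmetric_form_def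
    proof (intro ballI)
      fix x y assume "x \<in> D" "y \<in> D"
      hence "s x y = cnj (s y x)"
        using sym unfolding symmetric_form_def by blast
      thus "s x y + of_real c * cinner x y = cnj (s y x + of_real c * cinner y x)"
        using cinner_commute[of x y] by simp
    qed
    show "(norm x)\<^sup>2 \<le> Re (s x x + of_real c * cinner x x)" if "x \<in> D" for x
      using low[OF that] by (simp only: Re_e) (simp add: c_def algebra_simps)
  next
    fix X :: "nat \<Rightarrow> 'a"
    assume X: "\<And>n. X n \<in> D" "\<And>e. e > 0 \<Longrightarrow> \<exists>N. \<forall>m\<ge>N. \<forall>n\<ge>N.
      Re (s (X m - X n) (X m - X n) + of_real c * cinner (X m - X n) (X m - X n)) < e"
    have XD: "X m - X n \<in> D" for m n
      using X(1) csubspace_diff[OF sub] by blast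
    have real_s: "cmod (s x x) = \<bar>Re (s x x)\<bar>" if "x \<in> D" for x
    proof -
      have "s x x = cnj (s x x)"
        using sym that unfolding symmetric_form_def by blast
      from arg_cong[OF this, of Im] have "Im (s x x) = 0"
        by simp
      thus ?thesis
        by (simp add: cmod_eq_Re)
    qed
    have "Cauchy X"
    proof (rule metric_CauchyI)
      fix e :: real assume e: "e > 0"
      then obtain N where N: "\<And>m n. m \<ge> N \<Longrightarrow> n \<ge> N \<Longrightarrow>
        Re (s (X m - X n) (X m - X n)) + c * (norm (X m - X n))\<^sup>2 < e\<^sup>2"
        using X(2)[of "e\<^sup>2", unfolded Re_e] by (metis zero_less_power)
      have "norm (X m - X n) < e" if "m \<ge> N" "n \<ge> N" for m n
      proof -
        have "(norm (X m - X n))\<^sup>2 < e\<^sup>2"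
          using N[OF that] low[OF XD, of m n] by (simp add: c_def algebra_simps)
        thus ?thesis
          using e by (simp add: power2_less_imp_less)
      qed
      thus "\<exists>N. \<forall>m\<ge>N. \<forall>n\<ge>N. dist (X m) (X n) < e"
        by (auto simp: dist_norm)
    qed
    then obtain x where x: "X \<longlonglongrightarrow> x"
      by (auto simp: Cauchy_convergent_iff convergent_def)
    have "((\<lambda>(n, m). s (X n - X m) (X n - X m)) \<longlongrightarrow> 0) (sequentially \<times>\<^sub>F sequentially)"
      unfolding tendsto_iff
    proof (intro allI impI)
      fix e :: real assume e: "e > 0"
      \<comment> \<open>Chosen such that \<open>(\<bar>c\<bar> + 1) * d\<^sup>2 = e / 2\<close>:
        removing the shift from the energy then costs less than half of \<open>e\<close>.\<close>
      define d where "d = sqrt (e / (2 * (\<bar>c\<bar> + 1)))"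
      have d: "d > 0" and d_sq: "d\<^sup>2 = e / (2 * (\<bar>c\<bar> + 1))"
        using e by (simp_all add: d_def)
      obtain N1 where N1: "\<And>m n. m \<ge> N1 \<Longrightarrow> n \<ge> N1 \<Longrightarrow>
        Re (s (X m - X n) (X m - X n)) + c * (norm (X m - X n))\<^sup>2 < e / 2"
        using X(2)[of "e / 2", unfolded Re_e] e by (metis half_gt_zero)
      obtain N2 where N2: "\<And>m n. m \<ge> N2 \<Longrightarrow> n \<ge> N2 \<Longrightarrow> norm (X m - X n) < d"
        using metric_CauchyD[OF \<open>Cauchy X\<close> d] by (auto simp: dist_norm)
      have "cmod (s (X m - X n) (X m - X n)) < e" if "m \<ge> max N1 N2" "n \<ge> max N1 N2" for m n
      proof -
        have sq: "(norm (X m - X n))\<^sup>2 \<le> d\<^sup>2"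
          using N2[of m n] that by (intro power_mono) auto
        have "\<bar>c\<bar> * (norm (X m - X n))\<^sup>2 \<le> \<bar>c\<bar> * d\<^sup>2"
          using sq by (simp add: mult_left_mono)
        moreover have "\<bar>c\<bar> * d\<^sup>2 + d\<^sup>2 = e / 2"
        proof -
          have "(\<bar>c\<bar> + 1) * d\<^sup>2 = e / 2"
            unfolding d_sq by (simp add: field_simps)
          thus ?thesis by (simp add: algebra_simps)
        qed
        moreover have "Re (s (X m - X n) (X m - X n)) + c * (norm (X m - X n))\<^sup>2 < e / 2"
          using N1 that by simp
        moreover have "0 \<le> Re (s (X m - X n) (X m - X n)) + c * (norm (X m - X n))\<^sup>2"
          using low[OF XD, of m n] zero_le_power2[of "norm (X m - X n)"]
          unfolding c_def left_diff_distrib by linarith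
        moreover have "c * (norm (X m - X n))\<^sup>2 \<le> \<bar>c\<bar> * (norm (X m - X n))\<^sup>2"
          "- c * (norm (X m - X n))\<^sup>2 \<le> \<bar>c\<bar> * (norm (X m - X n))\<^sup>2"
          by (intro mult_right_mono; simp)+
        moreover have "d\<^sup>2 > 0" using d by simp
        ultimately show ?thesis
          unfolding real_s[OF XD] abs_less_iff by (auto simp only: mult_minus_left)
      qed
      thus "\<forall>\<^sub>F p in sequentially \<times>\<^sub>F sequentially. dist (case p of (n, m) \<Rightarrow> s (X n - X m) (X n - X m)) 0 < e"
        unfolding eventually_prod_sequentially by (intro exI[of _ "max N1 N2"]) auto
    qed
    hence xD: "x \<in> D" and lim: "(\<lambda>n. s (X n - x) (X n - x)) \<longlonglongrightarrow> 0"
      using cl X(1) x unfolding closed_sectorial_form_def by blast+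
    have "(\<lambda>n. Re (s (X n - x) (X n - x)) + c * (norm (X n - x))\<^sup>2) \<longlonglongrightarrow> Re 0 + c * 0\<^sup>2"
      by (intro tendsto_intros lim tendsto_norm_zero LIM_zero x)
    hence "(\<lambda>n. Re (s (X n - x) (X n - x) + of_real c * cinner (X n - x) (X n - x))) \<longlonglongrightarrow> 0"
      by (simp only: Re_e) simp
    with xD show "\<exists>x\<in>D. (\<lambda>n. Re (s (X n - x) (X n - x) + of_real c * cinner (X n - x) (X n - x))) \<longlonglongrightarrow> 0"
      by blast
  qed
  with that show ?thesis by blast
qed

text \<open>Let \<open>E\<close> be the energy closure of \<open>DT\<close> in \<open>D\<close>. The
  form on \<open>E\<close> is closed and extends the form on \<open>DT\<close>, so minimality of the
  form closure forces \<open>D\<close> into \<open>E\<close>; this turns a core into an energy dense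
  subspace.\<close>

lemma form_operator_pair_ex:
  assumes cl: "closed_sectorial_form D s" and sym: "symmetric_form D s" and op: "form_operator D s DT T"
  obtains c where "form_operator_pair D s DT T c"
proof -
  obtain c where c: "form_space D (\<lambda>x y. s x y + of_real c * cinner x y)"
    using closed_symmetric_form_energy[OF cl sym] by blast
  interpret E: form_space D "\<lambda>x y. s x y + of_real c * cinner x y"
    by (rule c)
  have DT: "selfadjoint_op DT T" "csubspace DT" "DT \<subseteq> D" "is_form_closure D s DT s"
    "\<And>x y. x \<in> DT \<Longrightarrow> y \<in> DT \<Longrightarrow> cinner (T x) y = s x y"
    using op by (auto simp: form_operator_def form_core_def)
  define E where "E = {x \<in> D. \<exists>X. (\<forall>n. X n \<in> DT) \<and> (\<lambda>n. E.fnorm (X n - x)) \<longlonglongrightarrow> 0}"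
  have DT_E: "DT \<subseteq> E"
    unfolding E_def using DT(3) by (auto intro!: exI[of _ "\<lambda>_. x" for x])
  have "csubspace E"
    unfolding csubspace_def
  proof (intro conjI ballI allI)
    show "0 \<in> E"
      using DT_E csubspace_0[OF DT(2)] by blast
  next
    fix x y assume "x \<in> E" "y \<in> E"
    then obtain X Y where XY: "x \<in> D" "y \<in> D" "\<And>n. X n \<in> DT" "\<And>n. Y n \<in> DT"
      "(\<lambda>n. E.fnorm (X n - x)) \<longlonglongrightarrow> 0" "(\<lambda>n. E.fnorm (Y n - y)) \<longlonglongrightarrow> 0"
      unfolding E_def by blast
    have XYD: "X n \<in> D" "Y n \<in> D" for n
      using XY DT(3) by blast+
    have "(\<lambda>n. E.fnorm ((X n + Y n) - (x + y))) \<longlonglongrightarrow> 0"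
    proof (rule Lim_null_comparison)
      show "(\<lambda>n. E.fnorm (X n - x) + E.fnorm (Y n - y)) \<longlonglongrightarrow> 0"
        using tendsto_add[OF XY(5,6)] by simp
      have "E.fnorm ((X n + Y n) - (x + y)) \<le> E.fnorm (X n - x) + E.fnorm (Y n - y)" for n
        using E.fnorm_triangle[of "X n - x" "Y n - y"] XYD XY(1,2) by (simp add: algebra_simps)
      thus "\<forall>\<^sub>F n in sequentially. norm (E.fnorm ((X n + Y n) - (x + y))) \<le> E.fnorm (X n - x) + E.fnorm (Y n - y)"
        using E.fnorm_nonneg XYD XY(1,2) by simp
    qed
    moreover have "X n + Y n \<in> DT" for n
      using XY csubspace_add[OF DT(2)] by blast
    ultimately show "x + y \<in> E"
      unfolding E_def using XY(1,2) by (auto intro!: exI[of _ "\<lambda>n. X n + Y n"])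
  next
    fix d x assume "x \<in> E"
    then obtain X where X: "x \<in> D" "\<And>n. X n \<in> DT" "(\<lambda>n. E.fnorm (X n - x)) \<longlonglongrightarrow> 0"
      unfolding E_def by blast
    have XD: "X n \<in> D" for n
      using X DT(3) by blast
    have "d *\<^sub>C X n - d *\<^sub>C x = d *\<^sub>C (X n - x)" for n
      using scaleC_add_right[of d "X n - x" x] by (simp add: algebra_simps)
    hence "(\<lambda>n. E.fnorm (d *\<^sub>C X n - d *\<^sub>C x)) \<longlonglongrightarrow> 0"
      using tendsto_mult_left[OF X(3), of "cmod d"] XD X(1) by (simp add: E.fnorm_scaleC)
    moreover have "d *\<^sub>C X n \<in> DT" for n
      using X csubspace_scaleC[OF DT(2)] by blast
    ultimately show "d *\<^sub>C x \<in> E"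
      unfolding E_def using X(1) by (auto intro!: exI[of _ "\<lambda>n. d *\<^sub>C X n"])
  qed
  moreover have ED: "E \<subseteq> D"
    by (auto simp: E_def)
  moreover have "x \<in> E" if X: "\<And>n. X n \<in> E" "x \<in> D" "X \<longlonglongrightarrow> x" "(\<lambda>n. s (X n - x) (X n - x)) \<longlonglongrightarrow> 0" for X x
  proof -
    have XD: "X n \<in> D" for n
      using X(1) ED by blast
    have "(\<lambda>n. sqrt (Re (s (X n - x) (X n - x)) + c * (norm (X n - x))\<^sup>2)) \<longlonglongrightarrow> sqrt (Re 0 + c * 0\<^sup>2)"
      by (intro tendsto_intros X tendsto_norm_zero LIM_zero)
    hence lim: "(\<lambda>n. E.fnorm (X n - x)) \<longlonglongrightarrow> 0"
      by (simp add: E.fnorm_def Re_cinner_self)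
    have "\<exists>y\<in>DT. E.fnorm (y - X n) < inverse (real (Suc n))" for n
    proof -
      obtain Y where Y: "\<And>k. Y k \<in> DT" "(\<lambda>k. E.fnorm (Y k - X n)) \<longlonglongrightarrow> 0"
        using X(1)[of n] unfolding E_def by blast
      have "\<forall>\<^sub>F k in sequentially. E.fnorm (Y k - X n) < inverse (real (Suc n))"
        by (rule order_tendstoD(2)[OF Y(2)]) simp
      thus ?thesis
        using Y(1) eventually_happens'[OF sequentially_bot] by blast
    qed
    then obtain Y where Y: "\<And>n. Y n \<in> DT" "\<And>n. E.fnorm (Y n - X n) < inverse (real (Suc n))"
      by metis
    have YD: "Y n \<in> D" for n
      using Y DT(3) by blast
    have "(\<lambda>n. E.fnorm (Y n - x)) \<longlonglongrightarrow> 0"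
    proof (rule Lim_null_comparison)
      show "(\<lambda>n. inverse (real (Suc n)) + E.fnorm (X n - x)) \<longlonglongrightarrow> 0"
        using tendsto_add[OF LIMSEQ_inverse_real_of_nat lim] by simp
      have "E.fnorm (Y n - x) \<le> inverse (real (Suc n)) + E.fnorm (X n - x)" for n
        using E.fnorm_triangle[of "Y n - X n" "X n - x"] YD XD X(2) Y(2)[of n] by simp
      thus "\<forall>\<^sub>F n in sequentially. norm (E.fnorm (Y n - x)) \<le> inverse (real (Suc n)) + E.fnorm (X n - x)"
        using E.fnorm_nonneg YD X(2) by simp
    qed
    thus ?thesis
      unfolding E_def using X(2) Y(1) by blast
  qed
  ultimately have "closed_sectorial_form E s"
    by (intro closed_sectorial_form_restrict[OF cl]) blast+
  moreover have "form_extends E s DT s"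
    using DT_E by (simp add: form_extends_def)
  ultimately have "form_extends E s D s"
    using DT(4) unfolding is_form_closure_def by blast
  hence "D \<subseteq> E"
    by (simp add: form_extends_def)
  have "form_operator_pair D s DT T c"
  proof (rule form_operator_pair.intro)
    show "sesquilinear_form D s"
      using cl by (simp add: closed_sectorial_form_def)
    show "\<exists>X. (\<forall>n. X n \<in> DT) \<and> (\<lambda>n. E.fnorm (X n - x)) \<longlonglongrightarrow> 0" if "x \<in> D" for x
      using \<open>D \<subseteq> E\<close> that by (auto simp: E_def)
  qed (fact c DT)+
  with that show ?thesis by blast
qed

section \<open>Uniform estimates for families of forms\<close>

lemma sesquilinear_form_diff_left:
  assumes "sesquilinear_form D f" "x \<in> D" "y \<in> D" "z \<in> D"
  shows "f (x - y) z = f x z - f y z"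
proof -
  have "- y \<in> D"
    using assms csubspace_minus by (auto simp: sesquilinear_form_def)
  thus ?thesis
    using sesquilinear_formD(1)[OF assms(1,2) _ assms(4), of "- y"]
      sesquilinear_form_scaleR(1)[OF assms(1,3,4), of "-1"] by simp
qed

lemma sesquilinear_form_diff_right:
  assumes "sesquilinear_form D f" "x \<in> D" "y \<in> D" "z \<in> D"
  shows "f x (y - z) = f x y - f x z"
proof -
  have "- z \<in> D"
    using assms csubspace_minus by (auto simp: sesquilinear_form_def)
  thus ?thesis
    using sesquilinear_formD(2)[OF assms(1,2,3), of "- z"]
      sesquilinear_form_scaleR(2)[OF assms(1,2,4), of "-1"] by simp
qed

lemma sesquilinear_form_lincomb:
  assumes "sesquilinear_form D f" "sesquilinear_form D g"
  shows "sesquilinear_form D (\<lambda>x y. p * f x y + q * g x y)"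
  using assms(1) unfolding sesquilinear_form_def
  by (simp add: sesquilinear_formD[OF assms(2)] algebra_simps)

lemma sesquilinear_form_limit:
  assumes f: "\<And>n :: nat. sesquilinear_form D (f n)"
    and lim: "\<And>x y. x \<in> D \<Longrightarrow> y \<in> D \<Longrightarrow> (\<lambda>n. f n x y) \<longlonglongrightarrow> g x y"
  shows "sesquilinear_form D g"
proof -
  have sub: "csubspace D"
    using f by (simp add: sesquilinear_form_def)
  show ?thesis
    unfolding sesquilinear_form_def
  proof (intro conjI ballI allI sub)
    fix x y z assume xyz: "x \<in> D" "y \<in> D" "z \<in> D"
    have "(\<lambda>n. f n (x + y) z) \<longlonglongrightarrow> g x z + g y z"
      using tendsto_add[OF lim[OF xyz(1,3)] lim[OF xyz(2,3)]] by (simp add: sesquilinear_formD[OF f] xyz)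
    thus "g (x + y) z = g x z + g y z"
      using LIMSEQ_unique lim[OF csubspace_add[OF sub xyz(1,2)] xyz(3)] by blast
    have "(\<lambda>n. f n x (y + z)) \<longlonglongrightarrow> g x y + g x z"
      using tendsto_add[OF lim[OF xyz(1,2)] lim[OF xyz(1,3)]] by (simp add: sesquilinear_formD[OF f] xyz)
    thus "g x (y + z) = g x y + g x z"
      using LIMSEQ_unique lim[OF xyz(1) csubspace_add[OF sub xyz(2,3)]] by blast
  next
    fix d x y assume xy: "x \<in> D" "y \<in> D"
    have "(\<lambda>n. f n (d *\<^sub>C x) y) \<longlonglongrightarrow> d * g x y"
      using tendsto_mult_left[OF lim[OF xy]] by (simp add: sesquilinear_formD[OF f] xy)
    thus "g (d *\<^sub>C x) y = d * g x y"
      using LIMSEQ_unique lim[OF csubspace_scaleC[OF sub xy(1)] xy(2)] by blast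
    have "(\<lambda>n. f n x (d *\<^sub>C y)) \<longlonglongrightarrow> cnj d * g x y"
      using tendsto_mult_left[OF lim[OF xy]] by (simp add: sesquilinear_formD[OF f] xy)
    thus "g x (d *\<^sub>C y) = cnj d * g x y"
      using LIMSEQ_unique lim[OF xy(1) csubspace_scaleC[OF sub xy(2)]] by blast
  qed
qed

text \<open>
  The second energy norm is a supremum of functionals that are continuous on the ambient space, hence
  for the first energy norm, so that uniform boundedness applies.
\<close>

lemma (in form_space) energy_norm_le:
  assumes "form_operator_pair D s' DT T c"
  obtains M where "M \<ge> 0" "\<And>x. x \<in> D \<Longrightarrow> form_space.fnorm (\<lambda>x y. s' x y + of_real c * cinner x y) x \<le> M * fnorm x"
proof -
  interpret Q: form_operator_pair D s' DT T c
    by (rule assms)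
  have l_eq: "cinner x (T y + c *\<^sub>R y) = Q.e x y" if "x \<in> D" "y \<in> DT" for x y
  proof -
    have y: "y \<in> D"
      using that Q.dom_sub by blast
    have "cinner x (T y) = s' x y"
      using Q.op_form'[OF that(2,1)] Q.s_commute[OF that(1) y] cinner_commute[of x "T y"] by simp
    thus ?thesis
      by (simp add: cinner_add_right hilbert.scaleR_right)
  qed
  obtain K where K: "\<And>y x. y \<in> {y \<in> DT. Q.E.fnorm y \<le> 1} \<Longrightarrow> x \<in> D \<Longrightarrow> cmod (cinner x (T y + c *\<^sub>R y)) \<le> K * fnorm x"
  proof (rule uniform_boundedness[of "{y \<in> DT. Q.E.fnorm y \<le> 1}" "\<lambda>y x. cinner x (T y + c *\<^sub>R y)"])
    fix y
    have "cmod (cinner x w) \<le> norm w * fnorm x" if "x \<in> D" for x w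
      using hilbert.cauchy_schwarz[of x w] norm_le_fnorm[OF that]
      by (smt (verit) UNIV_I mult.commute mult_left_mono norm_ge_zero)
    thus "functional (\<lambda>x. cinner x (T y + c *\<^sub>R y))"
      unfolding functional_def by (auto simp: cinner_add_left cinner_scaleC_left)
  next
    fix x assume x: "x \<in> D"
    have "cmod (cinner x (T y + c *\<^sub>R y)) \<le> Q.E.fnorm x" if "y \<in> {y \<in> DT. Q.E.fnorm y \<le> 1}" for y
    proof -
      have y: "y \<in> D"
        using that Q.dom_sub by blast
      have "cmod (Q.e x y) \<le> Q.E.fnorm x * Q.E.fnorm y"
        using x y by (rule Q.E.cauchy_schwarz)
      also have "\<dots> \<le> Q.E.fnorm x * 1"
        using that Q.E.fnorm_nonneg[OF x] by (intro mult_left_mono) auto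
      finally show ?thesis
        using l_eq[OF x, of y] that by simp
    qed
    thus "\<exists>C. \<forall>y\<in>{y \<in> DT. Q.E.fnorm y \<le> 1}. cmod (cinner x (T y + c *\<^sub>R y)) \<le> C"
      by blast
  qed blast
  have K1: "cmod (Q.e x y) \<le> \<bar>K\<bar> * fnorm x * Q.E.fnorm y" if x: "x \<in> D" and y: "y \<in> DT" for x y
  proof -
    have yD: "y \<in> D"
      using y Q.dom_sub by blast
    show ?thesis
    proof (cases "Q.E.fnorm y = 0")
      case True
      thus ?thesis
        using Q.E.cauchy_schwarz[OF x yD] by simp
    next
      case False
      hence pos: "Q.E.fnorm y > 0"
        using Q.E.fnorm_nonneg[OF yD] by simp
      define w where "w = (1 / Q.E.fnorm y) *\<^sub>R y"
      have w: "w \<in> DT"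
        using y csubspace_scaleR Q.selfadjoint by (auto simp: w_def selfadjoint_op_def)
      have "Q.E.fnorm w = 1"
        using pos by (simp add: w_def Q.E.fnorm_scaleR yD)
      hence "cmod (Q.e x w) \<le> K * fnorm x"
        using K[of w x] w x l_eq[OF x w] by simp
      also have "\<dots> \<le> \<bar>K\<bar> * fnorm x"
        using fnorm_nonneg[OF x] by (intro mult_right_mono) auto
      also have "Q.e x w = of_real (1 / Q.E.fnorm y) * Q.e x y"
        unfolding w_def by (rule Q.E.scaleR_right[OF x yD])
      finally show ?thesis
        using pos by (simp add: norm_mult norm_divide field_simps)
    qed
  qed
  have "Q.E.fnorm x \<le> \<bar>K\<bar> * fnorm x" if x: "x \<in> D" for x
  proof -
    obtain Y where Y: "\<And>n. Y n \<in> DT" "(\<lambda>n. Q.E.fnorm (Y n - x)) \<longlonglongrightarrow> 0"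
      using Q.dense[OF x] by blast
    have YD: "Y n \<in> D" for n
      using Y Q.dom_sub by blast
    \<comment> \<open>The bound \<open>K1\<close> passes from \<open>DT\<close> to \<open>x\<close>
      itself by approximation in one argument; cancelling a factor then compares the norms.\<close>
    have "cmod (Q.e x x) \<le> \<bar>K\<bar> * fnorm x * Q.E.fnorm x"
    proof (rule LIMSEQ_le)
      show "(\<lambda>n. cmod (Q.e (Y n) x)) \<longlonglongrightarrow> cmod (Q.e x x)"
        by (intro tendsto_norm Q.E.tendsto_form_left YD x Y)
      show "(\<lambda>n. \<bar>K\<bar> * fnorm x * Q.E.fnorm (Y n)) \<longlonglongrightarrow> \<bar>K\<bar> * fnorm x * Q.E.fnorm x"
        by (intro tendsto_intros Q.E.tendsto_fnorm YD x Y)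
      have "cmod (Q.e (Y n) x) = cmod (Q.e x (Y n))" for n
        using Q.E.commute[OF x YD, of n] by (metis complex_mod_cnj)
      thus "\<exists>N. \<forall>n\<ge>N. cmod (Q.e (Y n) x) \<le> \<bar>K\<bar> * fnorm x * Q.E.fnorm (Y n)"
        using K1[OF x Y(1)] by simp
    qed
    hence "Q.E.fnorm x * Q.E.fnorm x \<le> (\<bar>K\<bar> * fnorm x) * Q.E.fnorm x"
      unfolding Q.E.self_eq[OF x] by (simp add: power2_eq_square norm_mult)
    thus ?thesis
      using Q.E.fnorm_nonneg[OF x] fnorm_nonneg[OF x]
      by (cases "Q.E.fnorm x = 0") (simp_all add: mult_le_cancel_right)
  qed
  thus ?thesis
    using that[of "\<bar>K\<bar>"] by simp
qed

text \<open>All closed forms on the common domain are thereby measured by one fixed energy norm. The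
  shift belonging to the other form is controlled by the ambient norm.\<close>

lemma (in form_space) closed_form_bounded:
  assumes "form_operator_pair D s' DT T c"
  shows "\<exists>M. \<forall>x\<in>D. \<forall>y\<in>D. cmod (s' x y) \<le> M * fnorm x * fnorm y"
proof -
  interpret Q: form_operator_pair D s' DT T c
    by (rule assms)
  obtain M where M: "M \<ge> 0" "\<And>x. x \<in> D \<Longrightarrow> Q.E.fnorm x \<le> M * fnorm x"
    using energy_norm_le[OF assms] by blast
  have "cmod (s' x y) \<le> (M * M + \<bar>c\<bar>) * fnorm x * fnorm y" if x: "x \<in> D" and y: "y \<in> D" for x y
  proof -
    have "cmod (s' x y) \<le> cmod (Q.e x y) + cmod (of_real c * cinner x y)"
      using norm_triangle_ineq4[of "Q.e x y" "of_real c * cinner x y"] by simp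
    also have "cmod (Q.e x y) \<le> Q.E.fnorm x * Q.E.fnorm y"
      using x y by (rule Q.E.cauchy_schwarz)
    also have "\<dots> \<le> (M * fnorm x) * (M * fnorm y)"
      using M x y Q.E.fnorm_nonneg fnorm_nonneg by (intro mult_mono) auto
    also have "cmod (of_real c * cinner x y) \<le> \<bar>c\<bar> * (fnorm x * fnorm y)"
    proof -
      have "cmod (cinner x y) \<le> norm x * norm y"
        by (rule hilbert.cauchy_schwarz) auto
      also have "\<dots> \<le> fnorm x * fnorm y"
        using norm_le_fnorm x y fnorm_nonneg by (intro mult_mono) auto
      finally show ?thesis
        by (simp add: norm_mult mult_left_mono)
    qed
    finally show ?thesis
      by (simp add: algebra_simps)
  qed
  thus ?thesis by blast
qed

text \<open>
  The principle of uniform boundedness is applied to the difference quotients \<open>Q\<close>, which converge to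
  \<open>a1\<close>, and then to the remainders \<open>F\<close>.
\<close>

lemma (in form_space) uniform_expansion:
  fixes b :: "real \<Rightarrow> 'a \<Rightarrow> 'a \<Rightarrow> complex"
  assumes r: "r > 0"
    and pair: "\<And>t. t \<in> {0..r} \<Longrightarrow> \<exists>c. form_operator_pair D (b t) (DT t) (T t) c"
    and pw: "\<And>x y. x \<in> D \<Longrightarrow> y \<in> D \<Longrightarrow> \<exists>C. \<forall>s\<in>{0..r}. \<forall>t\<in>{0..r}.
      cmod (b t x y - b s x y - of_real (t - s) * a1 x y) \<le> C * \<bar>t - s\<bar> * (t + s)"
  obtains K where "K \<ge> 0" "sesquilinear_form D a1" "symmetric_form D a1"
    "\<And>x y. x \<in> D \<Longrightarrow> y \<in> D \<Longrightarrow> cmod (a1 x y) \<le> K * fnorm x * fnorm y"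
    "\<And>s t x y. s \<in> {0..r} \<Longrightarrow> t \<in> {0..r} \<Longrightarrow> x \<in> D \<Longrightarrow> y \<in> D \<Longrightarrow>
      cmod (b t x y - b s x y - of_real (t - s) * a1 x y) \<le> K * \<bar>t - s\<bar> * (t + s) * fnorm x * fnorm y"
proof -
  have b_sesq: "sesquilinear_form D (b t)" if "t \<in> {0..r}" for t
    using pair[OF that] by (auto dest: form_operator_pair.form)
  have b_sym: "b t x y = cnj (b t y x)" if "t \<in> {0..r}" "x \<in> D" "y \<in> D" for t x y
    using pair[OF that(1)] that(2,3) form_operator_pair.s_commute by blast
  have "\<exists>M. \<forall>x\<in>D. \<forall>y\<in>D. cmod (b t x y) \<le> M * fnorm x * fnorm y" if "t \<in> {0..r}" for t
    using pair[OF that] closed_form_bounded by blast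
  then obtain M where M: "\<And>t x y. t \<in> {0..r} \<Longrightarrow> x \<in> D \<Longrightarrow> y \<in> D \<Longrightarrow> cmod (b t x y) \<le> M t * fnorm x * fnorm y"
    by metis
  define h where "h n = r * inverse (real (Suc n))" for n
  have h: "h n > 0" "h n \<in> {0..r}" for n
    using r by (simp_all add: h_def field_simps)
  have "(\<lambda>n. r * inverse (real (Suc n))) \<longlonglongrightarrow> r * 0"
    by (intro tendsto_intros LIMSEQ_inverse_real_of_nat)
  hence h0: "h \<longlonglongrightarrow> 0"
    by (simp add: h_def[abs_def])
  define Q where "Q n x y = of_real (1 / h n) * b (h n) x y + of_real (- 1 / h n) * b 0 x y" for n x y
  have Q_lim: "(\<lambda>n. Q n x y) \<longlonglongrightarrow> a1 x y" if x: "x \<in> D" and y: "y \<in> D" for x y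
  proof -
    obtain C where C: "\<And>s t. s \<in> {0..r} \<Longrightarrow> t \<in> {0..r} \<Longrightarrow>
        cmod (b t x y - b s x y - of_real (t - s) * a1 x y) \<le> C * \<bar>t - s\<bar> * (t + s)"
      using pw[OF x y] by blast
    have "cmod (Q n x y - a1 x y) \<le> C * h n" for n
    proof -
      have "Q n x y - a1 x y = of_real (1 / h n) * (b (h n) x y - b 0 x y - of_real (h n - 0) * a1 x y)"
        using h(1)[of n] by (simp add: Q_def field_simps)
      also have "cmod \<dots> \<le> (1 / h n) * (C * \<bar>h n - 0\<bar> * (h n + 0))"
        unfolding norm_mult using h[of n] r C[of 0 "h n"] by (intro mult_mono) (auto simp: norm_divide)
      also have "\<dots> = C * h n"
        using h(1)[of n] by simp
      finally show ?thesis .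
    qed
    hence "(\<lambda>n. Q n x y - a1 x y) \<longlonglongrightarrow> 0"
      by (intro Lim_null_comparison[OF _ tendsto_mult_right_zero[OF h0, of C]]) simp
    thus ?thesis
      by (rule LIM_zero_cancel)
  qed
  have Q_sesq: "sesquilinear_form D (Q n)" for n
    unfolding Q_def[abs_def] using r by (intro sesquilinear_form_lincomb b_sesq h(2)) auto
  have a1_sesq: "sesquilinear_form D a1"
    by (rule sesquilinear_form_limit[OF Q_sesq Q_lim])
  have a1_sym: "symmetric_form D a1"
    unfolding symmetric_form_def
  proof (intro ballI)
    fix x y assume xy: "x \<in> D" "y \<in> D"
    have "Q n x y = cnj (Q n y x)" for n
      unfolding Q_def using b_sym[OF h(2) xy, of n] b_sym[of 0 x y] xy r by simp
    hence "(\<lambda>n. Q n x y) \<longlonglongrightarrow> cnj (a1 y x)"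
      using tendsto_cnj[OF Q_lim[OF xy(2,1)]] by simp
    thus "a1 x y = cnj (a1 y x)"
      using Q_lim[OF xy] LIMSEQ_unique by blast
  qed
  obtain K1 where K1: "K1 \<ge> 0" "\<And>n x y. x \<in> D \<Longrightarrow> y \<in> D \<Longrightarrow> cmod (Q n x y) \<le> K1 * fnorm x * fnorm y"
  proof (rule uniform_boundedness_forms[of "UNIV :: nat set" Q])
    fix n
    show "sesquilinear_form D (Q n)" by (rule Q_sesq)
    have "cmod (Q n x y) \<le> (1 / h n * M (h n) + 1 / h n * M 0) * fnorm x * fnorm y" if "x \<in> D" "y \<in> D" for x y
    proof -
      have "cmod (Q n x y) \<le> 1 / h n * cmod (b (h n) x y) + 1 / h n * cmod (b 0 x y)"
        unfolding Q_def using h(1)[of n] by (intro norm_triangle_mono) (simp_all add: norm_mult norm_divide)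
      also have "\<dots> \<le> 1 / h n * (M (h n) * fnorm x * fnorm y) + 1 / h n * (M 0 * fnorm x * fnorm y)"
        using M[OF h(2) that, of n] M[of 0, OF _ that] h(1)[of n] r by (intro add_mono mult_left_mono) auto
      finally show ?thesis by (simp add: algebra_simps)
    qed
    thus "\<exists>M. \<forall>x\<in>D. \<forall>y\<in>D. cmod (Q n x y) \<le> M * fnorm x * fnorm y" by blast
  next
    fix x y assume "x \<in> D" "y \<in> D"
    from convergent_imp_Bseq[OF convergentI[OF Q_lim[OF this]]]
    show "\<exists>C. \<forall>n\<in>UNIV. cmod (Q n x y) \<le> C"
      by (auto simp: Bseq_def)
  qed blast
  have a1_bound: "cmod (a1 x y) \<le> K1 * fnorm x * fnorm y" if "x \<in> D" "y \<in> D" for x y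
    using LIMSEQ_le_const2[OF tendsto_norm[OF Q_lim[OF that]]] K1(2)[OF that] by blast
  \<comment> \<open>The diagonal, where the remainder is zero, is left out so that the weight
    \<open>w\<close> is positive. Remainders divided by \<open>w\<close> are bounded pointwise by
    assumption.\<close>
  define I where "I = {(s, t). s \<in> {0..r} \<and> t \<in> {0..r} \<and> s \<noteq> t}"
  define w where "w p = \<bar>snd p - fst p\<bar> * (snd p + fst p)" for p :: "real \<times> real"
  have w: "w p > 0" if "p \<in> I" for p
    using that by (auto simp: I_def w_def intro!: mult_pos_pos)
  \<comment> \<open>The factors 1 and 0 give \<open>F\<close> the shape of iterated combinations of
    two forms, as in \<open>sesquilinear_form_lincomb\<close>.\<close>
  define F where "F p x y = of_real (1 / w p) * (1 * (1 * b (snd p) x y + (- 1) * b (fst p) x y)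
      + (- of_real (snd p - fst p)) * a1 x y) + 0 * a1 x y" for p x y
  have F_eq: "cmod (F p x y) = cmod (b (snd p) x y - b (fst p) x y - of_real (snd p - fst p) * a1 x y) / w p"
    if "p \<in> I" for p x y
    using w[OF that] by (simp add: F_def norm_mult norm_divide left_diff_distrib) (simp add: algebra_simps)
  obtain K2 where K2: "K2 \<ge> 0" "\<And>p x y. p \<in> I \<Longrightarrow> x \<in> D \<Longrightarrow> y \<in> D \<Longrightarrow> cmod (F p x y) \<le> K2 * fnorm x * fnorm y"
  proof (rule uniform_boundedness_forms[of I F])
    fix p assume p: "p \<in> I"
    have pr: "fst p \<in> {0..r}" "snd p \<in> {0..r}"
      using p by (auto simp: I_def)
    show "sesquilinear_form D (F p)"
      unfolding F_def[abs_def] by (intro sesquilinear_form_lincomb a1_sesq b_sesq pr)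
    have "cmod (F p x y) \<le> (M (snd p) + M (fst p) + \<bar>snd p - fst p\<bar> * K1) / w p * fnorm x * fnorm y"
      if xy: "x \<in> D" "y \<in> D" for x y
    proof -
      have "cmod (b (snd p) x y - b (fst p) x y - of_real (snd p - fst p) * a1 x y)
        \<le> (cmod (b (snd p) x y) + cmod (b (fst p) x y)) + \<bar>snd p - fst p\<bar> * cmod (a1 x y)"
        by (rule order_trans[OF norm_triangle_ineq4 add_mono[OF norm_triangle_ineq4]])
          (metis norm_mult norm_of_real order_refl)
      also have "\<dots> \<le> (M (snd p) * fnorm x * fnorm y + M (fst p) * fnorm x * fnorm y)
          + \<bar>snd p - fst p\<bar> * (K1 * fnorm x * fnorm y)"
        using M[OF pr(1) xy] M[OF pr(2) xy] a1_bound[OF xy] by (intro add_mono mult_left_mono) auto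
      also have "\<dots> = (M (snd p) + M (fst p) + \<bar>snd p - fst p\<bar> * K1) * fnorm x * fnorm y"
        by (simp add: algebra_simps)
      finally show ?thesis
        unfolding F_eq[OF p] using w[OF p] by (simp add: divide_right_mono)
    qed
    thus "\<exists>M. \<forall>x\<in>D. \<forall>y\<in>D. cmod (F p x y) \<le> M * fnorm x * fnorm y" by blast
  next
    fix x y assume xy: "x \<in> D" "y \<in> D"
    obtain C where C: "\<And>s t. s \<in> {0..r} \<Longrightarrow> t \<in> {0..r} \<Longrightarrow>
        cmod (b t x y - b s x y - of_real (t - s) * a1 x y) \<le> C * \<bar>t - s\<bar> * (t + s)"
      using pw[OF xy] by blast
    have "cmod (F p x y) \<le> C" if p: "p \<in> I" for p
      unfolding F_eq[OF p] using w[OF p] C[of "fst p" "snd p"] p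
      by (auto simp: divide_le_eq w_def I_def mult.assoc)
    thus "\<exists>C. \<forall>p\<in>I. cmod (F p x y) \<le> C" by blast
  qed blast
  have K2': "cmod (b t x y - b s x y - of_real (t - s) * a1 x y) \<le> K2 * \<bar>t - s\<bar> * (t + s) * fnorm x * fnorm y"
    if "s \<in> {0..r}" "t \<in> {0..r}" "x \<in> D" "y \<in> D" for s t x y
  proof (cases "s = t")
    case False
    hence p: "(s, t) \<in> I"
      using that by (simp add: I_def)
    have "cmod (F (s, t) x y) * w (s, t) \<le> K2 * fnorm x * fnorm y * w (s, t)"
      using K2(2)[OF p that(3,4)] w[OF p] by (intro mult_right_mono) auto
    also have "cmod (F (s, t) x y) * w (s, t) = cmod (b t x y - b s x y - of_real (t - s) * a1 x y)"
      unfolding F_eq[OF p] using w[OF p] by simp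
    also have "K2 * fnorm x * fnorm y * w (s, t) = K2 * \<bar>t - s\<bar> * (t + s) * fnorm x * fnorm y"
      by (simp add: w_def)
    finally show ?thesis .
  qed simp
  show ?thesis
  proof (rule that[of "max K1 K2"])
    fix x y assume xy: "x \<in> D" "y \<in> D"
    hence nn: "0 \<le> fnorm x" "0 \<le> fnorm y"
      by (simp_all add: fnorm_nonneg)
    show "cmod (a1 x y) \<le> max K1 K2 * fnorm x * fnorm y"
      by (rule order_trans[OF a1_bound[OF xy]]) (intro mult_right_mono max.cobounded1 nn)
    fix s t assume st: "s \<in> {0..r}" "t \<in> {0..r}"
    show "cmod (b t x y - b s x y - of_real (t - s) * a1 x y) \<le> max K1 K2 * \<bar>t - s\<bar> * (t + s) * fnorm x * fnorm y"
      by (rule order_trans[OF K2'[OF st xy]])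
        (intro mult_right_mono max.cobounded2 nn, use st in auto)
  qed (use K1(1) a1_sesq a1_sym in auto)
qed

section \<open>Eigenvalues at the threshold\<close>

text \<open>If \<open>f t < 0\<close>, let \<open>u\<close> be the last point with
  \<open>f u \<ge> 0\<close>. By continuity \<open>f u = 0\<close>, and \<open>f\<close> is negative
  just after \<open>u\<close>, contrary to \<open>cross\<close>. Information is required only at
  zeros of \<open>f\<close>, which is why eigenvectors have to be controlled only where a level is
  met.\<close>

lemma nonneg_crossing:
  fixes f :: "real \<Rightarrow> real"
  assumes cont: "continuous_on {s..t} f" and st: "s \<le> t" and s: "f s \<ge> 0"
    and cross: "\<And>u. s \<le> u \<Longrightarrow> u < t \<Longrightarrow> f u = 0 \<Longrightarrow> \<forall>\<^sub>F v in at_right u. f v > 0"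
  shows "f t \<ge> 0"
proof (rule ccontr)
  assume neg: "\<not> f t \<ge> 0"
  define S where "S = {s..t} \<inter> f -` {0..}"
  have clS: "closed S"
    unfolding S_def by (intro continuous_closed_preimage cont) auto
  have sS: "s \<in> S"
    using s st by (simp add: S_def)
  have bdd: "bdd_above S"
    by (rule bdd_aboveI[of _ t]) (simp add: S_def)
  define u where "u = Sup S"
  have uS: "u \<in> S"
    unfolding u_def using clS bdd sS by (intro closed_contains_Sup) auto
  have u: "s \<le> u" "u < t" "f u \<ge> 0"
    using uS neg by (auto simp: S_def less_le)
  have after: "f v < 0" if "u < v" "v \<le> t" for v
  proof (rule ccontr)
    assume "\<not> f v < 0"
    hence "v \<in> S"
      using that u by (simp add: S_def)
    hence "v \<le> u"
      unfolding u_def using bdd by (rule cSup_upper)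
    thus False
      using that by simp
  qed
  have near: "\<forall>\<^sub>F v in at_right u. v \<in> {u<..t}"
    using u(2) by (auto simp: eventually_at_right intro!: exI[of _ t])
  have "f u = 0"
  proof (rule ccontr)
    assume "f u \<noteq> 0"
    hence "f u > 0"
      using u by simp
    obtain v where v: "u \<le> v" "v \<le> t" "f v = 0"
    proof -
      have "continuous_on {u..t} f"
        using cont u(1) by (auto intro: continuous_on_subset)
      thus ?thesis
        using IVT2'[of f t 0 u] \<open>f u > 0\<close> neg u(2) that by auto
    qed
    moreover have "v \<noteq> u"
      using v \<open>f u > 0\<close> by auto
    ultimately show False
      using after[of v] by simp
  qed
  from eventually_conj[OF cross[OF u(1,2) this] near]
  have "\<forall>\<^sub>F v in at_right u. False"
    by eventually_elim (use after in force)
  thus False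
    by simp
qed

text \<open>The interval of parameters is translated to start at \<open>0\<close>; \<open>\<tau>\<close> realizes the negative lower limit.\<close>

locale threshold = form_operator_pair D "b 0" "DT 0" "T 0" c
  for D :: "'a :: complex_hilbert set" and b :: "real \<Rightarrow> 'a \<Rightarrow> 'a \<Rightarrow> complex"
    and DT :: "real \<Rightarrow> 'a set" and T :: "real \<Rightarrow> 'a \<Rightarrow> 'a" and c :: real +
  fixes a1 :: "'a \<Rightarrow> 'a \<Rightarrow> complex" and \<Sigma> lam :: "real \<Rightarrow> real" and r K B gap :: real
    and \<tau> :: "nat \<Rightarrow> real"
  assumes r: "r > 0" and K: "K \<ge> 0" and B: "B \<ge> 0"
    and pair: "\<And>t. t \<in> {0..r} \<Longrightarrow> \<exists>c. form_operator_pair D (b t) (DT t) (T t) c"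
    and a1_sesq: "sesquilinear_form D a1" and a1_sym: "symmetric_form D a1"
    and a1_bound: "\<And>x y. x \<in> D \<Longrightarrow> y \<in> D \<Longrightarrow> cmod (a1 x y) \<le> K * E.fnorm x * E.fnorm y"
    and expansion: "\<And>s t x y. s \<in> {0..r} \<Longrightarrow> t \<in> {0..r} \<Longrightarrow> x \<in> D \<Longrightarrow> y \<in> D \<Longrightarrow>
      cmod (b t x y - b s x y - of_real (t - s) * a1 x y) \<le> K * \<bar>t - s\<bar> * (t + s) * E.fnorm x * E.fnorm y"
    and min: "\<And>t. t \<in> {0..r} \<Longrightarrow> is_min_of (\<Sigma> t) (ess_spectrum (DT t) (T t))"
    and lam_less: "\<And>t. t \<in> {0<..r} \<Longrightarrow> lam t < \<Sigma> t"
    and lam_eig: "\<And>t. t \<in> {0<..r} \<Longrightarrow> eigenvalue (DT t) (T t) (of_real (lam t))"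
    and eig_fnorm: "\<And>t x. t \<in> {0<..r} \<Longrightarrow> x \<in> D \<Longrightarrow> norm x = 1 \<Longrightarrow> b t x x = of_real (lam t) \<Longrightarrow> E.fnorm x \<le> B"
    and lam_cont: "continuous_on {0<..r} lam"
    and lam_lim: "(lam \<longlongrightarrow> \<Sigma> 0) (at_right 0)"
    and gap: "gap > 0"
    and \<tau>: "\<And>n. \<tau> n \<in> {0<..r}" "\<tau> \<longlonglongrightarrow> 0" "\<And>n. lam (\<tau> n) \<le> \<Sigma> (\<tau> n) - gap * \<tau> n"
begin

definition unit_eig :: "real \<Rightarrow> 'a \<Rightarrow> bool" where
  "unit_eig t x \<longleftrightarrow> x \<in> D \<and> norm x = 1 \<and> (\<forall>y\<in>D. b t x y = of_real (lam t) * cinner x y)"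

definition kernel :: "'a set" where
  "kernel = {x \<in> D. \<forall>y\<in>D. b 0 x y = of_real (\<Sigma> 0) * cinner x y}"

text \<open>The eigenvector has to lie in \<open>kernel\<close>. The compressed operator
  \<open>B0\<close> vanishes on the orthogonal complement of the kernel, so \<open>0\<close> may be
  an eigenvalue of \<open>B0\<close> without satisfying this condition.\<close>

definition kernel_eigenvalue :: "real \<Rightarrow> bool" where
  "kernel_eigenvalue \<mu> \<longleftrightarrow> (\<exists>x\<in>kernel. x \<noteq> 0 \<and> (\<forall>y\<in>kernel. a1 x y = of_real \<mu> * cinner x y))"

definition slope :: "real \<Rightarrow> real" where
  "slope t = (lam t - \<Sigma> 0) / t"

text \<open>A Lipschitz constant of the family in energy norm: \<open>K\<close> from the linear term
  and \<open>K * 2 * r\<close> from the remainder, where \<open>t + s \<le> 2 * r\<close>.\<close>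

definition lip :: real where "lip = K * (1 + 2 * r)"

section \<open>Energy-weak limits and unit eigenvectors\<close>

lemma zero_r: "0 \<in> {0..r}"
  using r by simp

lemma lip_nonneg: "lip \<ge> 0"
  using K r by (simp add: lip_def)

lemma b_sesq: "t \<in> {0..r} \<Longrightarrow> sesquilinear_form D (b t)"
  using pair by (auto dest: form_operator_pair.form)

lemma b_commute: "t \<in> {0..r} \<Longrightarrow> x \<in> D \<Longrightarrow> y \<in> D \<Longrightarrow> b t x y = cnj (b t y x)"
  using pair form_operator_pair.s_commute by blast

lemma a1_commute: "x \<in> D \<Longrightarrow> y \<in> D \<Longrightarrow> a1 x y = cnj (a1 y x)"
  using a1_sym unfolding symmetric_form_def by blast

lemma b_lip:
  assumes "s \<in> {0..r}" "t \<in> {0..r}" "x \<in> D" "y \<in> D"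
  shows "cmod (b t x y - b s x y) \<le> lip * \<bar>t - s\<bar> * E.fnorm x * E.fnorm y"
proof -
  have nn: "0 \<le> E.fnorm x" "0 \<le> E.fnorm y"
    using assms by (simp_all add: E.fnorm_nonneg)
  have "cmod (b t x y - b s x y) \<le> cmod (b t x y - b s x y - of_real (t - s) * a1 x y) + cmod (of_real (t - s) * a1 x y)"
    using norm_triangle_ineq[of "b t x y - b s x y - of_real (t - s) * a1 x y" "of_real (t - s) * a1 x y"] by simp
  also have "\<dots> \<le> K * \<bar>t - s\<bar> * (t + s) * E.fnorm x * E.fnorm y + \<bar>t - s\<bar> * (K * E.fnorm x * E.fnorm y)"
    unfolding norm_mult norm_of_real
    by (intro add_mono mult_left_mono expansion[OF assms] a1_bound assms) auto
  also have "\<dots> = K * \<bar>t - s\<bar> * (t + s + 1) * E.fnorm x * E.fnorm y"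
    by (simp add: algebra_simps)
  also have "\<dots> \<le> K * \<bar>t - s\<bar> * (1 + 2 * r) * E.fnorm x * E.fnorm y"
    using nn K assms by (intro mult_right_mono mult_left_mono) auto
  finally show ?thesis
    by (simp add: lip_def algebra_simps)
qed

lemma b0_bound: "x \<in> D \<Longrightarrow> y \<in> D \<Longrightarrow> cmod (b 0 x y) \<le> (1 + \<bar>c\<bar>) * E.fnorm x * E.fnorm y"
proof -
  assume x: "x \<in> D" and y: "y \<in> D"
  have "cmod (b 0 x y) \<le> cmod (e x y) + cmod (of_real c * cinner x y)"
    using norm_triangle_ineq4[of "e x y" "of_real c * cinner x y"] by simp
  moreover have "cmod (cinner x y) \<le> E.fnorm x * E.fnorm y"
    using hilbert.cauchy_schwarz[of x y] mult_mono[OF E.norm_le_fnorm[OF x] E.norm_le_fnorm[OF y]]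
      E.fnorm_nonneg[OF x] by simp
  hence "cmod (of_real c * cinner x y) \<le> \<bar>c\<bar> * (E.fnorm x * E.fnorm y)"
    by (simp add: norm_mult mult_left_mono)
  ultimately show ?thesis
    using E.cauchy_schwarz[OF x y] by (simp add: algebra_simps)
qed

lemma functional_b: "t \<in> {0..r} \<Longrightarrow> y \<in> D \<Longrightarrow> E.functional (\<lambda>x. b t x y)"
proof -
  assume t: "t \<in> {0..r}" and y: "y \<in> D"
  have "cmod (b t x y) \<le> ((1 + \<bar>c\<bar>) * E.fnorm y + lip * t * E.fnorm y) * E.fnorm x" if x: "x \<in> D" for x
  proof -
    have "cmod (b t x y) \<le> cmod (b 0 x y) + cmod (b t x y - b 0 x y)"
      by (rule norm_triangle_sub)
    also have "\<dots> \<le> (1 + \<bar>c\<bar>) * E.fnorm x * E.fnorm y + lip * \<bar>t - 0\<bar> * E.fnorm x * E.fnorm y"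
      by (intro add_mono b0_bound b_lip zero_r t x y)
    finally show ?thesis
      using t by (simp add: algebra_simps)
  qed
  thus ?thesis
    unfolding E.functional_def using y by (auto simp: sesquilinear_formD[OF b_sesq[OF t]])
qed

lemma functional_a1: "y \<in> D \<Longrightarrow> E.functional (\<lambda>x. a1 x y)"
proof -
  assume y: "y \<in> D"
  have "cmod (a1 x y) \<le> (K * E.fnorm y) * E.fnorm x" if x: "x \<in> D" for x
    using a1_bound[OF x y] by (simp add: algebra_simps)
  thus ?thesis
    unfolding E.functional_def using y by (auto simp: sesquilinear_formD[OF a1_sesq])
qed

text \<open>Weak convergence in the energy space. Unlike \<open>weakly_tendsto\<close>, it passes
  through the first argument of \<open>b t\<close> and \<open>a1\<close>, which are controlled by
  the energy norm only.\<close>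

definition wlim :: "(nat \<Rightarrow> 'a) \<Rightarrow> 'a \<Rightarrow> bool" where
  "wlim X x \<longleftrightarrow> (\<forall>n. X n \<in> D) \<and> x \<in> D \<and> (\<forall>y\<in>D. (\<lambda>n. e (X n) y) \<longlonglongrightarrow> e x y)"

lemma wlim_functional: "wlim X x \<Longrightarrow> E.functional l \<Longrightarrow> (\<lambda>n. l (X n)) \<longlonglongrightarrow> l x"
proof -
  assume X: "wlim X x" and "E.functional l"
  then obtain z where z: "z \<in> D" "\<And>x. x \<in> D \<Longrightarrow> l x = e x z"
    using E.riesz by blast
  thus ?thesis
    using X by (simp add: wlim_def)
qed

lemma wlim_weakly: "wlim X x \<Longrightarrow> weakly_tendsto X x"
  unfolding wlim_def by (intro weakly_tendstoI) auto

lemma wlim_cinner: "wlim X x \<Longrightarrow> (\<lambda>n. cinner (X n) y) \<longlonglongrightarrow> cinner x y"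
  using wlim_weakly by (auto simp: weakly_tendsto_def)

lemma wlim_subseq:
  assumes "\<And>n :: nat. X n \<in> D" "\<And>n. E.fnorm (X n) \<le> C"
  obtains k x where "strict_mono k" "wlim (\<lambda>n. X (k n)) x"
proof (rule E.weakly_compact[of X C, OF assms])
  fix k x
  assume "strict_mono k" "x \<in> D" "\<And>y. y \<in> D \<Longrightarrow> (\<lambda>n. e (X (k n)) y) \<longlonglongrightarrow> e x y"
  thus ?thesis
    using that[of k x] assms(1) by (simp add: wlim_def)
qed

lemma unit_eig_self:
  assumes "unit_eig t x"
  shows "b t x x = of_real (lam t)"
proof -
  have "cinner x x = 1"
    using assms power2_norm_eq_cinner[of x] by (simp add: unit_eig_def)
  thus ?thesis
    using assms by (simp add: unit_eig_def)
qed

lemma unit_eigD: "unit_eig t x \<Longrightarrow> x \<in> D" "unit_eig t x \<Longrightarrow> norm x = 1"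
  "unit_eig t x \<Longrightarrow> y \<in> D \<Longrightarrow> b t x y = of_real (lam t) * cinner x y"
  by (auto simp: unit_eig_def)

lemma unit_eig_fnorm: "t \<in> {0<..r} \<Longrightarrow> unit_eig t x \<Longrightarrow> E.fnorm x \<le> B"
  using eig_fnorm unit_eigD unit_eig_self by blast

lemma unit_eig_ex: "t \<in> {0<..r} \<Longrightarrow> \<exists>x. unit_eig t x"
proof -
  assume t: "t \<in> {0<..r}"
  then obtain d where "form_operator_pair D (b t) (DT t) (T t) d"
    using pair[of t] by auto
  then interpret Q: form_operator_pair D "b t" "DT t" "T t" d .
  obtain x where x: "x \<in> DT t" "x \<noteq> 0" "T t x = of_real (lam t) *\<^sub>C x"
    using lam_eig[OF t] by (auto simp: eigenvalue_def)
  hence x': "x \<in> D" "\<And>y. y \<in> D \<Longrightarrow> b t x y = of_real (lam t) * cinner x y"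
    using Q.eigenvector_iff[of x] by auto
  define u where "u = (1 / norm x) *\<^sub>R x"
  have "b t u y = of_real (lam t) * cinner u y" if y: "y \<in> D" for y
    unfolding u_def sesquilinear_form_scaleR(1)[OF Q.form x'(1) y] x'(2)[OF y] hilbert.scaleR_left[OF UNIV_I UNIV_I]
    by simp
  hence "unit_eig t u"
    using x(2) x'(1) by (simp add: unit_eig_def u_def)
  thus ?thesis ..
qed

lemma Re_b_self_sub:
  assumes s: "s \<in> {0..r}" and xy: "x \<in> D" "y \<in> D"
  shows "Re (b s (x - y) (x - y)) = Re (b s x x) - 2 * Re (b s x y) + Re (b s y y)"
proof -
  have "x - y \<in> D"
    using xy by simp
  hence "b s (x - y) (x - y) = b s x x - b s x y - (b s y x - b s y y)"
    using xy by (simp add: sesquilinear_form_diff_left[OF b_sesq[OF s]] sesquilinear_form_diff_right[OF b_sesq[OF s]])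
  moreover have "Re (b s y x) = Re (b s x y)"
    using b_commute[OF s xy] by simp
  ultimately show ?thesis by simp
qed

text \<open>Replacing \<open>b (s n)\<close> by \<open>b t\<close> costs a multiple of
  \<open>\<bar>s n - t\<bar>\<close>, since unit eigenvectors have energy at most \<open>B\<close>;
  the rest of the equation is continuous under \<open>wlim\<close>. The case \<open>t = 0\<close> is
  included.\<close>

lemma weak_limit_eigenvector:
  assumes t: "t \<in> {0..r}" and s: "\<And>n. s n \<in> {0<..r}" "s \<longlonglongrightarrow> t"
    and X: "\<And>n. unit_eig (s n) (X n)" "wlim X x" and l: "(\<lambda>n. lam (s n)) \<longlonglongrightarrow> l" and y: "y \<in> D"
  shows "b t x y = of_real l * cinner x y"
proof -
  have XD: "X n \<in> D" for n
    using X(1) unit_eigD by blast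
  have s': "s n \<in> {0..r}" for n
    using s(1)[of n] by simp
  have "(\<lambda>n. b (s n) (X n) y - b t (X n) y) \<longlonglongrightarrow> 0"
  proof (rule Lim_null_comparison)
    have "cmod (b (s n) (X n) y - b t (X n) y) \<le> lip * \<bar>s n - t\<bar> * B * E.fnorm y" for n
    proof -
      have "cmod (b (s n) (X n) y - b t (X n) y) \<le> lip * \<bar>s n - t\<bar> * E.fnorm (X n) * E.fnorm y"
        by (intro b_lip t s' XD y)
      also have "\<dots> \<le> lip * \<bar>s n - t\<bar> * B * E.fnorm y"
        using lip_nonneg unit_eig_fnorm[OF s(1) X(1)] E.fnorm_nonneg[OF y]
        by (intro mult_right_mono mult_left_mono) auto
      finally show ?thesis .
    qed
    thus "\<forall>\<^sub>F n in sequentially. norm (b (s n) (X n) y - b t (X n) y) \<le> lip * \<bar>s n - t\<bar> * B * E.fnorm y"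
      by simp
    have "(\<lambda>n. lip * \<bar>s n - t\<bar> * B * E.fnorm y) \<longlonglongrightarrow> lip * \<bar>t - t\<bar> * B * E.fnorm y"
      by (intro tendsto_intros s)
    thus "(\<lambda>n. lip * \<bar>s n - t\<bar> * B * E.fnorm y) \<longlonglongrightarrow> 0" by simp
  qed
  hence "(\<lambda>n. b (s n) (X n) y - b t (X n) y + b t (X n) y) \<longlonglongrightarrow> 0 + b t x y"
    by (intro tendsto_add wlim_functional[OF X(2) functional_b[OF t y]])
  moreover have "b (s n) (X n) y - b t (X n) y + b t (X n) y = of_real (lam (s n)) * cinner (X n) y" for n
    using unit_eigD(3)[OF X(1) y] by simp
  ultimately have "(\<lambda>n. of_real (lam (s n)) * cinner (X n) y) \<longlonglongrightarrow> b t x y"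
    by simp
  moreover have "(\<lambda>n. of_real (lam (s n)) * cinner (X n) y) \<longlonglongrightarrow> of_real l * cinner x y"
    by (intro tendsto_intros l wlim_cinner[OF X(2)])
  ultimately show ?thesis
    using LIMSEQ_unique by blast
qed

section \<open>Motion of the threshold and growth of the eigenvalue\<close>

text \<open>Being normalized and weakly null does not refer to the parameter, so \<open>Y\<close>
  also bounds the threshold at \<open>t\<close>. The expansion controls its form values there, and a
  subsequence makes them converge.\<close>

lemma threshold_upper:
  assumes Y: "\<And>n. Y n \<in> D" "\<And>n. norm (Y n) = 1" "\<And>n. E.fnorm (Y n) \<le> C" "weakly_tendsto Y 0"
    and b0: "(\<lambda>n. Re (b 0 (Y n) (Y n))) \<longlonglongrightarrow> \<Sigma> 0" and a1: "(\<lambda>n. Re (a1 (Y n) (Y n))) \<longlonglongrightarrow> \<beta>"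
    and t: "t \<in> {0..r}"
  shows "\<Sigma> t \<le> \<Sigma> 0 + t * \<beta> + K * t\<^sup>2 * C\<^sup>2"
proof -
  obtain d where "form_operator_pair D (b t) (DT t) (T t) d"
    using pair[OF t] by auto
  then interpret Q: form_operator_pair D "b t" "DT t" "T t" d .
  have diff: "\<bar>Re (b t (Y n) (Y n)) - (Re (b 0 (Y n) (Y n)) + t * Re (a1 (Y n) (Y n)))\<bar> \<le> K * t\<^sup>2 * C\<^sup>2" for n
  proof -
    have "\<bar>Re (b t (Y n) (Y n) - b 0 (Y n) (Y n) - of_real (t - 0) * a1 (Y n) (Y n))\<bar>
        \<le> K * \<bar>t - 0\<bar> * (t + 0) * E.fnorm (Y n) * E.fnorm (Y n)"
      by (rule order_trans[OF abs_Re_le_cmod expansion[OF zero_r t Y(1) Y(1)]])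
    also have "\<dots> = K * t\<^sup>2 * (E.fnorm (Y n))\<^sup>2"
      using t by (simp add: power2_eq_square)
    also have "\<dots> \<le> K * t\<^sup>2 * C\<^sup>2"
      using K Y(3)[of n] E.fnorm_nonneg[OF Y(1)] by (intro mult_left_mono power_mono) auto
    finally show ?thesis
      by (simp add: algebra_simps)
  qed
  have sum_lim: "(\<lambda>n. Re (b 0 (Y n) (Y n)) + t * Re (a1 (Y n) (Y n))) \<longlonglongrightarrow> \<Sigma> 0 + t * \<beta>"
    by (intro tendsto_intros b0 a1)
  from convergent_imp_Bseq[OF convergentI[OF this]]
  obtain M where M: "\<And>n. \<bar>Re (b 0 (Y n) (Y n)) + t * Re (a1 (Y n) (Y n))\<bar> \<le> M"
    by (auto simp: Bseq_def)
  have bd: "\<bar>Re (b t (Y n) (Y n))\<bar> \<le> M + K * t\<^sup>2 * C\<^sup>2" for n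
    using diff[of n] M[of n] by linarith
  obtain k \<gamma> where k: "strict_mono k" "(\<lambda>n. Re (b t (Y (k n)) (Y (k n)))) \<longlonglongrightarrow> \<gamma>"
    using bounded_real_subseq[of "\<lambda>n. Re (b t (Y n) (Y n))", OF bd] .
  have "\<Sigma> t * 1\<^sup>2 \<le> \<gamma>"
    by (rule Q.ess_min_le[OF min[OF t] Y(1) weakly_tendsto_subseq[OF Y(4) k(1)] _ k(2)]) (simp add: Y(2))
  moreover have "\<gamma> \<le> \<Sigma> 0 + t * \<beta> + K * t\<^sup>2 * C\<^sup>2"
  proof (rule LIMSEQ_le[OF k(2)])
    show "(\<lambda>n. Re (b 0 (Y (k n)) (Y (k n))) + t * Re (a1 (Y (k n)) (Y (k n))) + K * t\<^sup>2 * C\<^sup>2)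
        \<longlonglongrightarrow> \<Sigma> 0 + t * \<beta> + K * t\<^sup>2 * C\<^sup>2"
      by (intro tendsto_add tendsto_const tendsto_subseq[OF sum_lim k(1)])
  qed (intro exI allI impI, use diff in \<open>simp only: abs_le_iff diff_le_eq add.commute\<close>)
  ultimately show ?thesis by simp
qed

lemma a1_self_bounded:
  assumes "x \<in> D" "E.fnorm x \<le> C"
  shows "\<bar>Re (a1 x x)\<bar> \<le> K * C\<^sup>2"
proof -
  have "\<bar>Re (a1 x x)\<bar> \<le> K * E.fnorm x * E.fnorm x"
    by (rule order_trans[OF abs_Re_le_cmod a1_bound[OF assms(1,1)]])
  also have "\<dots> = K * (E.fnorm x)\<^sup>2"
    by (simp add: power2_eq_square)
  also have "\<dots> \<le> K * C\<^sup>2"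
    using K assms E.fnorm_nonneg by (intro mult_left_mono power_mono) auto
  finally show ?thesis .
qed

text \<open>A singular sequence of the operator at \<open>0\<close> has bounded energy and, along a
  subsequence, convergent values of \<open>a1\<close>. The resulting linear bound keeps the slopes
  along \<open>\<tau>\<close> bounded above.\<close>

lemma threshold_upper_ex:
  obtains M where "\<And>t. t \<in> {0..r} \<Longrightarrow> \<Sigma> t \<le> \<Sigma> 0 + t * M"
proof -
  have "of_real (\<Sigma> 0) \<in> ess_spectrum (DT 0) (T 0)"
    using min[OF zero_r] by (simp add: is_min_of_def)
  then obtain X where X: "\<And>n. X n \<in> DT 0" "\<And>n. norm (X n) = 1" "weakly_tendsto X 0"
    "(\<lambda>n. norm (T 0 (X n) - of_real (\<Sigma> 0) *\<^sub>C X n)) \<longlonglongrightarrow> 0"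
    unfolding ess_spectrum_def by blast
  have XD: "X n \<in> D" for n
    using X(1) dom_sub by blast
  have b0: "(\<lambda>n. Re (b 0 (X n) (X n))) \<longlonglongrightarrow> \<Sigma> 0"
  proof (rule LIM_zero_cancel, rule Lim_null_comparison[OF _ X(4)])
    have "\<bar>Re (b 0 (X n) (X n)) - \<Sigma> 0\<bar> \<le> norm (T 0 (X n) - of_real (\<Sigma> 0) *\<^sub>C X n)" for n
    proof -
      have "cinner (T 0 (X n) - of_real (\<Sigma> 0) *\<^sub>C X n) (X n) = b 0 (X n) (X n) - of_real (\<Sigma> 0)"
        using op_form'[OF X(1) XD, of n n] power2_norm_eq_cinner[of "X n"] X(2)[of n]
        by (simp add: hilbert.diff_left cinner_scaleC_left)
      thus ?thesis
        using hilbert.cauchy_schwarz[of "T 0 (X n) - of_real (\<Sigma> 0) *\<^sub>C X n" "X n"]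
          abs_Re_le_cmod[of "b 0 (X n) (X n) - of_real (\<Sigma> 0)"] X(2)[of n] by simp
    qed
    thus "\<forall>\<^sub>F n in sequentially. norm (Re (b 0 (X n) (X n)) - \<Sigma> 0) \<le> norm (T 0 (X n) - of_real (\<Sigma> 0) *\<^sub>C X n)"
      by simp
  qed
  from convergent_imp_Bseq[OF convergentI[OF b0]]
  obtain M where M: "\<And>n. \<bar>Re (b 0 (X n) (X n))\<bar> \<le> M"
    by (auto simp: Bseq_def)
  define C where "C = sqrt (M + \<bar>c\<bar>)"
  have fX: "E.fnorm (X n) \<le> C" for n
    unfolding C_def using fnorm_sq[OF XD, of n] X(2)[of n] M[of n] by (intro real_le_rsqrt) simp
  obtain k \<beta> where k: "strict_mono k" "(\<lambda>n. Re (a1 (X (k n)) (X (k n)))) \<longlonglongrightarrow> \<beta>"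
    using bounded_real_subseq[of "\<lambda>n. Re (a1 (X n) (X n))", OF a1_self_bounded[OF XD fX]] .
  have "\<Sigma> t \<le> \<Sigma> 0 + t * (\<beta> + K * r * C\<^sup>2)" if t: "t \<in> {0..r}" for t
  proof -
    have "\<Sigma> t \<le> \<Sigma> 0 + t * \<beta> + K * t\<^sup>2 * C\<^sup>2"
      by (rule threshold_upper[OF _ _ _ weakly_tendsto_subseq[OF X(3) k(1)] tendsto_subseq[OF b0 k(1)] k(2) t])
        (simp_all add: XD X(2) fX)
    also have "K * t\<^sup>2 * C\<^sup>2 \<le> K * (t * r) * C\<^sup>2"
      using t K by (intro mult_right_mono mult_left_mono) (auto simp: power2_eq_square mult_left_mono)
    finally show ?thesis
      by (simp add: algebra_simps)
  qed
  with that show ?thesis by blast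
qed

lemma unit_eig_form_limit:
  assumes t: "t \<in> {0..r}" and s: "\<And>n. s n \<in> {0<..r}" "s \<longlonglongrightarrow> t"
    and X: "\<And>n. unit_eig (s n) (X n)" and l: "(\<lambda>n. lam (s n)) \<longlonglongrightarrow> l"
  shows "(\<lambda>n. Re (b t (X n) (X n))) \<longlonglongrightarrow> l"
proof -
  have XD: "X n \<in> D" for n
    using X unit_eigD by blast
  have "(\<lambda>n. Re (b t (X n) (X n)) - lam (s n)) \<longlonglongrightarrow> 0"
  proof (rule Lim_null_comparison)
    have "\<bar>Re (b t (X n) (X n)) - lam (s n)\<bar> \<le> lip * \<bar>t - s n\<bar> * B * B" for n
    proof -
      have "\<bar>Re (b t (X n) (X n) - b (s n) (X n) (X n))\<bar> \<le> lip * \<bar>t - s n\<bar> * E.fnorm (X n) * E.fnorm (X n)"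
        by (rule order_trans[OF abs_Re_le_cmod b_lip]) (use s(1)[of n] t XD in auto)
      also have "\<dots> \<le> lip * \<bar>t - s n\<bar> * B * B"
        using lip_nonneg unit_eig_fnorm[OF s(1) X, of n] E.fnorm_nonneg[OF XD, of n] B by (intro mult_mono) auto
      finally show ?thesis
        using unit_eig_self[OF X, of n] by simp
    qed
    thus "\<forall>\<^sub>F n in sequentially. norm (Re (b t (X n) (X n)) - lam (s n)) \<le> lip * \<bar>t - s n\<bar> * B * B"
      by simp
    have "(\<lambda>n. lip * \<bar>t - s n\<bar> * B * B) \<longlonglongrightarrow> lip * \<bar>t - t\<bar> * B * B"
      by (intro tendsto_intros s)
    thus "(\<lambda>n. lip * \<bar>t - s n\<bar> * B * B) \<longlonglongrightarrow> 0" by simp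
  qed
  from tendsto_add[OF this l] show ?thesis by simp
qed

text \<open>
  For \<open>s\<close> decreasing to \<open>t > 0\<close>, eigenvectors \<open>X\<close> at \<open>s\<close> converge weakly to an eigenvector \<open>x\<close> at \<open>t\<close>,
  which is a unit vector since \<open>lam t\<close> is below the essential spectrum; testing the eigenvalue
  equations of \<open>X\<close> and \<open>x\<close> with each other gives the difference quotient of \<open>lam\<close>.
\<close>

lemma lam_increase:
  assumes t: "0 < t" "t < r" and \<kappa>: "\<And>x. unit_eig t x \<Longrightarrow> \<kappa> \<le> Re (a1 x x)"
    and q: "q < \<kappa> - 2 * K * t * B\<^sup>2"
  shows "\<forall>\<^sub>F s in at_right t. lam s - lam t > q * (s - t)"
proof (rule ccontr)
  assume "\<not> ?thesis"
  hence ne: "\<And>d. d > t \<Longrightarrow> \<exists>s>t. s < d \<and> lam s - lam t \<le> q * (s - t)"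
    unfolding eventually_at_right_field by (meson not_le)
  have "\<exists>s. t < s \<and> s < min r (t + inverse (real (Suc n))) \<and> lam s - lam t \<le> q * (s - t)" for n
    using ne[of "min r (t + inverse (real (Suc n)))"] t by (auto simp del: of_nat_Suc)
  then obtain s where s: "\<And>n. t < s n" "\<And>n. s n < min r (t + inverse (real (Suc n)))"
    "\<And>n. lam (s n) - lam t \<le> q * (s n - t)"
    by metis
  have s_r: "s n \<in> {0<..r}" for n
    using s(1)[of n] s(2)[of n] t by auto
  have t_r: "t \<in> {0..r}" "t \<in> {0<..r}"
    using t by auto
  have s_lim: "s \<longlonglongrightarrow> t"
  proof (rule LIM_zero_cancel, rule Lim_null_comparison[OF _ LIMSEQ_inverse_real_of_nat])
    have "\<bar>s n - t\<bar> \<le> inverse (real (Suc n))" for n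
      using s(1)[of n] s(2)[of n] by auto
    thus "\<forall>\<^sub>F n in sequentially. norm (s n - t) \<le> inverse (real (Suc n))"
      by simp
  qed
  have lam_s: "(\<lambda>n. lam (s n)) \<longlonglongrightarrow> lam t"
    using lam_cont s_r t_r(2) s_lim by (auto intro: continuous_on_tendsto_compose)
  obtain Y where Y: "\<And>n. unit_eig (s n) (Y n)"
    using unit_eig_ex[OF s_r] by metis
  have YD: "Y n \<in> D" for n
    using Y unit_eigD by blast
  obtain k x where k: "strict_mono k" and x: "wlim (\<lambda>n. Y (k n)) x"
    by (rule wlim_subseq[of Y B, OF YD unit_eig_fnorm[OF s_r Y]])
  have xD: "x \<in> D"
    using x by (simp add: wlim_def)
  have eig: "b t x y = of_real (lam t) * cinner x y" if "y \<in> D" for y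
    by (rule weak_limit_eigenvector[where s = "\<lambda>n. s (k n)" and X = "\<lambda>n. Y (k n)"])
      (use t_r s_r tendsto_subseq[OF s_lim k] Y x tendsto_subseq[OF lam_s k] that in auto)
  obtain d where "form_operator_pair D (b t) (DT t) (T t) d"
    using pair[OF t_r(1)] by auto
  then interpret Q: form_operator_pair D "b t" "DT t" "T t" d .
  have norm_x: "norm x = 1"
  proof -
    have cx: "cinner x x = of_real ((norm x)\<^sup>2)"
      by (rule power2_norm_eq_cinner[symmetric])
    \<comment> \<open>\<open>Z\<close> carries the mass lost in the weak limit: its squared norms
      tend to \<open>1 - (norm x)\<^sup>2\<close> and its form values to \<open>lam t\<close> times
      that number. Being weakly null, it cannot have a limit of form values below
      \<open>\<Sigma> t\<close> times that number.\<close>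
    define Z where "Z n = Y (k n) - x" for n
    have ZD: "Z n \<in> D" for n
      using YD xD by (simp add: Z_def)
    have Z_weak: "weakly_tendsto Z 0"
      unfolding weakly_tendsto_def Z_def
      using LIM_zero[OF wlim_cinner[OF x]] by (auto simp: hilbert.diff_left)
    have Re_Yx: "(\<lambda>n. Re (cinner (Y (k n)) x)) \<longlonglongrightarrow> (norm x)\<^sup>2"
      using tendsto_Re[OF wlim_cinner[OF x, of x]] by (simp add: Re_cinner_self)
    have "(\<lambda>n. (norm (Y (k n)))\<^sup>2 + (norm x)\<^sup>2 - 2 * Re (cinner (Y (k n)) x)) \<longlonglongrightarrow> 1 + (norm x)\<^sup>2 - 2 * (norm x)\<^sup>2"
      using tendsto_diff[OF tendsto_const tendsto_mult[OF tendsto_const Re_Yx], of "1 + (norm x)\<^sup>2" 2]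
      by (simp add: unit_eigD(2)[OF Y])
    hence Z_sq: "(\<lambda>n. (norm (Z n))\<^sup>2) \<longlonglongrightarrow> 1 - (norm x)\<^sup>2"
      unfolding Z_def hilbert.fnorm_diff_sq[OF UNIV_I UNIV_I] by simp
    hence Z_norm: "(\<lambda>n. norm (Z n)) \<longlonglongrightarrow> sqrt (1 - (norm x)\<^sup>2)"
      using tendsto_real_sqrt[OF Z_sq] by simp
    have pos: "1 - (norm x)\<^sup>2 \<ge> 0"
      using LIMSEQ_le_const[OF Z_sq, of 0] by auto
    have bY: "(\<lambda>n. Re (b t (Y (k n)) (Y (k n)))) \<longlonglongrightarrow> lam t"
      by (rule tendsto_subseq[OF unit_eig_form_limit[OF t_r(1) s_r s_lim Y lam_s] k])
    have bYx: "(\<lambda>n. Re (b t (Y (k n)) x)) \<longlonglongrightarrow> lam t * (norm x)\<^sup>2"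
      using tendsto_Re[OF wlim_functional[OF x functional_b[OF t_r(1) xD]]] by (simp add: eig[OF xD] cx)
    have "(\<lambda>n. Re (b t (Y (k n)) (Y (k n))) - 2 * Re (b t (Y (k n)) x) + Re (b t x x))
        \<longlonglongrightarrow> lam t - 2 * (lam t * (norm x)\<^sup>2) + lam t * (norm x)\<^sup>2"
      by (intro tendsto_add tendsto_diff tendsto_mult tendsto_const bY bYx) (simp add: eig[OF xD] cx)
    hence "(\<lambda>n. Re (b t (Z n) (Z n))) \<longlonglongrightarrow> lam t * (1 - (norm x)\<^sup>2)"
      unfolding Z_def Re_b_self_sub[OF t_r(1) YD xD] by (simp add: algebra_simps)
    from Q.ess_min_le[OF min[OF t_r(1)] ZD Z_weak Z_norm this]
    have "(\<Sigma> t - lam t) * (1 - (norm x)\<^sup>2) \<le> 0"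
      using pos by (simp add: algebra_simps)
    moreover have "\<Sigma> t - lam t > 0"
      using lam_less[OF t_r(2)] by simp
    ultimately have "1 - (norm x)\<^sup>2 \<le> 0"
      by (simp add: mult_le_0_iff)
    hence "(norm x)\<^sup>2 = 1"
      using pos by linarith
    thus ?thesis
      by (metis abs_norm_cancel abs_square_eq_1 power2_eq_1_iff norm_ge_zero abs_1 real_sqrt_abs real_sqrt_one)
  qed
  have ux: "unit_eig t x"
    using xD norm_x eig by (simp add: unit_eig_def)
  \<comment> \<open>Positivity of the factor \<open>Re (cinner (Y n) x)\<close>, whose limit along
    \<open>k\<close> is 1, allows the assumed bound on \<open>lam (s n) - lam t\<close> to be
    multiplied by it. The error tends to the \<open>2 * K * t * B\<^sup>2\<close> in the assumption
    on \<open>q\<close>.\<close>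
  have main: "q * Re (cinner (Y n) x) \<ge> Re (a1 (Y n) x) - K * (s n + t) * B\<^sup>2" if pos: "Re (cinner (Y n) x) > 0" for n
  proof -
    have "b (s n) (Y n) x - b t (Y n) x = of_real (lam (s n) - lam t) * cinner (Y n) x"
      using unit_eigD(3)[OF Y xD, of n] b_commute[OF t_r(1) YD xD, of n] unit_eigD(3)[OF ux YD, of n]
        cinner_commute[of "Y n" x] by (simp add: left_diff_distrib)
    hence eq: "Re (b (s n) (Y n) x - b t (Y n) x - of_real (s n - t) * a1 (Y n) x) =
        (lam (s n) - lam t) * Re (cinner (Y n) x) - (s n - t) * Re (a1 (Y n) x)"
      by simp
    have "\<bar>Re (b (s n) (Y n) x - b t (Y n) x - of_real (s n - t) * a1 (Y n) x)\<bar>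
        \<le> K * \<bar>s n - t\<bar> * (s n + t) * E.fnorm (Y n) * E.fnorm x"
      by (rule order_trans[OF abs_Re_le_cmod expansion]) (use s_r[of n] t_r YD xD in auto)
    also have "\<dots> \<le> K * \<bar>s n - t\<bar> * (s n + t) * B * B"
      using K s_r[of n] t_r unit_eig_fnorm[OF s_r Y, of n] unit_eig_fnorm[OF t_r(2) ux] E.fnorm_nonneg xD B
      by (intro mult_mono mult_nonneg_nonneg) (auto simp: YD)
    also have "\<dots> = (s n - t) * (K * (s n + t) * B\<^sup>2)"
      using s(1)[of n] by (simp add: power2_eq_square)
    finally have "(s n - t) * Re (a1 (Y n) x) - (s n - t) * (K * (s n + t) * B\<^sup>2) \<le> (lam (s n) - lam t) * Re (cinner (Y n) x)"
      unfolding eq by linarith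
    also have "\<dots> \<le> (q * (s n - t)) * Re (cinner (Y n) x)"
      using s(3)[of n] pos by (intro mult_right_mono) auto
    finally have "(s n - t) * (Re (a1 (Y n) x) - K * (s n + t) * B\<^sup>2) \<le> (s n - t) * (q * Re (cinner (Y n) x))"
      by (simp add: algebra_simps)
    thus ?thesis
      using s(1)[of n] by (simp add: mult_le_cancel_left)
  qed
  have "Re (a1 x x) - K * (t + t) * B\<^sup>2 \<le> q * 1"
  proof (rule LIMSEQ_le)
    show "(\<lambda>n. Re (a1 (Y (k n)) x) - K * (s (k n) + t) * B\<^sup>2) \<longlonglongrightarrow> Re (a1 x x) - K * (t + t) * B\<^sup>2"
      by (intro tendsto_intros wlim_functional[OF x functional_a1[OF xD]] tendsto_subseq[OF s_lim k])
    have lim1: "(\<lambda>n. Re (cinner (Y (k n)) x)) \<longlonglongrightarrow> 1"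
      using tendsto_Re[OF wlim_cinner[OF x, of x]] norm_x by (simp add: Re_cinner_self)
    thus "(\<lambda>n. q * Re (cinner (Y (k n)) x)) \<longlonglongrightarrow> q * 1"
      by (intro tendsto_intros)
    show "\<exists>N. \<forall>n\<ge>N. Re (a1 (Y (k n)) x) - K * (s (k n) + t) * B\<^sup>2 \<le> q * Re (cinner (Y (k n)) x)"
      using order_tendstoD(1)[OF lim1, of 0] main by (auto simp: eventually_sequentially)
  qed
  with \<kappa>[OF ux] q show False
    by (simp add: algebra_simps)
qed

text \<open>By \<open>lam_increase\<close>, a line of slope \<open>q\<close> through a point of the
  graph of \<open>lam\<close> is left upwards wherever the graph meets it, so the graph stays above
  it. The base point then moves to \<open>0\<close>, where \<open>lam\<close> tends to
  \<open>\<Sigma> 0\<close>.\<close>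

lemma lam_lower:
  assumes \<delta>: "0 < \<delta>" "\<delta> \<le> r" and \<kappa>: "\<And>t x. 0 < t \<Longrightarrow> t < \<delta> \<Longrightarrow> unit_eig t x \<Longrightarrow> \<kappa> \<le> Re (a1 x x)"
    and q: "q < \<kappa> - 2 * K * \<delta> * B\<^sup>2" and t: "0 < t" "t < \<delta>"
  shows "\<Sigma> 0 + q * t \<le> lam t"
proof -
  have mono: "lam s + q * (t - s) \<le> lam t" if s: "0 < s" "s < t" for s
  proof -
    have "lam t - lam s - q * (t - s) \<ge> 0"
    proof (rule nonneg_crossing[where f = "\<lambda>u. lam u - lam s - q * (u - s)" and s = s])
      have "continuous_on {s..t} lam"
        using lam_cont by (rule continuous_on_subset) (use s t \<delta> in auto)
      thus "continuous_on {s..t} (\<lambda>u. lam u - lam s - q * (u - s))"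
        by (intro continuous_intros)
      fix u assume u: "s \<le> u" "u < t" "lam u - lam s - q * (u - s) = 0"
      have "K * u * B\<^sup>2 \<le> K * \<delta> * B\<^sup>2"
        using K u t by (intro mult_right_mono mult_left_mono) auto
      hence "q < \<kappa> - 2 * K * u * B\<^sup>2"
        using q by linarith
      hence "\<forall>\<^sub>F v in at_right u. lam v - lam u > q * (v - u)"
        using u s t \<delta> by (intro lam_increase[of u \<kappa>] \<kappa>) auto
      thus "\<forall>\<^sub>F v in at_right u. lam v - lam s - q * (v - s) > 0"
        by eventually_elim (use u(3) in \<open>simp add: algebra_simps\<close>)
    qed (use s in auto)
    thus ?thesis by simp
  qed
  have "((\<lambda>s. lam s + q * (t - s)) \<longlongrightarrow> \<Sigma> 0 + q * (t - 0)) (at_right 0)"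
    by (intro tendsto_intros lam_lim)
  moreover have "\<forall>\<^sub>F s in at_right 0. lam s + q * (t - s) \<le> lam t"
    using t(1) mono by (auto simp: eventually_at_right intro!: exI[of _ t])
  ultimately have "\<Sigma> 0 + q * (t - 0) \<le> lam t"
    by (rule tendsto_upperbound) simp
  thus ?thesis by simp
qed

section \<open>Existence of the limit slope\<close>

text \<open>A lower bound for every \<open>\<beta>\<close> to which \<open>threshold_upper\<close>
  applies. The energy bound \<open>C\<close> is left free, since eigenvectors at small parameters
  and normalized kernel vectors come with different ones.\<close>

definition lower_slope :: "real \<Rightarrow> bool" where
  "lower_slope \<sigma> \<longleftrightarrow> (\<forall>Y C \<beta>. (\<forall>n. Y n \<in> D) \<longrightarrow> (\<forall>n. norm (Y n) = 1) \<longrightarrow> (\<forall>n. E.fnorm (Y n) \<le> C) \<longrightarrow>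
     weakly_tendsto Y 0 \<longrightarrow> (\<lambda>n. Re (b 0 (Y n) (Y n))) \<longlonglongrightarrow> \<Sigma> 0 \<longrightarrow>
     (\<lambda>n. Re (a1 (Y n) (Y n))) \<longlonglongrightarrow> \<beta> \<longrightarrow> \<sigma> \<le> \<beta>)"

lemma lower_slopeD:
  assumes "lower_slope \<sigma>" "\<And>n. Y n \<in> D" "\<And>n. norm (Y n) = 1" "\<And>n. E.fnorm (Y n) \<le> C"
    "weakly_tendsto Y 0" "(\<lambda>n. Re (b 0 (Y n) (Y n))) \<longlonglongrightarrow> \<Sigma> 0" "(\<lambda>n. Re (a1 (Y n) (Y n))) \<longlonglongrightarrow> \<beta>"
  shows "\<sigma> \<le> \<beta>"
  using assms unfolding lower_slope_def by blast

text \<open>The slopes along \<open>\<tau>\<close> are bounded, above by the linear bound on the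
  threshold and below by \<open>lam_lower\<close>, hence have a cluster point \<open>m\<close>. The
  bound of \<open>threshold_upper\<close>, divided by \<open>\<tau> n\<close>, places slope plus
  \<open>gap\<close> below \<open>\<beta>\<close> in the limit.\<close>

lemma gap_slope:
  obtains k m where "strict_mono k" "(\<lambda>n. slope (\<tau> (k n))) \<longlonglongrightarrow> m" "lower_slope (m + gap)"
proof -
  have \<tau>_pos: "\<tau> n > 0" and \<tau>_r: "\<tau> n \<le> r" for n
    using \<tau>(1)[of n] by auto
  have slope_le: "slope (\<tau> n) \<le> (\<Sigma> (\<tau> n) - \<Sigma> 0) / \<tau> n - gap" for n
  proof -
    have "(lam (\<tau> n) - \<Sigma> 0) / \<tau> n \<le> (\<Sigma> (\<tau> n) - \<Sigma> 0 - gap * \<tau> n) / \<tau> n"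
      using \<tau>(3)[of n] \<tau>_pos[of n] by (intro divide_right_mono) auto
    thus ?thesis
      using \<tau>_pos[of n] by (simp add: slope_def diff_divide_distrib)
  qed
  obtain M where M: "\<And>t. t \<in> {0..r} \<Longrightarrow> \<Sigma> t \<le> \<Sigma> 0 + t * M"
    using threshold_upper_ex by blast
  \<comment> \<open>\<open>- (K * B\<^sup>2)\<close> is a crude lower bound of \<open>a1\<close> at
    unit eigenvectors, \<open>2 * K * r * B\<^sup>2\<close> the error in \<open>lam_lower\<close> on
    the whole interval, and 1 makes the inequality strict.\<close>
  define q where "q = - (K * B\<^sup>2) - 2 * K * r * B\<^sup>2 - 1"
  have low: "q \<le> slope t" if t: "0 < t" "t < r" for t
  proof -
    have "\<Sigma> 0 + q * t \<le> lam t"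
    proof (rule lam_lower[where \<kappa> = "- (K * B\<^sup>2)"])
      fix s x assume "0 < s" "s < r" "unit_eig s x"
      thus "- (K * B\<^sup>2) \<le> Re (a1 x x)"
        using a1_self_bounded[OF unit_eigD(1) unit_eig_fnorm[of s x], of s] by simp
    qed (use t r in \<open>auto simp: q_def\<close>)
    thus ?thesis
      using t by (simp add: slope_def field_simps)
  qed
  \<comment> \<open>\<open>lam_lower\<close> applies strictly below \<open>r\<close>, hence the
    shift by \<open>N\<close>.\<close>
  obtain N where N: "\<And>n. n \<ge> N \<Longrightarrow> \<tau> n < r"
    using order_tendstoD(2)[OF \<tau>(2) r] by (auto simp: eventually_sequentially)
  have bd: "\<bar>slope (\<tau> (n + N))\<bar> \<le> \<bar>q\<bar> + \<bar>M\<bar>" for n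
  proof -
    have "slope (\<tau> (n + N)) \<le> M"
      using slope_le[of "n + N"] M[of "\<tau> (n + N)"] \<tau>_pos[of "n + N"] \<tau>_r[of "n + N"] gap
      by (smt (verit) atLeastAtMost_iff divide_right_mono nonzero_mult_div_cancel_left)
    moreover have "q \<le> slope (\<tau> (n + N))"
      using low N \<tau>_pos by simp
    ultimately show ?thesis by linarith
  qed
  obtain j m where j: "strict_mono j" "(\<lambda>n. slope (\<tau> (j n + N))) \<longlonglongrightarrow> m"
    using bounded_real_subseq[of "\<lambda>n. slope (\<tau> (n + N))", OF bd] .
  define k where "k n = j n + N" for n
  have k: "strict_mono k" "(\<lambda>n. slope (\<tau> (k n))) \<longlonglongrightarrow> m"
    using j by (simp_all add: k_def strict_mono_def)
  show ?thesis
  proof (rule that[OF k], unfold lower_slope_def, intro allI impI)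
    fix Y C \<beta>
    assume Y: "\<forall>n. Y n \<in> D" "\<forall>n. norm (Y n) = 1" "\<forall>n. E.fnorm (Y n) \<le> C" "weakly_tendsto Y 0"
      "(\<lambda>n. Re (b 0 (Y n) (Y n))) \<longlonglongrightarrow> \<Sigma> 0" "(\<lambda>n. Re (a1 (Y n) (Y n))) \<longlonglongrightarrow> \<beta>"
    note Y = Y(1-3)[rule_format] Y(4-6)
    have le: "slope (\<tau> n) + gap \<le> \<beta> + K * \<tau> n * C\<^sup>2" for n
    proof -
      have "\<Sigma> (\<tau> n) - \<Sigma> 0 \<le> \<tau> n * (\<beta> + K * \<tau> n * C\<^sup>2)"
        using threshold_upper[OF Y, of "\<tau> n"] \<tau>_pos[of n] \<tau>_r[of n] by (simp add: power2_eq_square algebra_simps)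
      hence "(\<Sigma> (\<tau> n) - \<Sigma> 0) / \<tau> n \<le> \<beta> + K * \<tau> n * C\<^sup>2"
        using \<tau>_pos[of n] by (simp add: divide_le_eq mult.commute)
      thus ?thesis
        using slope_le[of n] by linarith
    qed
    have "m + gap \<le> \<beta> + K * 0 * C\<^sup>2"
    proof (rule LIMSEQ_le)
      show "(\<lambda>n. slope (\<tau> (k n)) + gap) \<longlonglongrightarrow> m + gap"
        by (intro tendsto_intros k)
      show "(\<lambda>n. \<beta> + K * \<tau> (k n) * C\<^sup>2) \<longlonglongrightarrow> \<beta> + K * 0 * C\<^sup>2"
        by (intro tendsto_intros tendsto_subseq[OF \<tau>(2) k(1)])
    qed (use le in blast)
    thus "m + gap \<le> \<beta>" by simp
  qed
qed

lemma seq_at_right: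
  assumes "\<And>n. s n \<in> {0<..r}" "s \<longlonglongrightarrow> 0"
  shows "filterlim s (at_right 0) sequentially"
proof -
  have "s n \<in> {0<..} \<and> s n \<noteq> 0" for n
    using assms(1)[of n] by auto
  thus ?thesis
    unfolding filterlim_at using assms(2) by simp
qed

lemma lam_seq:
  assumes "\<And>n. s n \<in> {0<..r}" "s \<longlonglongrightarrow> 0"
  shows "(\<lambda>n. lam (s n)) \<longlonglongrightarrow> \<Sigma> 0"
  by (rule filterlim_compose[OF lam_lim seq_at_right[OF assms]])

text \<open>Tested against a kernel vector, the eigenvalue equation of \<open>X n\<close> loses its
  terms of order zero: by symmetry, the form at \<open>0\<close> becomes \<open>\<Sigma> 0\<close>
  times the inner product. Division by \<open>s n\<close> leaves \<open>slope\<close> and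
  \<open>a1\<close>, with an error of order \<open>s n\<close>.\<close>

lemma weak_limit_kernel:
  assumes s: "\<And>n. s n \<in> {0<..r}" "s \<longlonglongrightarrow> 0" and X: "\<And>n. unit_eig (s n) (X n)" "wlim X x"
    and \<mu>: "(\<lambda>n. slope (s n)) \<longlonglongrightarrow> \<mu>"
  shows "x \<in> kernel" "y \<in> kernel \<Longrightarrow> a1 x y = of_real \<mu> * cinner x y"
proof -
  have XD: "X n \<in> D" for n
    using X(1) unit_eigD by blast
  have xD: "x \<in> D"
    using X(2) by (simp add: wlim_def)
  have "b 0 x y = of_real (\<Sigma> 0) * cinner x y" if "y \<in> D" for y
    by (rule weak_limit_eigenvector[of 0 s X]) (use zero_r s X lam_seq[OF s] that in auto)
  thus "x \<in> kernel"
    using xD by (simp add: kernel_def)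
  assume y: "y \<in> kernel"
  hence yD: "y \<in> D"
    by (simp add: kernel_def)
  have bound: "cmod (of_real (slope (s n)) * cinner (X n) y - a1 (X n) y) \<le> s n * (K * B * E.fnorm y)" for n
  proof -
    have pos: "s n > 0" and sr: "s n \<in> {0..r}"
      using s(1)[of n] by auto
    have "b 0 y (X n) = of_real (\<Sigma> 0) * cinner y (X n)"
      using y XD by (simp add: kernel_def)
    hence "b 0 (X n) y = of_real (\<Sigma> 0) * cinner (X n) y"
      using b_commute[OF zero_r XD yD, of n] cinner_commute[of "X n" y] by simp
    hence "b (s n) (X n) y - b 0 (X n) y - of_real (s n - 0) * a1 (X n) y =
        of_real (s n) * (of_real (slope (s n)) * cinner (X n) y - a1 (X n) y)"
      using pos unit_eigD(3)[OF X(1) yD, of n] by (simp add: slope_def field_simps)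
    hence "s n * cmod (of_real (slope (s n)) * cinner (X n) y - a1 (X n) y) \<le> K * \<bar>s n - 0\<bar> * (s n + 0) * E.fnorm (X n) * E.fnorm y"
      using expansion[OF zero_r sr XD yD, of n] pos by (simp add: norm_mult)
    also have "\<dots> \<le> K * \<bar>s n - 0\<bar> * (s n + 0) * B * E.fnorm y"
      using K pos unit_eig_fnorm[OF s(1) X(1)] E.fnorm_nonneg[OF yD] by (intro mult_right_mono mult_left_mono) auto
    also have "\<dots> = s n * (s n * (K * B * E.fnorm y))"
      using pos by simp
    finally show ?thesis
      using pos by simp
  qed
  have "(\<lambda>n. of_real (slope (s n)) * cinner (X n) y - a1 (X n) y) \<longlonglongrightarrow> 0"
  proof (rule Lim_null_comparison)
    show "\<forall>\<^sub>F n in sequentially. norm (of_real (slope (s n)) * cinner (X n) y - a1 (X n) y) \<le> s n * (K * B * E.fnorm y)"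
      using bound by simp
    show "(\<lambda>n. s n * (K * B * E.fnorm y)) \<longlonglongrightarrow> 0"
      using tendsto_mult[OF s(2) tendsto_const[of "K * B * E.fnorm y"]] by simp
  qed
  moreover have "(\<lambda>n. of_real (slope (s n)) * cinner (X n) y - a1 (X n) y) \<longlonglongrightarrow> of_real \<mu> * cinner x y - a1 x y"
    by (intro tendsto_intros \<mu> wlim_cinner[OF X(2)] wlim_functional[OF X(2) functional_a1[OF yD]])
  ultimately have "0 = of_real \<mu> * cinner x y - a1 x y"
    by (rule LIMSEQ_unique)
  thus "a1 x y = of_real \<mu> * cinner x y" by simp
qed

text \<open>A nonzero weak limit would make \<open>\<mu>\<close> a kernel eigenvalue. So the
  eigenvectors are weakly null along a subsequence, and \<open>lower_slope\<close> applies to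
  them.\<close>

lemma slope_alternative:
  assumes s: "\<And>n. s n \<in> {0<..r}" "s \<longlonglongrightarrow> 0" and X: "\<And>n. unit_eig (s n) (X n)"
    and \<mu>: "(\<lambda>n. slope (s n)) \<longlonglongrightarrow> \<mu>" "\<not> kernel_eigenvalue \<mu>"
    and \<sigma>: "lower_slope \<sigma>" and \<kappa>: "\<And>n. Re (a1 (X n) (X n)) \<le> \<kappa>"
  shows "\<sigma> \<le> \<kappa>"
proof -
  have XD: "X n \<in> D" for n
    using X unit_eigD by blast
  have fX: "E.fnorm (X n) \<le> B" for n
    using unit_eig_fnorm[OF s(1) X] .
  obtain k x where k: "strict_mono k" and x: "wlim (\<lambda>n. X (k n)) x"
    by (rule wlim_subseq[of X B, OF XD fX])
  have sk: "(\<lambda>n. s (k n)) \<longlonglongrightarrow> 0"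
    by (rule tendsto_subseq[OF s(2) k])
  note ker = weak_limit_kernel[of "\<lambda>n. s (k n)" "\<lambda>n. X (k n)", OF s(1) sk X x tendsto_subseq[OF \<mu>(1) k]]
  have x0: "x = 0"
    using \<mu>(2) ker unfolding kernel_eigenvalue_def by blast
  have b0: "(\<lambda>n. Re (b 0 (X n) (X n))) \<longlonglongrightarrow> \<Sigma> 0"
    by (rule unit_eig_form_limit[OF zero_r s X lam_seq[OF s]])
  obtain j \<beta> where j: "strict_mono j" "(\<lambda>n. Re (a1 (X (k (j n))) (X (k (j n))))) \<longlonglongrightarrow> \<beta>"
    using bounded_real_subseq[of "\<lambda>n. Re (a1 (X (k n)) (X (k n)))", OF a1_self_bounded[OF XD fX]] .
  have "weakly_tendsto (\<lambda>n. X (k n)) 0"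
    using wlim_weakly[OF x] x0 by simp
  hence w: "weakly_tendsto (\<lambda>n. X (k (j n))) 0"
    using weakly_tendsto_subseq j(1) by blast
  have "\<sigma> \<le> \<beta>"
    by (rule lower_slopeD[where C = B, OF \<sigma> _ _ _ w tendsto_subseq[OF tendsto_subseq[OF b0 k] j(1)] j(2)])
      (simp_all add: XD fX unit_eigD(2)[OF X])
  also have "\<beta> \<le> \<kappa>"
    using LIMSEQ_le_const2[OF j(2)] \<kappa> by blast
  finally show ?thesis .
qed

text \<open>Uniformity in \<open>t\<close> by contradiction: violating parameters and eigenvectors
  form sequences for \<open>slope_alternative\<close>. \<open>P\<close> selects parameters at which
  the slope is known to converge: those with \<open>slope t = q\<close> before the limit is
  established, all of them afterwards.\<close>

lemma eventually_slope_bound: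
  assumes P: "\<And>s. (\<And>n. s n \<in> {0<..r}) \<Longrightarrow> (\<And>n. P (s n)) \<Longrightarrow> s \<longlonglongrightarrow> 0 \<Longrightarrow> (\<lambda>n. slope (s n)) \<longlonglongrightarrow> \<mu>"
    and \<mu>: "\<not> kernel_eigenvalue \<mu>" and \<sigma>: "lower_slope \<sigma>" "\<kappa> < \<sigma>" and \<eta>: "\<eta> > 0"
  obtains \<delta> where "0 < \<delta>" "\<delta> \<le> r" "2 * K * \<delta> * B\<^sup>2 < \<eta>"
    "\<And>t x. 0 < t \<Longrightarrow> t < \<delta> \<Longrightarrow> P t \<Longrightarrow> unit_eig t x \<Longrightarrow> \<kappa> \<le> Re (a1 x x)"
proof (rule ccontr)
  assume neg: "\<not> thesis"
  \<comment> \<open>The constant keeps \<open>2 * K * d n * B\<^sup>2\<close> within half of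
    \<open>\<eta>\<close>; the added 1 covers the case \<open>K * B\<^sup>2 = 0\<close>.\<close>
  define d where "d n = min r (\<eta> / (4 * (K * B\<^sup>2 + 1)) * inverse (real (Suc n)))" for n
  have KB: "K * B\<^sup>2 + 1 > 0"
    using K by (smt (verit) mult_nonneg_nonneg zero_le_power2)
  have d: "0 < d n" "d n \<le> r" for n
    using r \<eta> KB by (auto simp: d_def simp del: of_nat_Suc)
  have d': "2 * K * d n * B\<^sup>2 < \<eta>" for n
  proof -
    have "inverse (real (Suc n)) \<le> 1"
      by (simp add: field_simps)
    hence "d n \<le> \<eta> / (4 * (K * B\<^sup>2 + 1)) * 1"
      unfolding d_def using \<eta> KB by (intro order_trans[OF min.cobounded2] mult_left_mono) auto
    hence "(K * B\<^sup>2) * d n \<le> (K * B\<^sup>2) * (\<eta> / (4 * (K * B\<^sup>2 + 1)))"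
      using K by (intro mult_left_mono) auto
    also have "\<dots> \<le> (K * B\<^sup>2 + 1) * (\<eta> / (4 * (K * B\<^sup>2 + 1)))"
      using \<eta> KB by (intro mult_right_mono) auto
    also have "\<dots> = \<eta> / 4"
      using KB by (simp add: field_simps)
    finally show ?thesis
      using \<eta> by (simp add: mult.commute mult.left_commute)
  qed
  have "\<exists>t x. 0 < t \<and> t < d n \<and> P t \<and> unit_eig t x \<and> Re (a1 x x) \<le> \<kappa>" for n
    using neg that[OF d(1)[of n] d(2)[of n] d'[of n]] by (meson linear)
  then obtain s X where s: "\<And>n. 0 < s n" "\<And>n. s n < d n" "\<And>n. P (s n)" and X: "\<And>n. unit_eig (s n) (X n)"
    "\<And>n. Re (a1 (X n) (X n)) \<le> \<kappa>"
    by metis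
  have sr: "s n \<in> {0<..r}" for n
    using s(1,2)[of n] d(2)[of n] by auto
  have "s \<longlonglongrightarrow> 0"
  proof (rule Lim_null_comparison)
    have "\<bar>s n\<bar> \<le> \<eta> / (4 * (K * B\<^sup>2 + 1)) * inverse (real (Suc n))" for n
      using s(1)[of n] s(2)[of n] unfolding d_def by linarith
    thus "\<forall>\<^sub>F n in sequentially. norm (s n) \<le> \<eta> / (4 * (K * B\<^sup>2 + 1)) * inverse (real (Suc n))"
      by simp
    show "(\<lambda>n. \<eta> / (4 * (K * B\<^sup>2 + 1)) * inverse (real (Suc n))) \<longlonglongrightarrow> 0"
      by (rule tendsto_mult_right_zero[OF LIMSEQ_inverse_real_of_nat])
  qed
  from slope_alternative[OF sr this X(1) P[OF sr s(3) this] \<mu> \<sigma>(1) X(2)] \<sigma>(2)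
  show False by simp
qed

text \<open>
  Below \<open>\<sigma>\<close> and away from the eigenvalues of the compressed perturbation, \<open>slope\<close> can only cross a
  level upwards.
\<close>

lemma slope_no_oscillation:
  assumes \<sigma>: "lower_slope \<sigma>" "q < \<sigma>" and q: "\<not> kernel_eigenvalue q"
    and below: "\<exists>\<^sub>F t in at_right 0. slope t < q" and above: "\<exists>\<^sub>F t in at_right 0. q < slope t"
  shows False
proof -
  \<comment> \<open>The midpoint leaves room below \<open>\<sigma>\<close> for the bound on
    \<open>a1\<close> and above \<open>q\<close> for the error term.\<close>
  define \<kappa> where "\<kappa> = (q + \<sigma>) / 2"
  have \<kappa>: "\<kappa> < \<sigma>" "\<kappa> - q > 0"
    using \<sigma>(2) by (auto simp: \<kappa>_def field_simps)
  obtain \<delta> where \<delta>: "0 < \<delta>" "\<delta> \<le> r" "2 * K * \<delta> * B\<^sup>2 < \<kappa> - q"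
    "\<And>t x. 0 < t \<Longrightarrow> t < \<delta> \<Longrightarrow> slope t = q \<Longrightarrow> unit_eig t x \<Longrightarrow> \<kappa> \<le> Re (a1 x x)"
    using eventually_slope_bound[of "\<lambda>t. slope t = q", OF _ q \<sigma>(1) \<kappa>] by auto
  have "\<forall>\<^sub>F t in at_right 0. t \<in> {0<..<\<delta>}"
    using \<delta>(1) by (auto simp: eventually_at_right intro!: exI[of _ \<delta>])
  \<comment> \<open>The order of choice matters: \<open>t\<close> with slope below \<open>q\<close>
    comes first, then an earlier \<open>s\<close> with slope above it, so that the level would have
    to be crossed downwards.\<close>
  from frequently_ex[OF frequently_eventually_frequently[OF below this]]
  obtain t where t: "0 < t" "t < \<delta>" "slope t < q"
    by auto
  have "\<forall>\<^sub>F s in at_right 0. s \<in> {0<..<t}"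
    using t(1) by (auto simp: eventually_at_right intro!: exI[of _ t])
  from frequently_ex[OF frequently_eventually_frequently[OF above this]]
  obtain s where s: "0 < s" "s < t" "q < slope s"
    by auto
  have "lam t - \<Sigma> 0 - q * t \<ge> 0"
  proof (rule nonneg_crossing[where f = "\<lambda>u. lam u - \<Sigma> 0 - q * u" and s = s])
    have "continuous_on {s..t} lam"
      using lam_cont by (rule continuous_on_subset) (use s t \<delta> in auto)
    thus "continuous_on {s..t} (\<lambda>u. lam u - \<Sigma> 0 - q * u)"
      by (intro continuous_intros)
    show "0 \<le> lam s - \<Sigma> 0 - q * s"
      using s by (simp add: slope_def field_simps)
    fix u assume u: "s \<le> u" "u < t" "lam u - \<Sigma> 0 - q * u = 0"
    have "slope u = q"
      using u s by (simp add: slope_def field_simps)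
    moreover have "K * u * B\<^sup>2 \<le> K * \<delta> * B\<^sup>2"
      using K u t by (intro mult_right_mono mult_left_mono) auto
    ultimately have "\<forall>\<^sub>F v in at_right u. lam v - lam u > q * (v - u)"
      using u s t \<delta> by (intro lam_increase[of u \<kappa>] \<delta>(4)) auto
    thus "\<forall>\<^sub>F v in at_right u. 0 < lam v - \<Sigma> 0 - q * v"
      by eventually_elim (use u(3) in \<open>simp add: algebra_simps\<close>)
  qed (use s in auto)
  thus False
    using t by (simp add: slope_def field_simps)
qed

text \<open>
  Eigenvectors for distinct eigenvalues of the compressed perturbation are orthogonal, hence weakly
  null when normalized, so that their eigenvalues can only accumulate at \<open>\<sigma>\<close> or above.
\<close>

lemma non_kernel_eigenvalue_ex:
  assumes \<sigma>: "lower_slope \<sigma>" and lu: "l < u" "u \<le> \<sigma>"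
  obtains q where "l < q" "q < u" "\<not> kernel_eigenvalue q"
proof (rule ccontr)
  assume "\<not> thesis"
  hence all: "\<And>q. l < q \<Longrightarrow> q < u \<Longrightarrow> kernel_eigenvalue q"
    using that by blast
  \<comment> \<open>Distinct points of the interval tending to its left end;
    \<open>Suc (Suc n)\<close> keeps \<open>q 0\<close> below \<open>u\<close>. The left end will be
    the limit of the \<open>a1\<close>-values, and it lies below \<open>\<sigma>\<close>.\<close>
  define q where "q n = l + (u - l) * inverse (real (Suc (Suc n)))" for n
  have q: "l < q n" "q n < u" for n
  proof -
    have "(u - l) * inverse (real (Suc (Suc n))) < (u - l) * 1"
      using lu by (intro mult_strict_left_mono) (auto simp: field_simps)
    thus "q n < u" by (simp add: q_def)
    show "l < q n"
      using lu by (simp add: q_def del: of_nat_Suc)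
  qed
  have q_lim: "q \<longlonglongrightarrow> l + (u - l) * 0"
    unfolding q_def by (intro tendsto_intros LIMSEQ_Suc[OF LIMSEQ_inverse_real_of_nat])
  have "\<exists>x\<in>kernel. x \<noteq> 0 \<and> (\<forall>y\<in>kernel. a1 x y = of_real (q n) * cinner x y)" for n
    using all[OF q] unfolding kernel_eigenvalue_def .
  then obtain x where x: "\<And>n. x n \<in> kernel" "\<And>n. x n \<noteq> 0"
    "\<And>n y. y \<in> kernel \<Longrightarrow> a1 (x n) y = of_real (q n) * cinner (x n) y"
    by metis
  have xD: "x n \<in> D" for n
    using x(1) by (simp add: kernel_def)
  define v where "v n = (1 / norm (x n)) *\<^sub>R x n" for n
  have vD: "v n \<in> D" and v_norm: "norm (v n) = 1" for n
    using xD x(2) by (simp_all add: v_def)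
  have vv: "cinner (v n) (v n) = 1" for n
    using power2_norm_eq_cinner[of "v n"] v_norm by simp
  have b0_v: "b 0 (v n) (v n) = of_real (\<Sigma> 0)" for n
  proof -
    have "b 0 (v n) (v n) = of_real (1 / norm (x n)) * b 0 (x n) (v n)"
      unfolding v_def by (rule sesquilinear_form_scaleR(1)[OF form xD]) (use xD in simp)
    also have "b 0 (x n) (v n) = of_real (\<Sigma> 0) * cinner (x n) (v n)"
      using x(1)[of n] vD by (simp add: kernel_def)
    also have "of_real (1 / norm (x n)) * (of_real (\<Sigma> 0) * cinner (x n) (v n)) = of_real (\<Sigma> 0) * cinner (v n) (v n)"
      unfolding v_def by (simp add: hilbert.scaleR_left)
    finally show ?thesis
      by (simp add: vv)
  qed
  have a1_v: "a1 (v n) (v n) = of_real (q n)" for n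
  proof -
    have "a1 (v n) (v n) = of_real (1 / norm (x n)) * (of_real (1 / norm (x n)) * a1 (x n) (x n))"
      unfolding v_def using xD by (simp add: sesquilinear_form_scaleR[OF a1_sesq])
    also have "\<dots> = of_real (q n) * cinner (v n) (v n)"
      using x(3)[OF x(1), of n n] by (simp add: v_def hilbert.scaleR_left hilbert.scaleR_right)
    finally show ?thesis
      by (simp add: vv)
  qed
  have orth: "cinner (v n) (v m) = 0" if "n \<noteq> m" for n m
  proof -
    have "of_real (q n) * cinner (x n) (x m) = cnj (a1 (x m) (x n))"
      using x(3)[OF x(1), of n m] a1_commute[OF xD xD, of n m] by simp
    also have "\<dots> = of_real (q m) * cinner (x n) (x m)"
      using x(3)[OF x(1), of m n] cinner_commute[of "x n" "x m"] by simp
    finally have "of_real (q n - q m) * cinner (x n) (x m) = 0"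
      by (simp add: left_diff_distrib)
    moreover have "q n \<noteq> q m"
      using that lu by (simp add: q_def)
    ultimately have "cinner (x n) (x m) = 0"
      by simp
    thus ?thesis
      by (simp add: v_def hilbert.scaleR_left hilbert.scaleR_right)
  qed
  have "(\<lambda>n. cinner (v n) (v i)) \<longlonglongrightarrow> 0" for i
  proof (rule tendsto_eventually)
    show "\<forall>\<^sub>F n in sequentially. cinner (v n) (v i) = 0"
      using eventually_gt_at_top[of i] by eventually_elim (simp add: orth)
  qed
  then obtain k where k: "strict_mono k" "weakly_tendsto (\<lambda>n. v (k n)) 0"
    using almost_orthogonal_weakly_null[of v 1] v_norm by auto
  have fv: "E.fnorm (v n) \<le> sqrt (\<Sigma> 0 + c)" for n
    using fnorm_sq[OF vD, of n] by (intro real_le_rsqrt) (simp add: b0_v v_norm)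
  have "\<sigma> \<le> l + (u - l) * 0"
  proof (rule lower_slopeD[where C = "sqrt (\<Sigma> 0 + c)", OF \<sigma> _ _ _ k(2)])
    show "(\<lambda>n. Re (a1 (v (k n)) (v (k n)))) \<longlonglongrightarrow> l + (u - l) * 0"
      using tendsto_subseq[OF q_lim k(1)] by (simp add: a1_v)
  qed (simp_all add: vD v_norm fv b0_v)
  thus False
    using lu by simp
qed

theorem slope_tendsto:
  obtains m where "(slope \<longlongrightarrow> m) (at_right 0)" "kernel_eigenvalue m"
proof -
  obtain k m where k: "strict_mono k" "(\<lambda>n. slope (\<tau> (k n))) \<longlonglongrightarrow> m" and \<sigma>: "lower_slope (m + gap)"
    by (rule gap_slope)
  \<comment> \<open>The sequence with limit \<open>m\<close> supplies one half of an oscillation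
    across a level, and failure of convergence supplies the other.\<close>
  have freq: "\<exists>\<^sub>F t in at_right 0. P (slope t)" if "\<forall>\<^sub>F n in sequentially. P (slope (\<tau> (k n)))" for P
  proof (rule ccontr)
    assume "\<not> ?thesis"
    hence "\<forall>\<^sub>F t in at_right 0. \<not> P (slope t)"
      by (simp add: frequently_def)
    moreover have "filterlim (\<lambda>n. \<tau> (k n)) (at_right 0) sequentially"
      by (rule seq_at_right[OF \<tau>(1) tendsto_subseq[OF \<tau>(2) k(1)]])
    ultimately have "\<forall>\<^sub>F n in sequentially. \<not> P (slope (\<tau> (k n)))"
      using eventually_compose_filterlim by blast
    with that have "\<forall>\<^sub>F n in sequentially. False"
      by eventually_elim simp
    thus False by simp
  qed
  have lim: "(slope \<longlongrightarrow> m) (at_right 0)"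
  proof (rule order_tendstoI; rule ccontr)
    fix a assume a: "a < m" "\<not> (\<forall>\<^sub>F t in at_right 0. a < slope t)"
    obtain q where q: "a < q" "q < m" "\<not> kernel_eigenvalue q"
      using non_kernel_eigenvalue_ex[OF \<sigma> a(1)] gap by auto
    have "\<exists>\<^sub>F t in at_right 0. slope t < q"
      using a(2) unfolding not_eventually by (rule frequently_elim1) (use q in auto)
    moreover have "\<exists>\<^sub>F t in at_right 0. q < slope t"
      by (rule freq[OF order_tendstoD(1)[OF k(2) q(2)]])
    ultimately show False
      using slope_no_oscillation[OF \<sigma> _ q(3)] q gap by auto
  next
    fix a assume a: "m < a" "\<not> (\<forall>\<^sub>F t in at_right 0. slope t < a)"
    \<comment> \<open>The level has to stay below \<open>m + gap\<close>, the range in which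
      downward crossings are excluded.\<close>
    obtain q where q: "m < q" "q < min a (m + gap)" "\<not> kernel_eigenvalue q"
      using non_kernel_eigenvalue_ex[OF \<sigma>, of m "min a (m + gap)"] a(1) gap by auto
    have "\<exists>\<^sub>F t in at_right 0. q < slope t"
      using a(2) unfolding not_eventually by (rule frequently_elim1) (use q in auto)
    moreover have "\<exists>\<^sub>F t in at_right 0. slope t < q"
      by (rule freq[OF order_tendstoD(2)[OF k(2) q(1)]])
    ultimately show False
      using slope_no_oscillation[OF \<sigma> _ q(3)] q by auto
  qed
  moreover have "kernel_eigenvalue m"
  proof (rule ccontr)
    assume m: "\<not> kernel_eigenvalue m"
    have slope_seq: "(\<lambda>n. slope (s n)) \<longlonglongrightarrow> m" if "\<And>n. s n \<in> {0<..r}" "\<And>n :: nat. True" "s \<longlonglongrightarrow> 0" for s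
      by (rule filterlim_compose[OF lim seq_at_right[OF that(1,3)]])
    \<comment> \<open>Half of the gap separates \<open>\<kappa>\<close> from \<open>m + gap\<close>,
      a quarter absorbs the error term, and the last quarter contradicts the limit
      \<open>m\<close>.\<close>
    have lt: "m + gap / 2 < m + gap" "gap / 4 > 0"
      using gap by auto
    show False
    proof (rule eventually_slope_bound[where P = "\<lambda>_. True", OF slope_seq m \<sigma> lt])
      fix \<delta>
      assume \<delta>: "0 < \<delta>" "\<delta> \<le> r" "2 * K * \<delta> * B\<^sup>2 < gap / 4"
        "\<And>t x. 0 < t \<Longrightarrow> t < \<delta> \<Longrightarrow> True \<Longrightarrow> unit_eig t x \<Longrightarrow> m + gap / 2 \<le> Re (a1 x x)"
      have "m + gap / 4 \<le> slope t" if t: "0 < t" "t < \<delta>" for t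
      proof -
        have "\<Sigma> 0 + (m + gap / 4) * t \<le> lam t"
          by (rule lam_lower[OF \<delta>(1,2) \<delta>(4)[OF _ _ TrueI] _ t]) (use \<delta>(3) in auto)
        thus ?thesis
          using t by (simp add: slope_def field_simps)
      qed
      hence "\<forall>\<^sub>F t in at_right 0. m + gap / 4 \<le> slope t"
        using \<delta>(1) by (auto simp: eventually_at_right intro!: exI[of _ \<delta>])
      hence "m + gap / 4 \<le> m"
        by (rule tendsto_lowerbound[OF lim]) simp
      thus False
        using gap by simp
    qed
  qed
  ultimately show ?thesis
    using that by blast
qed

section \<open>The projection onto the eigenspace and the compressed operator\<close>

lemma kernel_eq: "kernel = op_kernel (DT 0) (\<lambda>x. T 0 x - of_real (\<Sigma> 0) *\<^sub>C x)"
  using eigenvector_iff unfolding kernel_def op_kernel_def by (auto simp: set_eq_iff)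

lemma kernel_iff: "x \<in> kernel \<longleftrightarrow> x \<in> DT 0 \<and> T 0 x = of_real (\<Sigma> 0) *\<^sub>C x"
  using eigenvector_iff by (simp add: kernel_def)

lemma kernel_csubspace: "csubspace kernel"
  using E.sub unfolding csubspace_def kernel_def
  by (auto simp: sesquilinear_formD[OF form] cinner_add_left cinner_scaleC_left algebra_simps
      sesquilinear_form_scaleR(1)[OF form, of 0 _ 0, simplified])

text \<open>Closedness is needed for the ambient norm, in which \<open>P\<close> projects. It comes
  from the adjoint graph: testing with \<open>u\<close> in \<open>DT 0\<close> moves the operator to
  \<open>u\<close>, and the equation passes to the limit.\<close>

lemma kernel_closed:
  assumes X: "\<And>n. X n \<in> kernel" "(\<lambda>n. norm (X n - x)) \<longlonglongrightarrow> 0"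
  shows "x \<in> kernel"
proof -
  have lim: "(\<lambda>n. cinner (X n) y) \<longlonglongrightarrow> cinner x y" for y
    by (rule hilbert.tendsto_form_left) (use X in auto)
  have "cinner (T 0 u) x = cinner u (of_real (\<Sigma> 0) *\<^sub>C x)" if u: "u \<in> DT 0" for u
  proof -
    have "cinner (X n) (T 0 u) = of_real (\<Sigma> 0) * cinner (X n) u" for n
    proof -
      have "X n \<in> D" "u \<in> D"
        using X(1)[of n] u dom_sub by (auto simp: kernel_def)
      thus ?thesis
        using op_form'[OF u \<open>X n \<in> D\<close>] X(1)[of n] s_commute[of u "X n"] cinner_commute[of "X n" "T 0 u"]
        by (simp add: kernel_def)
    qed
    hence "(\<lambda>n. cinner (X n) (T 0 u)) \<longlonglongrightarrow> of_real (\<Sigma> 0) * cinner x u"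
      using tendsto_mult_left[OF lim[of u]] by simp
    hence "cinner x (T 0 u) = of_real (\<Sigma> 0) * cinner x u"
      using lim LIMSEQ_unique by blast
    thus ?thesis
      using cinner_commute[of "T 0 u" x] cinner_commute[of u x] by (simp add: cinner_scaleC_right)
  qed
  hence "(x, of_real (\<Sigma> 0) *\<^sub>C x) \<in> adjoint_graph (DT 0) (T 0)"
    by (simp add: adjoint_graph_def)
  thus ?thesis
    using selfadjoint by (auto simp: selfadjoint_op_def op_graph_def kernel_iff)
qed

abbreviation P :: "'a \<Rightarrow> 'a" where "P \<equiv> orth_proj kernel"

lemma proj_unique:
  assumes p: "p \<in> kernel" "\<And>m. m \<in> kernel \<Longrightarrow> cinner (x - p) m = 0"
  shows "P x = p"
  unfolding orth_proj_def
proof (rule the_equality)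
  show "p \<in> kernel \<and> (\<forall>m\<in>kernel. cinner (x - p) m = 0)"
    using p by blast
  fix p' assume p': "p' \<in> kernel \<and> (\<forall>m\<in>kernel. cinner (x - p') m = 0)"
  have pp: "p' - p \<in> kernel"
    using p' p csubspace_diff[OF kernel_csubspace] by blast
  have "cinner (p' - p) (p' - p) = cinner (x - p) (p' - p) - cinner (x - p') (p' - p)"
    by (simp flip: hilbert.diff_left)
  also have "\<dots> = 0"
    using p(2)[OF pp] p' pp by simp
  finally have "(norm (p' - p))\<^sup>2 = 0"
    by (simp flip: Re_cinner_self)
  thus "p' = p" by simp
qed

lemma proj: "P x \<in> kernel" "m \<in> kernel \<Longrightarrow> cinner (x - P x) m = 0"
proof -
  obtain p where p: "p \<in> kernel" "\<And>m. m \<in> kernel \<Longrightarrow> cinner m (x - p) = 0"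
    by (rule hilbert.projection[OF kernel_csubspace, of x]) (use kernel_closed in auto)
  have "cinner (x - p) m = 0" if "m \<in> kernel" for m
    using p(2)[OF that] cinner_commute[of "x - p" m] by simp
  moreover from proj_unique[OF p(1) this] have "P x = p" .
  ultimately show "P x \<in> kernel" "m \<in> kernel \<Longrightarrow> cinner (x - P x) m = 0"
    using p by auto
qed

lemma proj_add: "P (x + y) = P x + P y"
proof (rule proj_unique)
  show "P x + P y \<in> kernel"
    using proj csubspace_add[OF kernel_csubspace] by blast
  fix m assume "m \<in> kernel"
  thus "cinner (x + y - (P x + P y)) m = 0"
    using proj(2)[of m x] proj(2)[of m y] by (simp add: hilbert.diff_left cinner_add_left)
qed

lemma proj_scaleC: "P (d *\<^sub>C x) = d *\<^sub>C P x"
proof (rule proj_unique)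
  show "d *\<^sub>C P x \<in> kernel"
    using proj csubspace_scaleC[OF kernel_csubspace] by blast
  fix m assume "m \<in> kernel"
  thus "cinner (d *\<^sub>C x - d *\<^sub>C P x) m = 0"
    using proj(2)[of m x] by (simp add: hilbert.diff_left cinner_scaleC_left)
qed

lemma proj_ident: "x \<in> kernel \<Longrightarrow> P x = x"
  by (rule proj_unique) auto

lemma proj_D: "P x \<in> D"
  using proj(1) by (simp add: kernel_def)

lemma proj_norm: "norm (P x) \<le> norm x"
proof -
  have "(norm (P x))\<^sup>2 = Re (cinner x (P x))"
    using proj(2)[OF proj(1), of x x] by (simp add: hilbert.diff_left flip: Re_cinner_self)
  also have "\<dots> \<le> norm x * norm (P x)"
    by (rule hilbert.Re_le_fnorm) auto
  finally show ?thesis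
    by (cases "norm (P x) = 0") (simp_all add: power2_eq_square)
qed

text \<open>On the kernel, the squared energy norm is \<open>\<Sigma> 0 + c\<close> times the
  squared ambient norm, so the energy bound on \<open>a1\<close> becomes an ambient one.\<close>

lemma compression_bound: "cmod (a1 (P x) (P y)) \<le> (K * \<bar>\<Sigma> 0 + c\<bar>) * norm x * norm y"
proof -
  have f: "E.fnorm (P x) \<le> sqrt \<bar>\<Sigma> 0 + c\<bar> * norm x" for x
  proof -
    have "b 0 (P x) (P x) = of_real (\<Sigma> 0) * cinner (P x) (P x)"
      using proj(1)[of x] by (simp add: kernel_def)
    hence "(E.fnorm (P x))\<^sup>2 = (\<Sigma> 0 + c) * (norm (P x))\<^sup>2"
      using fnorm_sq[OF proj_D, of x] by (simp add: Re_cinner_self algebra_simps)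
    also have "\<dots> \<le> \<bar>\<Sigma> 0 + c\<bar> * (norm x)\<^sup>2"
      using proj_norm[of x] by (intro mult_mono power_mono) auto
    also have "\<dots> = (sqrt \<bar>\<Sigma> 0 + c\<bar> * norm x)\<^sup>2"
      by (simp add: power_mult_distrib)
    finally show ?thesis
      by (rule power2_le_imp_le) simp
  qed
  have "cmod (a1 (P x) (P y)) \<le> K * E.fnorm (P x) * E.fnorm (P y)"
    by (intro a1_bound proj_D)
  also have "\<dots> \<le> K * (sqrt \<bar>\<Sigma> 0 + c\<bar> * norm x) * (sqrt \<bar>\<Sigma> 0 + c\<bar> * norm y)"
    using K f E.fnorm_nonneg[OF proj_D] by (intro mult_mono mult_nonneg_nonneg) auto
  also have "\<dots> = (K * \<bar>\<Sigma> 0 + c\<bar>) * norm x * norm y"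
    by (simp add: algebra_simps flip: real_sqrt_mult)
  finally show ?thesis .
qed

lemma cinner_ext: "(\<And>y. cinner x y = cinner z y) \<Longrightarrow> x = z"
proof -
  assume "\<And>y. cinner x y = cinner z y"
  hence "cinner (x - z) (x - z) = 0"
    by (simp add: hilbert.diff_left)
  hence "(norm (x - z))\<^sup>2 = 0"
    by (simp flip: Re_cinner_self)
  thus "x = z" by simp
qed

text \<open>Riesz representation in the ambient space yields \<open>B0\<close>. A kernel eigenvector
  \<open>x\<close> is fixed by \<open>P\<close>, and orthogonality of \<open>y - P y\<close> to
  \<open>x\<close> extends its equation from kernel vectors to all \<open>y\<close>.\<close>

lemma compression:
  obtains B0 where "bounded_linear B0" "selfadjoint_op UNIV B0" "\<And>x y. cinner (B0 x) y = a1 (P x) (P y)"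
    "\<And>\<mu>. kernel_eigenvalue \<mu> \<Longrightarrow> eigenvalue UNIV B0 (of_real \<mu>)"
proof -
  have "\<exists>z. \<forall>y. cinner z y = a1 (P x) (P y)" for x
  proof -
    have "hilbert.functional (\<lambda>y. cnj (a1 (P x) (P y)))"
      unfolding hilbert.functional_def using compression_bound[of x] proj_D
      by (auto simp: proj_add proj_scaleC sesquilinear_formD[OF a1_sesq] intro!: exI[of _ "K * \<bar>\<Sigma> 0 + c\<bar> * norm x"])
    then obtain z where "\<And>y. cnj (a1 (P x) (P y)) = cinner y z"
      using hilbert.riesz by (metis UNIV_I)
    hence "cinner z y = a1 (P x) (P y)" for y
      using cinner_commute[of z y] by (metis complex_cnj_cnj)
    thus ?thesis by blast
  qed
  then obtain B0 where B0: "\<And>x y. cinner (B0 x) y = a1 (P x) (P y)"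
    by metis
  have add: "B0 (x + y) = B0 x + B0 y" for x y
    by (rule cinner_ext) (simp add: B0 cinner_add_left proj_add proj_D sesquilinear_formD[OF a1_sesq])
  have scale: "B0 (d *\<^sub>C x) = d *\<^sub>C B0 x" for d x
    by (rule cinner_ext) (simp add: B0 cinner_scaleC_left proj_scaleC proj_D sesquilinear_formD[OF a1_sesq])
  have bound: "norm (B0 x) \<le> norm x * (K * \<bar>\<Sigma> 0 + c\<bar>)" for x
  proof -
    have "(norm (B0 x))\<^sup>2 \<le> cmod (cinner (B0 x) (B0 x))"
      using complex_Re_le_cmod by (simp flip: Re_cinner_self)
    also have "\<dots> \<le> (K * \<bar>\<Sigma> 0 + c\<bar>) * norm x * norm (B0 x)"
      unfolding B0 by (rule compression_bound)
    finally show ?thesis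
      using K by (cases "norm (B0 x) = 0") (simp_all add: power2_eq_square mult.commute)
  qed
  have "bounded_linear B0"
    by (rule bounded_linear_intro[OF add _ bound]) (use scale[of "of_real r" for r] in \<open>simp add: scaleC_of_real\<close>)
  moreover have sym: "cinner (B0 x) y = cinner x (B0 y)" for x y
    using B0[of x y] B0[of y x] a1_commute[OF proj_D proj_D, of x y] cinner_commute[of x "B0 y"] by simp
  have "selfadjoint_op UNIV B0"
    unfolding selfadjoint_op_def
  proof (intro conjI)
    show "clinear_on UNIV B0"
      by (simp add: clinear_on_def add scale)
    show "adjoint_graph UNIV B0 = op_graph UNIV B0"
    proof (rule set_eqI)
      fix p :: "'a \<times> 'a"
      obtain y z where p: "p = (y, z)" by (cases p)
      have "(\<forall>x. cinner (B0 x) y = cinner x z) \<longleftrightarrow> z = B0 y"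
      proof
        assume "\<forall>x. cinner (B0 x) y = cinner x z"
        hence "cinner z x = cinner (B0 y) x" for x
          using sym[of x y] cinner_commute[of z x] cinner_commute[of "B0 y" x] by simp
        thus "z = B0 y" by (rule cinner_ext)
      qed (simp add: sym)
      thus "p \<in> adjoint_graph UNIV B0 \<longleftrightarrow> p \<in> op_graph UNIV B0"
        by (simp add: p adjoint_graph_def op_graph_def)
    qed
  qed (simp_all add: csubspace_UNIV)
  moreover note B0
  moreover have "eigenvalue UNIV B0 (of_real \<mu>)" if \<mu>: "kernel_eigenvalue \<mu>" for \<mu>
  proof -
    obtain x where x: "x \<in> kernel" "x \<noteq> 0" "\<And>y. y \<in> kernel \<Longrightarrow> a1 x y = of_real \<mu> * cinner x y"
      using \<mu> unfolding kernel_eigenvalue_def by metis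
    have "B0 x = of_real \<mu> *\<^sub>C x"
    proof (rule cinner_ext)
      fix y
      have "cinner x (P y) = cinner x y"
        using proj(2)[OF x(1), of y] cinner_commute[of x "y - P y"] by (simp add: hilbert.diff_right)
      thus "cinner (B0 x) y = cinner (of_real \<mu> *\<^sub>C x) y"
        using x(3)[OF proj(1)] by (simp add: B0 proj_ident[OF x(1)] cinner_scaleC_left)
    qed
    with x(2) show ?thesis
      by (auto simp: eigenvalue_def)
  qed
  ultimately show ?thesis
    using that by blast
qed

lemma kernel_eigenvalue_imp: "kernel_eigenvalue \<mu> \<Longrightarrow> eigenvalue (DT 0) (T 0) (of_real (\<Sigma> 0))"
  unfolding kernel_eigenvalue_def eigenvalue_def using kernel_iff by blast

end

section \<open>Estimates from holomorphy and from the lower limit\<close>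

text \<open>Mean value estimate on the segment between the parameters, after subtracting the linear
  part at \<open>t0\<close>; what is left of the derivative is at most a multiple of the distance to
  \<open>t0\<close>. The factor \<open>\<bar>t - s\<bar>\<close> in the bound is what lets
  \<open>lam_increase\<close> cancel \<open>s - t\<close> at a positive parameter.\<close>

lemma holomorphic_first_order:
  assumes f: "f holomorphic_on U" and U: "open U" and \<rho>: "cball (of_real t0) \<rho> \<subseteq> U"
  obtains C where "\<And>s t. s \<in> {0..\<rho>} \<Longrightarrow> t \<in> {0..\<rho>} \<Longrightarrow>
    cmod (f (of_real (t0 + t)) - f (of_real (t0 + s)) - of_real (t - s) * deriv f (of_real t0)) \<le> C * \<bar>t - s\<bar> * (t + s)"
proof -
  let ?S = "cball (complex_of_real t0) \<rho>"
  have df: "deriv f holomorphic_on U" and ddf: "deriv (deriv f) holomorphic_on U"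
    using f U by (auto intro: holomorphic_deriv)
  have "continuous_on ?S (deriv (deriv f))"
    using holomorphic_on_imp_continuous_on[OF ddf] \<rho> by (rule continuous_on_subset)
  hence "bounded (deriv (deriv f) ` ?S)"
    by (intro compact_imp_bounded compact_continuous_image) auto
  then obtain C where C: "\<And>z. z \<in> ?S \<Longrightarrow> cmod (deriv (deriv f) z) \<le> C"
    unfolding bounded_iff by blast
  have lip: "cmod (deriv f z - deriv f (of_real t0)) \<le> C * cmod (z - of_real t0)" if "z \<in> ?S" for z
  proof (rule field_differentiable_bound[of ?S "deriv f" "deriv (deriv f)"])
    fix w assume "w \<in> ?S"
    thus "(deriv f has_field_derivative deriv (deriv f) w) (at w within ?S)"
      using df U \<rho> by (meson has_field_derivative_at_within holomorphic_derivI subsetD)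
  next
    have "0 \<le> cmod (z - of_real t0)" by simp
    also have "\<dots> \<le> \<rho>"
      using that by (simp add: dist_norm norm_minus_commute)
    finally show "of_real t0 \<in> ?S" by simp
  qed (use C that in auto)
  show ?thesis
  proof (rule that[of C])
    fix s t assume s: "s \<in> {0..\<rho>}" and t: "t \<in> {0..\<rho>}"
    define g where "g z = f z - z * deriv f (of_real t0)" for z
    define M where "M = max s t"
    let ?L = "closed_segment (complex_of_real (t0 + s)) (of_real (t0 + t))"
    have C0: "C \<ge> 0"
      using order_trans[OF norm_ge_zero C[of "of_real t0"]] s by simp
    have L: "cmod (z - of_real t0) \<le> M" if "z \<in> ?L" for z
    proof -
      have "?L \<subseteq> cball (of_real t0) M"
        using s t by (intro closed_segment_subset) (auto simp: M_def dist_norm)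
      thus ?thesis
        using that by (auto simp: dist_norm norm_minus_commute)
    qed
    have LS: "?L \<subseteq> ?S"
      using s t by (intro closed_segment_subset) (auto simp: dist_norm)
    have "cmod (g (of_real (t0 + t)) - g (of_real (t0 + s))) \<le> (C * M) * cmod (of_real (t0 + t) - of_real (t0 + s))"
    proof (rule field_differentiable_bound[of ?L g "\<lambda>z. deriv f z - deriv f (of_real t0)"])
      fix w assume w: "w \<in> ?L"
      hence "(f has_field_derivative deriv f w) (at w)"
        using f U \<rho> LS by (meson holomorphic_derivI subsetD)
      hence "(g has_field_derivative deriv f w - 1 * deriv f (of_real t0)) (at w)"
        unfolding g_def by (intro DERIV_diff DERIV_cmult_right DERIV_ident)
      thus "(g has_field_derivative deriv f w - deriv f (of_real t0)) (at w within ?L)"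
        by (simp add: has_field_derivative_at_within)
      show "cmod (deriv f w - deriv f (of_real t0)) \<le> C * M"
        using lip[of w] L[OF w] LS w C0 by (meson mult_left_mono order_trans subsetD)
    qed auto
    also have "cmod (of_real (t0 + t) - of_real (t0 + s)) = \<bar>t - s\<bar>"
      by (simp flip: of_real_diff)
    also have "C * M * \<bar>t - s\<bar> \<le> C * (t + s) * \<bar>t - s\<bar>"
      using s t C0 by (intro mult_right_mono mult_left_mono) (auto simp: M_def)
    finally show "cmod (f (of_real (t0 + t)) - f (of_real (t0 + s)) - of_real (t - s) * deriv f (of_real t0))
        \<le> C * \<bar>t - s\<bar> * (t + s)"
      by (simp add: g_def algebra_simps)
  qed
qed

lemma Liminf_neg_sequence:
  fixes f :: "real \<Rightarrow> real"
  assumes L: "Liminf (at_right t0) (\<lambda>t. ereal (f t)) < 0" and d: "d > 0"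
  obtains gap \<tau> where "gap > 0" "\<And>n. \<tau> n \<in> {0<..d}" "\<tau> \<longlonglongrightarrow> 0" "\<And>n. f (t0 + \<tau> n) \<le> - gap"
proof -
  have "\<not> 0 \<le> Liminf (at_right t0) (\<lambda>t. ereal (f t))"
    using L by simp
  then obtain y where y: "y < 0" "\<not> (\<forall>\<^sub>F t in at_right t0. y < ereal (f t))"
    unfolding le_Liminf_iff by blast
  \<comment> \<open>The level \<open>y\<close> is an extended real; a real \<open>z\<close> between
    it and 0 provides \<open>gap\<close> as \<open>- z\<close>.\<close>
  obtain z where z: "y < ereal z" "ereal z < 0"
    using ereal_dense2[OF y(1)] by blast
  have "\<exists>t>t0. t < t0 + min d (inverse (real (Suc n))) \<and> f t \<le> z" for n
  proof (rule ccontr)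
    assume "\<not> ?thesis"
    hence "\<forall>\<^sub>F t in at_right t0. z < f t"
      unfolding eventually_at_right_field using d
      by (intro exI[of _ "t0 + min d (inverse (real (Suc n)))"]) (auto simp: not_le simp del: of_nat_Suc)
    hence "\<forall>\<^sub>F t in at_right t0. y < ereal (f t)"
      by eventually_elim (use z(1) in \<open>auto intro: less_trans\<close>)
    with y(2) show False ..
  qed
  then obtain u where u: "\<And>n. t0 < u n" "\<And>n. u n < t0 + min d (inverse (real (Suc n)))" "\<And>n. f (u n) \<le> z"
    by metis
  show ?thesis
  proof (rule that[of "- z" "\<lambda>n. u n - t0"])
    show "- z > 0"
      using z(2) by simp
    show "u n - t0 \<in> {0<..d}" for n
      using u(1)[of n] u(2)[of n] by auto
    show "(\<lambda>n. u n - t0) \<longlonglongrightarrow> 0"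
    proof (rule Lim_null_comparison[OF _ LIMSEQ_inverse_real_of_nat])
      have "\<bar>u n - t0\<bar> \<le> inverse (real (Suc n))" for n
        using u(1)[of n] u(2)[of n] by auto
      thus "\<forall>\<^sub>F n in sequentially. norm (u n - t0) \<le> inverse (real (Suc n))"
        by simp
    qed
  qed (use u(3) in simp)
qed

section \<open>Reduction to a parameter interval starting at zero\<close>

theorem corollary4p3:
  fixes U :: "complex set"
    and D :: "'a :: complex_hilbert set"
    and a :: "complex \<Rightarrow> 'a \<Rightarrow> 'a \<Rightarrow> complex"
    and DA :: "real \<Rightarrow> 'a set"
    and A :: "real \<Rightarrow> 'a \<Rightarrow> 'a"
    and \<Sigma> lam :: "real \<Rightarrow> real"
    and t0 \<epsilon> :: real
    and P :: "'a \<Rightarrow> 'a"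
  assumes "t0 < \<epsilon>"
    and "complex_of_real ` {t0..<\<epsilon>} \<subseteq> U"
    and "selfadjoint_family_B U D a DA A"
    and "\<And>t. t \<in> {t0..<\<epsilon>} \<Longrightarrow> is_min_of (\<Sigma> t) (ess_spectrum (DA t) (A t))"
    and "\<And>t. t \<in> {t0<..<\<epsilon>} \<Longrightarrow> lam t < \<Sigma> t"
    and "\<And>t. t \<in> {t0<..<\<epsilon>} \<Longrightarrow> eigenvalue (DA t) (A t) (complex_of_real (lam t))"
    and "continuous_on {t0<..<\<epsilon>} lam"
    and "(lam \<longlongrightarrow> \<Sigma> t0) (at_right t0)"
    and "Liminf (at_right t0) (\<lambda>t. ereal ((lam t - \<Sigma> t) / (t - t0))) < 0"
  defines "P \<equiv> orth_proj (op_kernel (DA t0) (\<lambda>x. A t0 x - complex_of_real (\<Sigma> t0) *\<^sub>C x))"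
  shows "eigenvalue (DA t0) (A t0) (complex_of_real (\<Sigma> t0)) \<and>
    (\<exists>B0. bounded_linear B0 \<and> selfadjoint_op UNIV B0 \<and>
       (\<forall>x y. cinner (B0 x) y = form_coeff a (complex_of_real t0) 1 (P x) (P y)) \<and>
       (\<exists>\<mu>. ((\<lambda>t. (lam t - \<Sigma> t0) / (t - t0)) \<longlongrightarrow> \<mu>) (at_right t0) \<and>
            eigenvalue UNIV B0 (complex_of_real \<mu>)))"
proof -
  have U: "open U" and closed: "\<And>z. z \<in> U \<Longrightarrow> closed_sectorial_form D (a z)"
    and holo: "\<And>x y. x \<in> D \<Longrightarrow> y \<in> D \<Longrightarrow> (\<lambda>z. a z x y) holomorphic_on U"
    and sa: "\<And>t. complex_of_real t \<in> U \<Longrightarrow> symmetric_form D (a (of_real t))"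
      "\<And>t. complex_of_real t \<in> U \<Longrightarrow> form_operator D (a (of_real t)) (DA t) (A t)"
    using assms(3) by (auto simp: selfadjoint_family_B_def holomorphic_family_a_def)
  have "complex_of_real t0 \<in> U"
    using assms(1,2) by auto
  then obtain \<rho> where \<rho>: "\<rho> > 0" "cball (complex_of_real t0) \<rho> \<subseteq> U"
    using U open_contains_cball by blast
  \<comment> \<open>Half the length keeps a closed interval of parameters inside the half-open
    one.\<close>
  define R where "R = min \<rho> ((\<epsilon> - t0) / 2)"
  have R: "R > 0" "R \<le> \<rho>"
    using \<rho>(1) assms(1) by (auto simp: R_def)
  have in_I: "t0 + t < \<epsilon>" if "t \<le> R" for t
    using that assms(1) by (auto simp: R_def field_simps)
  define b where "b t = a (complex_of_real (t0 + t))" for t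
  define a1 where "a1 = form_coeff a (complex_of_real t0) 1"
  have pair: "\<exists>c. form_operator_pair D (b t) (DA (t0 + t)) (A (t0 + t)) c" if t: "t \<in> {0..R}" for t
  proof -
    have "complex_of_real (t0 + t) \<in> U"
      using subsetD[OF assms(2) imageI[of "t0 + t"]] t in_I[of t] by simp
    from form_operator_pair_ex[OF closed[OF this] sa[OF this]] show ?thesis
      unfolding b_def by blast
  qed
  obtain c where "form_operator_pair D (b 0) (DA (t0 + 0)) (A (t0 + 0)) c"
    using pair[of 0] R by auto
  then interpret p0: form_operator_pair D "b 0" "DA (t0 + 0)" "A (t0 + 0)" c .
  have pw: "\<exists>C. \<forall>s\<in>{0..R}. \<forall>t\<in>{0..R}.
      cmod (b t x y - b s x y - of_real (t - s) * a1 x y) \<le> C * \<bar>t - s\<bar> * (t + s)" if xy: "x \<in> D" "y \<in> D" for x y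
  proof -
    obtain C where "\<And>s t. s \<in> {0..\<rho>} \<Longrightarrow> t \<in> {0..\<rho>} \<Longrightarrow>
      cmod (a (of_real (t0 + t)) x y - a (of_real (t0 + s)) x y - of_real (t - s) * deriv (\<lambda>z. a z x y) (of_real t0))
        \<le> C * \<bar>t - s\<bar> * (t + s)"
      using holomorphic_first_order[OF holo[OF xy] U \<rho>(2)] by blast
    thus ?thesis
      using R(2) by (intro exI[of _ C]) (auto simp: b_def a1_def form_coeff_def fps_expansion_def)
  qed
  obtain K where K: "K \<ge> 0" "sesquilinear_form D a1" "symmetric_form D a1"
    "\<And>x y. x \<in> D \<Longrightarrow> y \<in> D \<Longrightarrow> cmod (a1 x y) \<le> K * p0.E.fnorm x * p0.E.fnorm y"
    "\<And>s t x y. s \<in> {0..R} \<Longrightarrow> t \<in> {0..R} \<Longrightarrow> x \<in> D \<Longrightarrow> y \<in> D \<Longrightarrow>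
      cmod (b t x y - b s x y - of_real (t - s) * a1 x y) \<le> K * \<bar>t - s\<bar> * (t + s) * p0.E.fnorm x * p0.E.fnorm y"
    using p0.E.uniform_expansion[of R b "\<lambda>t. DA (t0 + t)" "\<lambda>t. A (t0 + t)" a1, OF R(1) pair pw] by blast
  have "\<forall>\<^sub>F t in at_right t0. lam t < \<Sigma> t0 + 1"
    by (rule order_tendstoD(2)[OF assms(8)]) simp
  then obtain d where d: "d > t0" "\<And>t. t0 < t \<Longrightarrow> t < d \<Longrightarrow> lam t < \<Sigma> t0 + 1"
    by (auto simp: eventually_at_right_field)
  \<comment> \<open>The last bound makes the change of the form at most half of the squared energy
    norm, so that it can be absorbed; the bound with \<open>d\<close> keeps \<open>lam\<close> below
    \<open>\<Sigma> t0 + 1\<close>.\<close>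
  define r where "r = min (min R ((d - t0) / 2)) (1 / (2 * (K * (1 + R) + 1)))"
  have KR: "K * (1 + R) \<ge> 0"
    using K(1) R(1) by simp
  have r: "r > 0" "r \<le> R" "r < d - t0"
    using R(1) d(1) KR by (auto simp: r_def min_less_iff_disj)
  have r_small: "K * (1 + R) * r \<le> 1 / 2"
  proof -
    have "K * (1 + R) * r \<le> (K * (1 + R) + 1) * (1 / (2 * (K * (1 + R) + 1)))"
      using KR r(1) by (intro mult_mono) (auto simp: r_def)
    also have "\<dots> = 1 / 2"
      using KR by (simp add: field_simps)
    finally show ?thesis .
  qed
  \<comment> \<open>For a unit eigenvector with squared energy norm \<open>F\<close>, smallness of
    \<open>r\<close> gives \<open>F \<le> lam (t0 + t) + F / 2 + c\<close>; solving for
    \<open>F\<close> leads to this constant.\<close>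
  define B where "B = sqrt (2 * (\<bar>\<Sigma> t0\<bar> + 1 + \<bar>c\<bar>))"
  have eig_bound: "p0.E.fnorm x \<le> B"
    if t: "t \<in> {0<..r}" and x: "x \<in> D" "norm x = 1" "b t x x = of_real (lam (t0 + t))" for t x
  proof -
    let ?F = "(p0.E.fnorm x)\<^sup>2"
    have "cmod (b t x x - b 0 x x - of_real (t - 0) * a1 x x) \<le> K * \<bar>t - 0\<bar> * (t + 0) * p0.E.fnorm x * p0.E.fnorm x"
      using t r x by (intro K(5)) auto
    moreover have "cmod (of_real (t - 0) * a1 x x) \<le> t * (K * p0.E.fnorm x * p0.E.fnorm x)"
      using K(4)[OF x(1,1)] t by (simp add: norm_mult mult_left_mono)
    moreover have "cmod (b t x x - b 0 x x) \<le> cmod (b t x x - b 0 x x - of_real (t - 0) * a1 x x) + cmod (of_real (t - 0) * a1 x x)"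
      using norm_triangle_ineq[of "b t x x - b 0 x x - of_real (t - 0) * a1 x x" "of_real (t - 0) * a1 x x"] by simp
    ultimately have "cmod (b t x x - b 0 x x) \<le> (K * (1 + t) * t) * ?F"
      using t by (simp add: power2_eq_square algebra_simps)
    also have "\<dots> \<le> (K * (1 + R) * r) * ?F"
      using K(1) t r by (intro mult_right_mono mult_mono mult_left_mono) auto
    also have "\<dots> \<le> 1 / 2 * ?F"
      using r_small by (intro mult_right_mono) auto
    finally have "\<bar>lam (t0 + t) - Re (b 0 x x)\<bar> \<le> ?F / 2"
      using abs_Re_le_cmod[of "b t x x - b 0 x x"] x(3) by simp
    moreover have "?F = Re (b 0 x x) + c"
      using p0.fnorm_sq[OF x(1)] x(2) by simp
    moreover have "lam (t0 + t) < \<Sigma> t0 + 1"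
      using d(2)[of "t0 + t"] t r by auto
    ultimately have "?F \<le> 2 * (\<bar>\<Sigma> t0\<bar> + 1 + \<bar>c\<bar>)"
      by argo
    thus ?thesis
      unfolding B_def by (rule real_le_rsqrt)
  qed
  obtain gap \<tau> where \<tau>: "gap > 0" "\<And>n. \<tau> n \<in> {0<..r}" "\<tau> \<longlonglongrightarrow> 0"
    "\<And>n. (lam (t0 + \<tau> n) - \<Sigma> (t0 + \<tau> n)) / (t0 + \<tau> n - t0) \<le> - gap"
    using Liminf_neg_sequence[OF assms(9) r(1)] by blast
  interpret threshold D b "\<lambda>t. DA (t0 + t)" "\<lambda>t. A (t0 + t)" c a1 "\<lambda>t. \<Sigma> (t0 + t)" "\<lambda>t. lam (t0 + t)" r K B gap \<tau>
  proof unfold_locales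
    show "continuous_on {0<..r} (\<lambda>t. lam (t0 + t))"
      using r(2) in_I[of r] by (intro continuous_on_compose2[OF assms(7)] continuous_intros) auto
    show "lam (t0 + \<tau> n) \<le> \<Sigma> (t0 + \<tau> n) - gap * \<tau> n" for n
      using \<tau>(4)[of n] \<tau>(2)[of n] by (simp add: field_simps)
    show "B \<ge> 0"
      by (simp add: B_def)
    show "((\<lambda>t. lam (t0 + t)) \<longlongrightarrow> \<Sigma> (t0 + 0)) (at_right 0)"
      using assms(8) by (simp add: filterlim_at_right_to_0[of lam _ t0] add.commute)
    show "\<exists>c. form_operator_pair D (b t) (DA (t0 + t)) (A (t0 + t)) c" if "t \<in> {0..r}" for t
      using pair that r by simp
    show "cmod (b t x y - b s x y - of_real (t - s) * a1 x y) \<le> K * \<bar>t - s\<bar> * (t + s) * p0.E.fnorm x * p0.E.fnorm y"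
      if "s \<in> {0..r}" "t \<in> {0..r}" "x \<in> D" "y \<in> D" for s t x y
      using K(5) that r by simp
    show "is_min_of (\<Sigma> (t0 + t)) (ess_spectrum (DA (t0 + t)) (A (t0 + t)))" if "t \<in> {0..r}" for t
      using assms(4) in_I that r by simp
    show "lam (t0 + t) < \<Sigma> (t0 + t)" if "t \<in> {0<..r}" for t
      using assms(5) in_I that r by simp
    show "eigenvalue (DA (t0 + t)) (A (t0 + t)) (of_real (lam (t0 + t)))" if "t \<in> {0<..r}" for t
      using assms(6) in_I that r by simp
  qed (fact r K \<tau> eig_bound)+
  obtain m where m: "(slope \<longlongrightarrow> m) (at_right 0)" "kernel_eigenvalue m"
    by (rule slope_tendsto)
  obtain B0 where B0: "bounded_linear B0" "selfadjoint_op UNIV B0"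
    "\<And>x y. cinner (B0 x) y = a1 (orth_proj kernel x) (orth_proj kernel y)"
    "\<And>\<mu>. kernel_eigenvalue \<mu> \<Longrightarrow> eigenvalue UNIV B0 (of_real \<mu>)"
    using compression by blast
  have "P = orth_proj kernel"
    unfolding P_def kernel_eq by simp
  hence "\<And>x y. cinner (B0 x) y = form_coeff a (complex_of_real t0) 1 (P x) (P y)"
    using B0(3) by (simp only: a1_def)
  moreover have "((\<lambda>t. (lam t - \<Sigma> t0) / (t - t0)) \<longlongrightarrow> m) (at_right t0)"
    using m(1) unfolding filterlim_at_right_to_0[of _ _ t0] slope_def[abs_def] by (simp add: add.commute)
  moreover have "eigenvalue (DA t0) (A t0) (of_real (\<Sigma> t0))"
    using kernel_eigenvalue_imp[OF m(2)] by simp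
  ultimately show ?thesis
    using B0(1,2) B0(4)[OF m(2)] by blast
qed

end
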